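(* Let $k\ge 2$ and $r\ge k+1$ be integers. For every $c\in\mathbb{N}$ there exists $\ell_0$ such that for every integer $\ell\ge \ell_0$ there exists $C_0$ such that for every real $C\ge C_0$ there exist $n_0\in\mathbb{N}$ and $\varepsilon_0>0$ such that the following holds for all $n\ge n_0$ and $0<\varepsilon\le\varepsilon_0$. Let $G$ be an $(\ell,c,C,\varepsilon)$-clique-regular $k$-graph on vertex set $[n]$ such that every set $S\subseteq V(G)$ with $S\in E(G)$ or $|S|<k$ is contained in the vertex set of some copy of $K_r$ in $G$. Let $\varphi$ be the globally-balanced uniform $K_r$-function on $G$. Then the sequence $(\mathcal{P}_{k,\ell}^t\varphi)_{t\ge 0}$ converges, as $t\to\infty$, to a fractional $K_r$-decomposition of $G$.
   Context: **Basics.** For integers $a,b$ write $[a,b]=\{x\in\mathbb{Z}:a\le x\le b\}$, $[a]=[1,a]$. A $k$-graph is a $k$-uniform hypergraph. $G$ has vertex set $[n]$ with the usual ordering. $K_r$ denotes the complete $k$-graph on $r$ vertices; a clique on fewer than $k$ vertices has no edges. For $A\subseteq V(G)$, $K_r(A)$ is the set of copies of $K_r$ in $G$ (as subhypergraphs) whose vertex set contains $A$; $K_r(G)=K_r(\emptyset)$. Put $E_k=E(G)$ and $E_j=\binom{V(G)}{j}$ for $j\in[0,k-1]$. For $S\subseteq V(G)$, $|S|\le k$, $N_G^{\mathrm e}(S)=\{e\in E(G):S\subseteq e\}$. Write $a=(1\pm\varepsilon)b$ for $(1-\varepsilon)b\le a\le(1+\varepsilon)b$. For $\zeta:E_j^2\to\mathbb{R}$,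 $\|\zeta\|=\max_{S}\sum_{T}|\zeta(S,T)|$. For a finite ordered set $S=\{x_1,\dots,x_j\}$ and $U\subseteq S$, $\iota(U,S)=\{i\in[j]:x_i\in U\}$; subsets of $V(G)=[n]$ carry the usual ordering. **$K_r$-functions.** A $K_r$-function on $G$ is a map $\varphi:K_r(G)\to\mathbb{R}$. For $e\in E(G)$, $\varphi(e)=\sum_{K\in K_r(e)}\varphi(K)$. The discrepancy is $\xi(e)=\xi[\varphi](e)=\xi^{(k)}[\varphi](e)=\varphi(e)-1$, and for $j\in[0,k-1]$, $|S|=j$, $\xi^{(j)}[\varphi](S)=\sum_{e\in N_G^{\mathrm e}(S)}\xi(e)$. $\varphi$ is globally-balanced if $\sum_{K\in K_r(G)}\varphi(K)=\binom{r}{k}^{-1}|E(G)|$; uniform if it is constant (so there is a unique globally-balanced uniform $K_r$-function). It is a fractional $K_r$-decomposition if it is non-negative and $\varphi(e)=1$ for all $e\in E(G)$. **Distributors.** For $s\in[k]$ define $\mathcal{R}_s:\mathbb{R}^{K_r(G)}\to\mathbb{R}^{K_r(G)}$ by $$\mathcal{R}_s[\varphi](K)=\varphi(K)-\frac{1}{\binom{r-s}{k-s}}\sum_{S\in\binom{V(K)}{s}}\frac{\xi^{(s)}[\varphi](S)}{|K_r(S)|}.$$ For $\ell\in\mathbb{N}$ let $\mathcal{P}_{0,\ell}$ be the identity and $\mathcal{P}_{s,\ell}=(\mathcal{R}_s^{\ell}\mathcal{P}_{s-1,\ell})^{\ell}$ for $s\in[k]$. Convergence is in the finite-dimensional space $\mathbb{R}^{K_r(G)}$.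 **Clique-paths.** Let $j\in[k]$, $\ell\ge0$. A $j$-clique-path of length $\ell$ is a pair $\mathbf{F}=((F_i)_{i\in[\ell]},\mathbf{S})$, $\mathbf{S}=(S_i)_{i\in[0,\ell]}$, where the $F_i$ are copies of $K_r$ and the $S_i$ (the root sets) are pairwise distinct ordered sets of size $j$, such that, writing $F_0,F_{\ell+1}$ for the cliques on vertex sets $S_0,S_\ell$ respectively, $$V((F_1\cup\dots\cup F_i)\cap F_{i+1})\subseteq V(F_i\cap F_{i+1})\subseteq S_i\subseteq V(F_{i+1})\quad\text{for each }i\in[0,\ell],$$ and the orderings of $S_i,S_{i'}$ agree on $S_i\cap S_{i'}$ for all $i,i'$. Put $F=F_1\cup\dots\cup F_{\ell+1}$, $s_i=|V(F_i\cap F_{i+1})|$ for $i\in[\ell]$, $\mathbf{s}(F)=(s_i)_{i\in[\ell]}$; $\mathbf{F}$ is also written $(F,\mathbf{S})$. Two $j$-clique-paths $(F,\mathbf{S}),(F',\mathbf{S}')$ are isomorphic if there is a hypergraph isomorphism $F\to F'$ mapping each $S_i$ to $S_i'$ order-preservingly; clique-paths are considered up to isomorphism. They are semi-isomorphic if there is a hypergraph isomorphism $F\to F'$ mapping each $S_i$ onto $S_i'$ as sets and $S_0$ to $S_0'$ order-preservingly. A semi-ordered $j$-clique-path is an equivalence class $\mathcal{F}$ under semi-isomorphism (a set of isomorphism classes of $j$-clique-paths), identified with $(F,\overline{\mathbf{S}})$ where only $\overline S_0$ is ordered; $\iota(\mathcal{F})=\iota(\overline S_0\cap\overline S_\ell,\overline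 S_0)$. **Semi-copies and weights.** For $S',T'\in E_j$, a homomorphism from $\mathbf{F}$ to $G$ rooted at $S',T'$ is a (not necessarily injective) hypergraph homomorphism $\Phi:F\to G$ mapping $S_0$ onto $S'$ and $S_\ell$ onto $T'$, with $\Phi\restriction_{S_i}$ injective and order-preserving for each $i\in[0,\ell]$. Two such are equivalent if they differ only by permutations of the sets $V(F_i)\setminus(S_{i-1}\cup S_i)$, $i\in[\ell]$ (equivalently, by an automorphism of the clique-path $\mathbf{F}$); an equivalence class is a semi-copy, and $X_G(S',T',\mathbf{F})$ is the set of semi-copies. The weight of a semi-copy $\Phi$ is $$w(\Phi)=\prod_{i=1}^{\ell}\frac{\hat w_{s_i}}{|K_r(\Phi(V(F_i\cap F_{i+1})))|},\qquad \hat w_s=-\binom{r-s}{j-s}^{-1},$$ (empty product $=1$). Put $\Xi[\mathbf{F}](S,T)=\sum_{\Phi\in X_G(S,T,\mathbf{F})}w(\Phi)$ for $S,T\in E_j$, and $\Xi[\mathcal{F}]=\sum_{\mathbf{F}\in\mathcal{F}}\Xi[\mathbf{F}]$. **Centred.** For a hypergraph $H$, $U\subseteq V(H)$ and distinct $x,y$, a $U$-avoiding walk of length $d$ from $x$ to $y$ is a sequence $x=v_0,\dots,v_d=y$ in $V(H)\setminus U$ such that for each $i\in[d]$ some edge of $H$ contains $v_{i-1},v_i$ (edges may meet $U$; repetitions allowed). For $b,c\in\mathbb{N}_0$, a $j$-clique-path $(F,\mathbf{S})$ of length $\ell$ is $(b,c)$-centred if $|S_0\cap S_\ell|=b$ and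 for all $x\in S_0\setminus S_\ell$, $y\in S_\ell\setminus S_0$, every $(S_0\cap S_\ell)$-avoiding walk from $x$ to $y$ in $F$ has length at least $c$. This is invariant under semi-isomorphism and so is defined for semi-ordered clique-paths. **Clique-regularity.** Put $\gamma_j=|K_r(G)|\binom{r}{j}/|E_j|$ and $d_j=|E(G)|\binom{k}{j}/|E_j|$ for $j\in[0,k]$. For $\ell,c\in\mathbb{N}$, $C,\varepsilon>0$, $G$ is $(\ell,c,C,\varepsilon)$-clique-regular if: (R1) $|N_G^{\mathrm e}(S)|=(1\pm\varepsilon)d_{k-1}$ for all $S\in E_{k-1}$; (R2) $|K_r(e)|=(1\pm\varepsilon)\gamma_k$ for all $e\in E(G)$; (R3) for all $0\le b<j\le k$ and every $(b,c)$-centred semi-ordered $j$-clique-path $\mathcal{F}$ of length at most $\ell^{3k}$ there exist $\alpha_{\mathcal F}\in\mathbb{R}$ with $|\alpha_{\mathcal F}|\le C$ and $\zeta_{\mathcal F}:E_j^2\to\mathbb{R}$ with $\|\zeta_{\mathcal F}\|\le\varepsilon$ such that $\Xi[\mathcal{F}](S,T)=\alpha_{\mathcal F}\frac{\gamma_j}{\gamma_b}+\zeta_{\mathcal F}(S,T)$ for all $S,T\in E_j$ with $\iota(\mathcal{F})\subseteq\iota(S\cap T,S)$. *)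

theory Defs
  imports Complex_Main "HOL-Library.Ramsey" "HOL-Combinatorics.Permutations"
begin

section \<open>Hypergraphs and cliques\<close>

text \<open>All vertices are natural numbers. The host graph has vertex set \<open>{1..n}\<close> and uses
  the usual order; for the abstract hypergraphs underlying clique-paths the natural numbers
  are just names. \<open>nsets A m\<close> is the set of \<open>m\<close>-element subsets of \<open>A\<close>.\<close>

record hgraph =
  verts :: "nat set"
  edges :: "nat set set"

definition kgraph :: "nat \<Rightarrow> hgraph \<Rightarrow> bool" where
  "kgraph k G \<longleftrightarrow> finite (verts G) \<and> edges G \<subseteq> nsets (verts G) k"

definition hgraph_iso :: "hgraph \<Rightarrow> hgraph \<Rightarrow> (nat \<Rightarrow> nat) \<Rightarrow> bool" where
  "hgraph_iso H H' f \<longleftrightarrow> bij_betw f (verts H) (verts H') \<and> (\<lambda>e. f ` e) ` edges H = edges H'"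

text \<open>A copy of \<open>K\<^sub>r\<close> is determined by its vertex set, so it is represented by that set.
  \<open>cliques k r G A\<close> is the set \<open>K\<^sub>r(A)\<close>; \<open>K\<^sub>r(G)\<close> is \<open>cliques k r G {}\<close>.\<close>

definition cliques :: "nat \<Rightarrow> nat \<Rightarrow> hgraph \<Rightarrow> nat set \<Rightarrow> nat set set" where
  "cliques k r G A = {K \<in> nsets (verts G) r. nsets K k \<subseteq> edges G \<and> A \<subseteq> K}"

definition Ej :: "nat \<Rightarrow> hgraph \<Rightarrow> nat \<Rightarrow> nat set set" where
  "Ej k G j = (if j = k then edges G else nsets (verts G) j)"

definition enbhd :: "hgraph \<Rightarrow> nat set \<Rightarrow> nat set set" where
  "enbhd G S = {e \<in> edges G. S \<subseteq> e}"

definition approx_within :: "real \<Rightarrow> real \<Rightarrow> real \<Rightarrow> bool" where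
  "approx_within a \<epsilon> b \<longleftrightarrow> (1 - \<epsilon>) * b \<le> a \<and> a \<le> (1 + \<epsilon>) * b"

text \<open>The norm of a function on pairs from \<open>E\<^sub>j\<close>; meaningful only when \<open>E\<^sub>j\<close> is finite and
  nonempty.\<close>

definition pair_norm :: "nat set set \<Rightarrow> (nat set \<Rightarrow> nat set \<Rightarrow> real) \<Rightarrow> real" where
  "pair_norm X \<zeta> = Max ((\<lambda>S. \<Sum>T\<in>X. \<bar>\<zeta> S T\<bar>) ` X)"

text \<open>Ordered sets are distinct lists; a set \<open>S\<close> of vertices of the host graph is ordered as
  \<open>sorted_list_of_set S\<close>. Positions are counted from 1.\<close>

definition iota :: "nat set \<Rightarrow> nat list \<Rightarrow> nat set" where
  "iota U xs = {i \<in> {1..length xs}. xs ! (i - 1) \<in> U}"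


section \<open>\<open>K\<^sub>r\<close>-functions and distributors\<close>

text \<open>A \<open>K\<^sub>r\<close>-function is a function on vertex sets of which only the values on
  \<open>cliques k r G {}\<close> are ever used.\<close>

definition edge_weight ::
    "nat \<Rightarrow> nat \<Rightarrow> hgraph \<Rightarrow> (nat set \<Rightarrow> real) \<Rightarrow> nat set \<Rightarrow> real" where
  "edge_weight k r G \<phi> e = (\<Sum>K\<in>cliques k r G e. \<phi> K)"

definition discrepancy ::
    "nat \<Rightarrow> nat \<Rightarrow> hgraph \<Rightarrow> nat \<Rightarrow> (nat set \<Rightarrow> real) \<Rightarrow> nat set \<Rightarrow> real" where
  "discrepancy k r G j \<phi> S =
     (if j = k then edge_weight k r G \<phi> S - 1
      else (\<Sum>e\<in>enbhd G S. (edge_weight k r G \<phi> e - 1)))"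

definition globally_balanced :: "nat \<Rightarrow> nat \<Rightarrow> hgraph \<Rightarrow> (nat set \<Rightarrow> real) \<Rightarrow> bool" where
  "globally_balanced k r G \<phi> \<longleftrightarrow>
     (\<Sum>K\<in>cliques k r G {}. \<phi> K) = inverse (real (r choose k)) * real (card (edges G))"

definition uniform :: "nat \<Rightarrow> nat \<Rightarrow> hgraph \<Rightarrow> (nat set \<Rightarrow> real) \<Rightarrow> bool" where
  "uniform k r G \<phi> \<longleftrightarrow> (\<exists>a. \<forall>K\<in>cliques k r G {}. \<phi> K = a)"

definition fractional_decomposition ::
    "nat \<Rightarrow> nat \<Rightarrow> hgraph \<Rightarrow> (nat set \<Rightarrow> real) \<Rightarrow> bool" where
  "fractional_decomposition k r G \<phi> \<longleftrightarrow>
     (\<forall>K\<in>cliques k r G {}. 0 \<le> \<phi> K) \<and> (\<forall>e\<in>edges G. edge_weight k r G \<phi> e = 1)"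

definition distributor ::
    "nat \<Rightarrow> nat \<Rightarrow> hgraph \<Rightarrow> nat \<Rightarrow> (nat set \<Rightarrow> real) \<Rightarrow> (nat set \<Rightarrow> real)" where
  "distributor k r G s \<phi> = (\<lambda>K. \<phi> K - 1 / real ((r - s) choose (k - s)) *
     (\<Sum>S\<in>nsets K s. discrepancy k r G s \<phi> S / real (card (cliques k r G S))))"

primrec iterated_distributor ::
    "nat \<Rightarrow> nat \<Rightarrow> hgraph \<Rightarrow> nat \<Rightarrow> nat \<Rightarrow> (nat set \<Rightarrow> real) \<Rightarrow> (nat set \<Rightarrow> real)" where
  "iterated_distributor k r G l 0 = id"
| "iterated_distributor k r G l (Suc s) =
     ((distributor k r G (Suc s) ^^ l) \<circ> iterated_distributor k r G l s) ^^ l"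


section \<open>Clique-paths\<close>

text \<open>A candidate clique-path is a pair \<open>(Fs, Ss)\<close> listing the vertex sets of
  \<open>F\<^sub>1, \<dots>, F\<^sub>l\<close> and the ordered root sets \<open>S\<^sub>0, \<dots>, S\<^sub>l\<close>.\<close>

type_synonym cpath = "nat set list \<times> nat list list"

definition plen :: "cpath \<Rightarrow> nat" where
  "plen P = length (fst P)"

definition root_seq :: "cpath \<Rightarrow> nat \<Rightarrow> nat list" where
  "root_seq P i = snd P ! i"

definition rset :: "cpath \<Rightarrow> nat \<Rightarrow> nat set" where
  "rset P i = set (root_seq P i)"

text \<open>\<open>pverts P i\<close> is \<open>V(F\<^sub>i)\<close> for \<open>0 \<le> i \<le> l + 1\<close>.\<close>

definition pverts :: "cpath \<Rightarrow> nat \<Rightarrow> nat set" where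
  "pverts P i = (if i = 0 then rset P 0
                 else if i \<le> plen P then fst P ! (i - 1)
                 else rset P (plen P))"

definition clique_path :: "nat \<Rightarrow> nat \<Rightarrow> cpath \<Rightarrow> bool" where
  "clique_path r j P \<longleftrightarrow>
     length (snd P) = plen P + 1 \<and>
     (\<forall>i\<in>{1..plen P}. finite (pverts P i) \<and> card (pverts P i) = r) \<and>
     (\<forall>i\<le>plen P. distinct (root_seq P i) \<and> length (root_seq P i) = j) \<and>
     (\<forall>i\<le>plen P. \<forall>i'\<le>plen P. i \<noteq> i' \<longrightarrow> root_seq P i \<noteq> root_seq P i') \<and>
     (\<forall>i\<le>plen P.
        (\<Union>m\<in>{1..i}. pverts P m) \<inter> pverts P (i + 1) \<subseteq> pverts P i \<inter> pverts P (i + 1) \<and>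
        pverts P i \<inter> pverts P (i + 1) \<subseteq> rset P i \<and>
        rset P i \<subseteq> pverts P (i + 1)) \<and>
     (\<forall>i\<le>plen P. \<forall>i'\<le>plen P.
        filter (\<lambda>x. x \<in> rset P i') (root_seq P i) = filter (\<lambda>x. x \<in> rset P i) (root_seq P i'))"

text \<open>The hypergraph \<open>F = F\<^sub>1 \<union> \<dots> \<union> F\<^sub>l\<^sub>+\<^sub>1\<close>. If \<open>j < k\<close>, the last clique has no edges.\<close>

definition phgraph :: "nat \<Rightarrow> cpath \<Rightarrow> hgraph" where
  "phgraph k P = \<lparr> verts = (\<Union>i\<in>{1..plen P + 1}. pverts P i),
                   edges = (\<Union>i\<in>{1..plen P + 1}. nsets (pverts P i) k) \<rparr>"

definition overlap :: "cpath \<Rightarrow> nat \<Rightarrow> nat set" where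
  "overlap P i = pverts P i \<inter> pverts P (i + 1)"

definition iso_rel :: "nat \<Rightarrow> nat \<Rightarrow> nat \<Rightarrow> (cpath \<times> cpath) set" where
  "iso_rel k r j = {(P, Q). clique_path r j P \<and> clique_path r j Q \<and> plen P = plen Q \<and>
     (\<exists>f. hgraph_iso (phgraph k P) (phgraph k Q) f \<and>
          (\<forall>i\<le>plen P. map f (root_seq P i) = root_seq Q i))}"

definition semi_iso_rel :: "nat \<Rightarrow> nat \<Rightarrow> nat \<Rightarrow> (cpath \<times> cpath) set" where
  "semi_iso_rel k r j = {(P, Q). clique_path r j P \<and> clique_path r j Q \<and> plen P = plen Q \<and>
     (\<exists>f. hgraph_iso (phgraph k P) (phgraph k Q) f \<and>
          map f (root_seq P 0) = root_seq Q 0 \<and>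
          (\<forall>i\<le>plen P. f ` rset P i = rset Q i))}"

text \<open>The semi-ordered clique-path represented by \<open>P\<close>: the finite set of isomorphism classes
  of clique-paths semi-isomorphic to \<open>P\<close>.\<close>

definition semi_ordered :: "nat \<Rightarrow> nat \<Rightarrow> nat \<Rightarrow> cpath \<Rightarrow> cpath set set" where
  "semi_ordered k r j P = (semi_iso_rel k r j `` {P}) // iso_rel k r j"

definition iota_path :: "cpath \<Rightarrow> nat set" where
  "iota_path P = iota (rset P 0 \<inter> rset P (plen P)) (root_seq P 0)"


section \<open>Semi-copies and weights\<close>

text \<open>Homomorphisms are extensional functions on \<open>V(F)\<close>, so that they can be counted.
  The condition \<open>sorted_wrt (<)\<close> says that the map is injective and order-preserving on each
  root set.\<close>

definition rooted_homs ::
    "nat \<Rightarrow> hgraph \<Rightarrow> cpath \<Rightarrow> nat set \<Rightarrow> nat set \<Rightarrow> (nat \<Rightarrow> nat) set" where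
  "rooted_homs k G P S T =
     {\<Phi> \<in> verts (phgraph k P) \<rightarrow>\<^sub>E verts G.
        (\<forall>e\<in>edges (phgraph k P). \<Phi> ` e \<in> edges G) \<and>
        \<Phi> ` rset P 0 = S \<and> \<Phi> ` rset P (plen P) = T \<and>
        (\<forall>i\<le>plen P. sorted_wrt (<) (map \<Phi> (root_seq P i)))}"

definition free_block :: "cpath \<Rightarrow> nat \<Rightarrow> nat set" where
  "free_block P i = pverts P i - (rset P (i - 1) \<union> rset P i)"

definition semi_copy_rel ::
    "nat \<Rightarrow> hgraph \<Rightarrow> cpath \<Rightarrow> nat set \<Rightarrow> nat set \<Rightarrow> ((nat \<Rightarrow> nat) \<times> (nat \<Rightarrow> nat)) set" where
  "semi_copy_rel k G P S T =
     {(\<Phi>, \<Psi>). \<Phi> \<in> rooted_homs k G P S T \<and> \<Psi> \<in> rooted_homs k G P S T \<and>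
        (\<exists>\<sigma>. \<sigma> permutes (\<Union>i\<in>{1..plen P}. free_block P i) \<and>
             (\<forall>i\<in>{1..plen P}. \<sigma> ` free_block P i = free_block P i) \<and>
             \<Psi> = \<Phi> \<circ> \<sigma>)}"

definition semi_copies ::
    "nat \<Rightarrow> hgraph \<Rightarrow> cpath \<Rightarrow> nat set \<Rightarrow> nat set \<Rightarrow> (nat \<Rightarrow> nat) set set" where
  "semi_copies k G P S T = rooted_homs k G P S T // semi_copy_rel k G P S T"

definition w_hat :: "nat \<Rightarrow> nat \<Rightarrow> nat \<Rightarrow> real" where
  "w_hat r j s = - inverse (real ((r - s) choose (j - s)))"

definition hom_weight ::
    "nat \<Rightarrow> nat \<Rightarrow> nat \<Rightarrow> hgraph \<Rightarrow> cpath \<Rightarrow> (nat \<Rightarrow> nat) \<Rightarrow> real" where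
  "hom_weight k r j G P \<Phi> =
     (\<Prod>i\<in>{1..plen P}. w_hat r j (card (overlap P i)) /
        real (card (cliques k r G (\<Phi> ` overlap P i))))"

text \<open>Below, a representative of each class is chosen. Equivalent homomorphisms agree on all
  sets \<open>overlap P i\<close>, and isomorphic clique-paths have the same weighted count, so the choice
  is immaterial.\<close>

definition Xi_path ::
    "nat \<Rightarrow> nat \<Rightarrow> nat \<Rightarrow> hgraph \<Rightarrow> cpath \<Rightarrow> nat set \<Rightarrow> nat set \<Rightarrow> real" where
  "Xi_path k r j G P S T =
     (\<Sum>X\<in>semi_copies k G P S T. hom_weight k r j G P (SOME \<Phi>. \<Phi> \<in> X))"

definition Xi_semi ::
    "nat \<Rightarrow> nat \<Rightarrow> nat \<Rightarrow> hgraph \<Rightarrow> cpath set set \<Rightarrow> nat set \<Rightarrow> nat set \<Rightarrow> real" where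
  "Xi_semi k r j G \<F> S T = (\<Sum>X\<in>\<F>. Xi_path k r j G (SOME P. P \<in> X) S T)"


section \<open>Centred clique-paths and clique-regularity\<close>

definition avoiding_walk ::
    "hgraph \<Rightarrow> nat set \<Rightarrow> nat \<Rightarrow> nat \<Rightarrow> nat \<Rightarrow> (nat \<Rightarrow> nat) \<Rightarrow> bool" where
  "avoiding_walk H U x y d v \<longleftrightarrow>
     v 0 = x \<and> v d = y \<and> (\<forall>i\<le>d. v i \<in> verts H - U) \<and>
     (\<forall>i\<in>{1..d}. \<exists>e\<in>edges H. v (i - 1) \<in> e \<and> v i \<in> e)"

definition centred :: "nat \<Rightarrow> nat \<Rightarrow> nat \<Rightarrow> cpath \<Rightarrow> bool" where
  "centred k b c P \<longleftrightarrow>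
     (let A = rset P 0; B = rset P (plen P) in
        card (A \<inter> B) = b \<and>
        (\<forall>x\<in>A - B. \<forall>y\<in>B - A. \<forall>d v. avoiding_walk (phgraph k P) (A \<inter> B) x y d v \<longrightarrow> c \<le> d))"

definition gamma :: "nat \<Rightarrow> nat \<Rightarrow> hgraph \<Rightarrow> nat \<Rightarrow> real" where
  "gamma k r G j =
     real (card (cliques k r G {})) * real (r choose j) / real (card (Ej k G j))"

definition avg_degree :: "nat \<Rightarrow> hgraph \<Rightarrow> nat \<Rightarrow> real" where
  "avg_degree k G j = real (card (edges G)) * real (k choose j) / real (card (Ej k G j))"

text \<open>In the third condition a semi-ordered clique-path is given by a representative \<open>P\<close>;
  being centred, the length and \<open>iota_path\<close> are invariant under semi-isomorphism.\<close>

definition clique_regular ::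
    "nat \<Rightarrow> nat \<Rightarrow> nat \<Rightarrow> nat \<Rightarrow> real \<Rightarrow> real \<Rightarrow> hgraph \<Rightarrow> bool" where
  "clique_regular k r l c C \<epsilon> G \<longleftrightarrow>
     (\<forall>S\<in>Ej k G (k - 1). approx_within (real (card (enbhd G S))) \<epsilon> (avg_degree k G (k - 1))) \<and>
     (\<forall>e\<in>edges G. approx_within (real (card (cliques k r G e))) \<epsilon> (gamma k r G k)) \<and>
     (\<forall>b j P. b < j \<and> j \<le> k \<and> clique_path r j P \<and> plen P \<le> l ^ (3 * k) \<and> centred k b c P \<longrightarrow>
        (\<exists>\<alpha> \<zeta>. \<bar>\<alpha>\<bar> \<le> C \<and> pair_norm (Ej k G j) \<zeta> \<le> \<epsilon> \<and>
           (\<forall>S\<in>Ej k G j. \<forall>T\<in>Ej k G j.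
              iota_path P \<subseteq> iota (S \<inter> T) (sorted_list_of_set S) \<longrightarrow>
              Xi_semi k r j G (semi_ordered k r j P) S T
                = \<alpha> * (gamma k r G j / gamma k r G b) + \<zeta> S T)))"

end

theory Submission
  imports Defs
begin

text \<open>
  The iteration converges because one application of \<open>\<P>\<^sub>k\<^sub>,\<^sub>l\<close> shrinks all discrepancies by a factor
  of order \<open>\<epsilon>\<close>. The proof of this contraction unrolls the operator along clique-paths.

  Fix \<open>j \<le> k\<close>. For \<open>s \<le> j\<close> the distributor \<open>\<R>\<^sub>s\<close> acts linearly on the discrepancies at level \<open>j\<close>: the
  new value at \<open>T\<close> is the old one plus a weighted sum of old values at \<open>U\<close> over all \<open>T \<subseteq> K \<supseteq> R \<subseteq> U\<close>
  with \<open>K\<close> an \<open>r\<close>-clique and \<open>R\<close> an \<open>s\<close>-set (\<open>discrepancy_distributor_below\<close>). This is one step of a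
  walk. Unrolling a word of distributors therefore writes a discrepancy after the word as a bounded
  combination of sums over homomorphisms of labelled clique-paths, where each homomorphism carries the
  weight of the path times the discrepancy before the word at the image of the last root set
  (\<open>hom_sum_step\<close>, \<open>hom_sum_word\<close>). For \<open>s = j\<close> the identity term cancels, so the root set changes.

  By induction on \<open>j\<close>, \<open>\<P>\<^sub>j\<^sub>,\<^sub>l\<close> multiplies the supremum of the discrepancies at level \<open>j\<close> by at most a
  constant times \<open>\<epsilon>\<close> (\<open>contraction\<close>). Unroll \<open>(\<R>\<^sub>j\<^sup>l \<P>\<^sub>j\<^sub>-\<^sub>1\<^sub>,\<^sub>l)\<^sup>l\<close> from the end backwards and call the
  moment after each of the \<open>l\<close> runs of \<open>\<P>\<^sub>j\<^sub>-\<^sub>1\<^sub>,\<^sub>l\<close> a checkpoint; there all discrepancies at levels below \<open>j\<close>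
  are of order \<open>\<epsilon>\<close>, by induction. Suppose that the segment of a path between some root set \<open>S\<^sub>q\<close> and the
  root set \<open>S\<^sub>p\<close> at a checkpoint is \<open>(b,c)\<close>-centred with \<open>b < j\<close>. The regularity condition says that the
  weighted number of homomorphisms of this segment hardly depends on the image \<open>T\<close> of \<open>S\<^sub>p\<close>, as long as
  \<open>T\<close> contains the image \<open>B\<close> of \<open>S\<^sub>q \<inter> S\<^sub>p\<close>. So the sum over \<open>T\<close> amounts to the discrepancy at level \<open>b\<close> of
  \<open>B\<close>, which is small (\<open>centred_segment_value\<close>). Such a path is not unrolled further. Every path is
  stopped in this way: its root sets form an interval family, and among more than \<open>c^j\<close> distinct sets of
  size \<open>j\<close> in such a family there are \<open>c + 1\<close> that form a sunflower with a kernel of size \<open>b < j\<close>. A walk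
  that avoids the kernel has to cross the petals one by one, so the segment is \<open>(b,c)\<close>-centred
  (\<open>sunflower_in_interval_family\<close>, \<open>centred_from_sunflower\<close>). Hence \<open>l > c^j\<close> checkpoints are enough
  (\<open>hom_sum_blocks\<close>).

  The regularity condition counts order-preserving maps up to permutations of free vertices, summed over
  the isomorphism classes in a semi-ordered path, whereas unrolling produces all maps of one labelled
  path. By orbit counting the two differ by the number of semi-automorphisms (\<open>sum_labelled_homs\<close>).

  The uniform function has the value \<open>1 / \<gamma>\<^sub>k\<close> on every clique and edge discrepancies at most \<open>\<epsilon>\<close>. For
  small \<open>\<epsilon>\<close> the discrepancies halve in each round, and the changes on a clique form a series dominated by
  a geometric one with sum at most \<open>1 / \<gamma>\<^sub>k\<close>. So the iterates converge, remain non-negative, and have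
  discrepancy 0 in the limit (\<open>iteration_converges\<close>).
\<close>

section \<open>Counting in the host hypergraph\<close>

lemma card_between:
  assumes "finite K" "S \<subseteq> K" "card S \<le> j"
  shows "card {U. S \<subseteq> U \<and> U \<subseteq> K \<and> card U = j} = (card K - card S) choose (j - card S)"
proof -
  have fS: "finite S" using assms finite_subset by blast
  have "bij_betw (\<lambda>U. U - S) {U. S \<subseteq> U \<and> U \<subseteq> K \<and> card U = j} {B. B \<subseteq> K - S \<and> card B = j - card S}"
  proof (rule bij_betw_byWitness[where f' = "\<lambda>B. B \<union> S"])
    show "(\<lambda>U. U - S) ` {U. S \<subseteq> U \<and> U \<subseteq> K \<and> card U = j} \<subseteq> {B. B \<subseteq> K - S \<and> card B = j - card S}"
      using fS by (auto simp: card_Diff_subset)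
    show "(\<lambda>B. B \<union> S) ` {B. B \<subseteq> K - S \<and> card B = j - card S} \<subseteq> {U. S \<subseteq> U \<and> U \<subseteq> K \<and> card U = j}"
    proof clarify
      fix B assume B: "B \<subseteq> K - S" "card B = j - card S"
      have "finite B" using B assms finite_subset by blast
      then have "card (B \<union> S) = j" using B fS assms by (subst card_Un_disjoint) auto
      then show "S \<subseteq> B \<union> S \<and> B \<union> S \<subseteq> K \<and> card (B \<union> S) = j" using B assms by auto
    qed
  qed auto
  then have "card {U. S \<subseteq> U \<and> U \<subseteq> K \<and> card U = j} = card {B. B \<subseteq> K - S \<and> card B = j - card S}"
    by (rule bij_betw_same_card)
  also have "\<dots> = (card (K - S)) choose (j - card S)"
    using assms by (intro n_subsets) auto
  finally show ?thesis using assms fS by (simp add: card_Diff_subset)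
qed

text \<open>The common form of the three sum formulas below: \<open>\<U>\<close> and \<open>\<K>\<close> are cliques, edges
  or smaller vertex sets.\<close>
lemma double_count:
  fixes y :: "'b set \<Rightarrow> real"
  assumes "finite \<U>" "finite \<K>" "\<And>K. K \<in> \<K> \<Longrightarrow> card {U \<in> \<U>. U \<subseteq> K} = m"
  shows "(\<Sum>U\<in>\<U>. \<Sum>K\<in>{K \<in> \<K>. U \<subseteq> K}. y K) = real m * (\<Sum>K\<in>\<K>. y K)"
proof -
  have "(\<Sum>U\<in>\<U>. \<Sum>K\<in>{K \<in> \<K>. U \<subseteq> K}. y K) = (\<Sum>K\<in>\<K>. \<Sum>U\<in>{U \<in> \<U>. U \<subseteq> K}. y K)"
    using assms by (intro sum.swap_restrict) auto
  also have "\<dots> = (\<Sum>K\<in>\<K>. real m * y K)"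
    using assms by (intro sum.cong) auto
  finally show ?thesis by (simp add: sum_distrib_left)
qed

text \<open>Inside the host graph, \<open>Cl S\<close> is \<open>K\<^sub>r(S)\<close>, \<open>kc S\<close> is its size,
  \<open>xi j\<close> is the discrepancy at level \<open>j\<close> and \<open>Rd s\<close> is the distributor
  \<open>\<R>\<^sub>s\<close>.\<close>
locale host =
  fixes k r :: nat and G :: hgraph
  assumes k2: "k \<ge> 2" and rk: "r \<ge> k + 1" and kg: "kgraph k G"
begin

abbreviation "Cl \<equiv> cliques k r G"
abbreviation "kc S \<equiv> real (card (cliques k r G S))"
abbreviation "E \<equiv> Ej k G"
abbreviation "xi \<equiv> discrepancy k r G"
abbreviation "Rd \<equiv> distributor k r G"

lemma finV: "finite (verts G)" and edges_sub: "edges G \<subseteq> nsets (verts G) k"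
  using kg by (auto simp: kgraph_def)

lemma E_nsets: "E j \<subseteq> nsets (verts G) j"
  using edges_sub by (auto simp: Ej_def)

lemma E_D: assumes "S \<in> E j" shows "S \<subseteq> verts G" "finite S" "card S = j"
  using E_nsets[of j] assms by (auto simp: nsets_def)

lemma finE [simp]: "finite (E j)"
  using E_nsets finV by (metis finite_imp_finite_nsets finite_subset)

lemma fin_edges [simp]: "finite (edges G)"
  using finE[of k] by (simp add: Ej_def)

lemma fin_enbhd [simp]: "finite (enbhd G S)"
  by (simp add: enbhd_def)

lemma finCl [simp]: "finite (Cl A)"
proof -
  have "Cl A \<subseteq> nsets (verts G) r" by (auto simp: cliques_def)
  then show ?thesis using finV by (meson finite_imp_finite_nsets finite_subset)
qed

lemma cliquesD: assumes "K \<in> Cl A" shows "K \<subseteq> verts G" "finite K" "card K = r" "A \<subseteq> K" "nsets K k \<subseteq> edges G"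
  using assms by (auto simp: cliques_def nsets_def)

lemma Cl_sub: "S \<subseteq> e \<Longrightarrow> Cl e = {K \<in> Cl S. e \<subseteq> K}"
  by (auto simp: cliques_def)

lemma nsets_Cl_E: assumes "K \<in> Cl A" "R \<in> nsets K s" shows "R \<in> E s"
  using cliquesD[OF assms(1)] assms(2) by (auto simp: Ej_def nsets_def)

lemma sub_Cl_E: assumes "K \<in> Cl A" "R \<subseteq> K" "card R = s" shows "R \<in> E s"
  using nsets_Cl_E[OF assms(1), of R s] cliquesD(2)[OF assms(1)] assms
  by (auto simp: nsets_def intro: finite_subset)

lemma enbhd_D: "e \<in> enbhd G S \<Longrightarrow> e \<in> edges G \<and> S \<subseteq> e \<and> finite e \<and> card e = k \<and> e \<subseteq> verts G"
  using edges_sub by (auto simp: enbhd_def nsets_def)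

lemma edge_D: "e \<in> edges G \<Longrightarrow> finite e \<and> card e = k \<and> e \<subseteq> verts G"
  using edges_sub by (auto simp: nsets_def)

lemma enbhd_edge: "e \<in> edges G \<Longrightarrow> enbhd G e = {e}"
proof -
  assume e: "e \<in> edges G"
  have "f = e" if "f \<in> edges G" "e \<subseteq> f" for f
    using card_subset_eq[of f e] that edge_D[OF e] edge_D[OF that(1)] by simp
  then show ?thesis using e by (auto simp: enbhd_def)
qed

text \<open>At level \<open>k\<close> an edge is the only edge containing itself, so both branches of the definition of the
  discrepancy are the same sum.\<close>
lemma discrepancy_eq_sum: "S \<in> E j \<Longrightarrow> xi j \<phi> S = (\<Sum>e\<in>enbhd G S. (edge_weight k r G \<phi> e - 1))"
  by (cases "j = k") (auto simp: discrepancy_def Ej_def enbhd_edge)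

lemma sub_edge_E: "e \<in> edges G \<Longrightarrow> U \<subseteq> e \<Longrightarrow> card U = j \<Longrightarrow> U \<in> E j"
  using enbhd_D[of e "{}"] card_subset_eq[of e U]
  by (auto simp: Ej_def nsets_def enbhd_def intro: finite_subset)

lemma sum_cliques_over_edges:
  assumes "S \<in> E j" "j \<le> k"
  shows "(\<Sum>e\<in>enbhd G S. \<Sum>K\<in>Cl e. y K) = real ((r - j) choose (k - j)) * (\<Sum>K\<in>Cl S. y K)"
proof -
  have "(\<Sum>e\<in>enbhd G S. \<Sum>K\<in>Cl e. y K) = (\<Sum>e\<in>enbhd G S. \<Sum>K\<in>{K\<in>Cl S. e \<subseteq> K}. y K)"
    by (intro sum.cong Cl_sub refl) (auto simp: enbhd_def Cl_sub)
  also have "\<dots> = real ((r - j) choose (k - j)) * (\<Sum>K\<in>Cl S. y K)"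
  proof (rule double_count)
    fix K assume K: "K \<in> Cl S"
    have "U \<in> edges G" if "U \<subseteq> K" "card U = k" for U
      using sub_Cl_E[OF K that] by (simp add: Ej_def)
    then have "{U \<in> enbhd G S. U \<subseteq> K} = {U. S \<subseteq> U \<and> U \<subseteq> K \<and> card U = k}"
      using edge_D by (auto simp: enbhd_def)
    then show "card {U \<in> enbhd G S. U \<subseteq> K} = (r - j) choose (k - j)"
      using card_between[of K S k] cliquesD[OF K] E_D[OF assms(1)] assms(2) by simp
  qed auto
  finally show ?thesis .
qed

lemma sum_edges_over_sets:
  assumes "R \<in> E s" "s \<le> j" "j \<le> k"
  shows "(\<Sum>U\<in>{U\<in>E j. R \<subseteq> U}. \<Sum>e\<in>enbhd G U. y e) = real ((k - s) choose (j - s)) * (\<Sum>e\<in>enbhd G R. y e)"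
proof -
  have "(\<Sum>U\<in>{U\<in>E j. R \<subseteq> U}. \<Sum>e\<in>enbhd G U. y e) = (\<Sum>U\<in>{U\<in>E j. R \<subseteq> U}. \<Sum>e\<in>{e\<in>enbhd G R. U \<subseteq> e}. y e)"
    by (intro sum.cong refl) (auto simp: enbhd_def)
  also have "\<dots> = real ((k - s) choose (j - s)) * (\<Sum>e\<in>enbhd G R. y e)"
  proof (rule double_count)
    fix e assume e: "e \<in> enbhd G R"
    have "U \<in> E j" if "U \<subseteq> e" "card U = j" for U
      using sub_edge_E that enbhd_D[OF e] by blast
    then have "{U \<in> {U\<in>E j. R \<subseteq> U}. U \<subseteq> e} = {U. R \<subseteq> U \<and> U \<subseteq> e \<and> card U = j}"
      using E_D(3) by auto
    then show "card {U \<in> {U\<in>E j. R \<subseteq> U}. U \<subseteq> e} = (k - s) choose (j - s)"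
      using card_between[of e R j] enbhd_D[OF e] E_D[OF assms(1)] assms(2) by simp
  qed auto
  finally show ?thesis .
qed

lemma sum_cliques_over_sets:
  assumes "R \<in> E s" "s \<le> j" "j \<le> k"
  shows "(\<Sum>U\<in>{U\<in>E j. R \<subseteq> U}. kc U) = real ((r - s) choose (j - s)) * kc R"
proof -
  have "(\<Sum>U\<in>{U\<in>E j. R \<subseteq> U}. kc U) = (\<Sum>U\<in>{U\<in>E j. R \<subseteq> U}. \<Sum>K\<in>{K\<in>Cl R. U \<subseteq> K}. 1)"
    by (intro sum.cong refl) (use Cl_sub in auto)
  also have "\<dots> = real ((r - s) choose (j - s)) * (\<Sum>K\<in>Cl R. 1)"
  proof (rule double_count)
    fix K assume K: "K \<in> Cl R"
    have "{U \<in> {U\<in>E j. R \<subseteq> U}. U \<subseteq> K} = {U. R \<subseteq> U \<and> U \<subseteq> K \<and> card U = j}"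
      using E_D(3) sub_Cl_E[OF K] by auto
    then show "card {U \<in> {U\<in>E j. R \<subseteq> U}. U \<subseteq> K} = (r - s) choose (j - s)"
      using card_between[of K R j] cliquesD[OF K] E_D[OF assms(1)] assms(2) by simp
  qed auto
  finally show ?thesis by simp
qed

text \<open>Each edge containing \<open>R\<close> contains the same number of \<open>j\<close>-sets \<open>U\<close> above
  \<open>R\<close>. So discrepancies at a low level are averages of those at a higher level: control at level
  \<open>j\<close> gives control at every level below.\<close>
lemma discrepancy_superset_sum:
  assumes "R \<in> E s" "s \<le> j" "j \<le> k"
  shows "(\<Sum>U\<in>{U\<in>E j. R \<subseteq> U}. xi j \<phi> U) = real ((k - s) choose (j - s)) * xi s \<phi> R"
proof -
  have "(\<Sum>U\<in>{U\<in>E j. R \<subseteq> U}. xi j \<phi> U) = (\<Sum>U\<in>{U\<in>E j. R \<subseteq> U}. \<Sum>e\<in>enbhd G U. (edge_weight k r G \<phi> e - 1))"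
    by (intro sum.cong refl) (auto simp: discrepancy_eq_sum)
  then show ?thesis using sum_edges_over_sets[OF assms] discrepancy_eq_sum[OF assms(1)] by simp
qed

text \<open>The correction made on a clique \<open>K \<supseteq> T\<close> is seen from \<open>T\<close> once for every edge
  between \<open>T\<close> and \<open>K\<close>.\<close>
lemma discrepancy_distributor:
  assumes "T \<in> E j" "j \<le> k" "s \<le> k"
  shows "xi j (Rd s \<phi>) T = xi j \<phi> T - real ((r - j) choose (k - j)) / real ((r - s) choose (k - s)) *
     (\<Sum>K\<in>Cl T. \<Sum>S\<in>nsets K s. xi s \<phi> S / kc S)"
proof -
  define Y where "Y K = (\<Sum>S\<in>nsets K s. xi s \<phi> S / kc S)" for K
  define b where "b = 1 / real ((r - s) choose (k - s))"
  have ew: "edge_weight k r G (Rd s \<phi>) e = edge_weight k r G \<phi> e - b * (\<Sum>K\<in>Cl e. Y K)" for e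
    by (simp add: edge_weight_def distributor_def Y_def b_def sum_subtractf sum_distrib_left)
  have "xi j (Rd s \<phi>) T = (\<Sum>e\<in>enbhd G T. (edge_weight k r G \<phi> e - 1) - b * (\<Sum>K\<in>Cl e. Y K))"
    unfolding discrepancy_eq_sum[OF assms(1)] by (intro sum.cong) (auto simp: ew)
  also have "\<dots> = xi j \<phi> T - b * (\<Sum>e\<in>enbhd G T. \<Sum>K\<in>Cl e. Y K)"
    by (simp add: discrepancy_eq_sum[OF assms(1)] sum_subtractf sum_distrib_left)
  also have "\<dots> = xi j \<phi> T - b * (real ((r - j) choose (k - j)) * (\<Sum>K\<in>Cl T. Y K))"
    by (subst sum_cliques_over_edges[OF assms(1,2)]) simp
  finally show ?thesis by (simp add: Y_def b_def)
qed

text \<open>For \<open>s \<le> j\<close> the distributor acts linearly on the discrepancies at level \<open>j\<close>,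
  because those at level \<open>s\<close> are averages of them. The sum runs over the steps \<open>T \<subseteq> K
  \<supseteq> R \<subseteq> U\<close> of a walk, and the two binomial factors combine to the weight \<open>w_hat r j
  s\<close> of a clique-path; this is the link between distributors and clique-paths.\<close>
lemma discrepancy_distributor_below:
  assumes "T \<in> E j" "s \<le> j" "j \<le> k"
  shows "xi j (Rd s \<phi>) T = xi j \<phi> T + w_hat r j s *
     (\<Sum>K\<in>Cl T. \<Sum>R\<in>nsets K s. (\<Sum>U\<in>{U\<in>E j. R \<subseteq> U}. xi j \<phi> U) / kc R)"
proof -
  define c1 where "c1 = real ((k - s) choose (j - s))"
  have c1: "c1 > 0" using assms by (simp add: c1_def zero_less_binomial_iff)
  have pos: "real ((r - s) choose (k - s)) > 0" "real ((r - s) choose (j - s)) > 0"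
    using assms rk by (auto simp: zero_less_binomial_iff)
  have id: "((r - s) choose (k - s)) * ((k - s) choose (j - s)) = ((r - s) choose (j - s)) * ((r - j) choose (k - j))"
    using choose_mult[of "j - s" "k - s" "r - s"] assms rk by simp
  have "(\<Sum>K\<in>Cl T. \<Sum>R\<in>nsets K s. (\<Sum>U\<in>{U\<in>E j. R \<subseteq> U}. xi j \<phi> U) / kc R)
     = (\<Sum>K\<in>Cl T. \<Sum>R\<in>nsets K s. c1 * (xi s \<phi> R / kc R))"
  proof (intro sum.cong refl)
    fix K R assume "K \<in> Cl T" "R \<in> nsets K s"
    then have "R \<in> E s" by (rule nsets_Cl_E)
    then show "(\<Sum>U\<in>{U\<in>E j. R \<subseteq> U}. xi j \<phi> U) / kc R = c1 * (xi s \<phi> R / kc R)"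
      using discrepancy_superset_sum[of R s j] assms c1_def by simp
  qed
  also have "\<dots> = c1 * (\<Sum>K\<in>Cl T. \<Sum>R\<in>nsets K s. xi s \<phi> R / kc R)"
    by (simp add: sum_distrib_left)
  finally have *: "(\<Sum>K\<in>Cl T. \<Sum>R\<in>nsets K s. (\<Sum>U\<in>{U\<in>E j. R \<subseteq> U}. xi j \<phi> U) / kc R)
    = c1 * (\<Sum>K\<in>Cl T. \<Sum>R\<in>nsets K s. xi s \<phi> R / kc R)" .
  have "real ((r - j) choose (k - j)) / real ((r - s) choose (k - s)) = - (w_hat r j s * c1)"
    using id[THEN arg_cong[where f=real]] pos unfolding w_hat_def c1_def by (simp add: field_simps)
  then show ?thesis
    using discrepancy_distributor[of T j s \<phi>] assms * by simp
qed

text \<open>The correction at the empty set is a multiple of \<open>xi 0 \<phi> {}\<close>: every \<open>s\<close>-set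
  \<open>S\<close> contributes its discrepancy once for each of the \<open>kc S\<close> cliques, divided by \<open>kc
  S\<close>.\<close>
lemma distributor_keeps_balance:
  assumes "xi 0 \<phi> {} = 0" "s \<le> k" "0 < kc {}"
    and pos: "\<And>S. S \<in> E s \<Longrightarrow> kc S \<noteq> 0"
  shows "xi 0 (Rd s \<phi>) {} = 0"
proof -
  have e: "{} \<in> E 0" using k2 by (simp add: Ej_def nsets_def)
  have "(\<Sum>K\<in>Cl {}. \<Sum>S\<in>nsets K s. xi s \<phi> S / kc S) = (\<Sum>K\<in>Cl {}. \<Sum>S\<in>{S\<in>E s. S \<subseteq> K}. xi s \<phi> S / kc S)"
  proof (intro sum.cong refl)
    fix K assume K: "K \<in> Cl {}"
    show "nsets K s = {S\<in>E s. S \<subseteq> K}" using nsets_Cl_E[OF K] E_D by (auto simp: nsets_def)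
  qed
  also have "\<dots> = (\<Sum>S\<in>E s. \<Sum>K\<in>{K\<in>Cl {}. S \<subseteq> K}. xi s \<phi> S / kc S)"
    by (intro sum.swap_restrict) auto
  also have "\<dots> = (\<Sum>S\<in>E s. xi s \<phi> S)"
  proof (intro sum.cong refl)
    fix S assume "S \<in> E s"
    moreover have "{K\<in>Cl {}. S \<subseteq> K} = Cl S" by (auto simp: cliques_def)
    ultimately show "(\<Sum>K\<in>{K\<in>Cl {}. S \<subseteq> K}. xi s \<phi> S / kc S) = xi s \<phi> S" using pos by simp
  qed
  also have "\<dots> = 0" using discrepancy_superset_sum[OF e, of s \<phi>] assms by simp
  finally show ?thesis using discrepancy_distributor[OF e, of s \<phi>] assms by simp
qed

end

section \<open>Regularity of the clique counts\<close>

locale regular_host = host +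
  fixes l c :: nat and C \<epsilon> :: real
  assumes eps: "0 < \<epsilon>" "\<epsilon> \<le> 1/2" and creg: "clique_regular k r l c C \<epsilon> G"
    and cliques_exist: "\<forall>S\<subseteq>verts G. S \<in> edges G \<or> card S < k \<longrightarrow> cliques k r G S \<noteq> {}"
begin

abbreviation "gam \<equiv> gamma k r G"

lemma codegree_regular: "S \<in> E (k - 1) \<Longrightarrow> approx_within (real (card (enbhd G S))) \<epsilon> (avg_degree k G (k - 1))"
  and edge_cliques_regular: "e \<in> edges G \<Longrightarrow> approx_within (kc e) \<epsilon> (gam k)"
  using creg unfolding clique_regular_def by blast+

lemma Cl_ne: "S \<in> E j \<Longrightarrow> j \<le> k \<Longrightarrow> Cl S \<noteq> {}"
  using cliques_exist E_D[of S j] by (cases "j = k") (auto simp: Ej_def)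

lemma Cl0_ne: "Cl {} \<noteq> {}"
  using cliques_exist k2 by auto

lemma E_ne: assumes "j \<le> k" shows "E j \<noteq> {}"
proof -
  obtain K where K: "K \<in> Cl {}" using Cl0_ne by auto
  obtain R where "R \<subseteq> K" "card R = j"
    using obtain_subset_with_card_n[of j K] cliquesD[OF K] assms rk by auto
  then show ?thesis using sub_Cl_E[OF K] by auto
qed

lemma gam_pos: assumes "j \<le> k" shows "gam j > 0"
proof -
  have "card (Cl {}) > 0" "card (E j) > 0" "(r choose j) > 0"
    using Cl0_ne E_ne[OF assms] rk assms by (auto simp: card_gt_0_iff zero_less_binomial_iff)
  then show ?thesis by (simp add: gamma_def)
qed

lemma card_E: "j < k \<Longrightarrow> card (E j) = (card (verts G) choose j)"
  by (simp add: Ej_def nsets_def conj_commute) (metis (no_types, lifting) Collect_cong finV finite_subset n_subsets)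

lemma k_le_n: "k \<le> card (verts G)"
proof -
  obtain K where K: "K \<in> Cl {}" using Cl0_ne by auto
  show ?thesis using cliquesD[OF K] card_mono[OF finV, of K] rk by simp
qed

text \<open>Averaging the degree condition over the \<open>(k-1)\<close>-sets above \<open>S\<close> loses nothing: the error
  \<open>\<epsilon>\<close> is the same at every level.\<close>
lemma degree_regular:
  assumes "S \<in> E s" "s < k"
  shows "approx_within (real (card (enbhd G S))) \<epsilon> (avg_degree k G s)"
proof -
  define q where "q = real ((k - s) choose (k - 1 - s))"
  define M where "M = ((card (verts G) - s) choose (k - 1 - s))"
  define d where "d = avg_degree k G (k - 1)"
  have q: "q > 0" using assms by (simp add: q_def zero_less_binomial_iff)
  have SE: "{S'\<in>E (k - 1). S \<subseteq> S'} = {S'. S \<subseteq> S' \<and> S' \<subseteq> verts G \<and> card S' = k - 1}"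
    using k2 finV by (auto simp: Ej_def nsets_def intro: finite_subset)
  have cM: "card {S'\<in>E (k - 1). S \<subseteq> S'} = M"
    unfolding SE M_def using card_between[of "verts G" S "k - 1"] E_D[OF assms(1)] finV assms(2) by simp
  have sum: "(\<Sum>S'\<in>{S'\<in>E (k - 1). S \<subseteq> S'}. real (card (enbhd G S'))) = q * real (card (enbhd G S))"
    using sum_edges_over_sets[OF assms(1), of "k - 1" "\<lambda>_. 1"] assms(2) by (simp add: q_def)
  have up: "q * real (card (enbhd G S)) \<le> real M * ((1 + \<epsilon>) * d)"
    unfolding sum[symmetric] cM[symmetric]
    by (rule sum_bounded_above) (use codegree_regular in \<open>auto simp: approx_within_def d_def\<close>)
  have lo: "real M * ((1 - \<epsilon>) * d) \<le> q * real (card (enbhd G S))"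
    unfolding sum[symmetric] cM[symmetric]
    by (rule sum_bounded_below) (use codegree_regular in \<open>auto simp: approx_within_def d_def\<close>)
  have id: "real M * d = q * avg_degree k G s"
  proof -
    let ?n = "card (verts G)"
    have 1: "(?n choose (k - 1)) * ((k - 1) choose s) = (?n choose s) * M"
      unfolding M_def using choose_mult[of s "k - 1" ?n] assms k_le_n by simp
    have 2: "(k choose (k - 1)) * ((k - 1) choose s) = (k choose s) * ((k - s) choose (k - 1 - s))"
      using choose_mult[of s "k - 1" k] assms by simp
    have p: "real (?n choose (k - 1)) > 0" "real (?n choose s) > 0" using k_le_n assms by (auto simp: zero_less_binomial_iff)
    have c: "card (E (k - 1)) = (?n choose (k - 1))" "card (E s) = (?n choose s)" using card_E k2 assms by auto
    let ?e = "real (card (edges G))"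
    have "real M * d * (real (?n choose (k - 1)) * real (?n choose s)) = ?e * real (k choose (k - 1)) * real ((?n choose s) * M)"
      using p by (simp add: d_def avg_degree_def c field_simps del: One_nat_def)
    also have "\<dots> = ?e * real (?n choose (k - 1)) * real ((k choose (k - 1)) * ((k - 1) choose s))"
      unfolding 1[symmetric] by simp
    also have "\<dots> = q * avg_degree k G s * (real (?n choose (k - 1)) * real (?n choose s))"
      unfolding 2 using p by (simp add: avg_degree_def c q_def field_simps del: One_nat_def)
    finally show ?thesis using p by simp
  qed
  have "q * real (card (enbhd G S)) \<le> q * ((1 + \<epsilon>) * avg_degree k G s)"
    using up id by (simp add: algebra_simps)
  moreover have "q * ((1 - \<epsilon>) * avg_degree k G s) \<le> q * real (card (enbhd G S))"
    using lo id by (simp add: algebra_simps)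
  ultimately show ?thesis using q by (simp add: approx_within_def)
qed

text \<open>The cliques on \<open>S\<close> are counted through the edges containing \<open>S\<close>, so the two relative
  errors multiply. The crude factor 4 absorbs both; the supremum bounds below rest on these two inequalities.\<close>
lemma kc_regular:
  assumes "S \<in> E s" "s \<le> k"
  shows "gam s / 4 \<le> kc S" "kc S \<le> 4 * gam s"
proof -
  have "gam s / 4 \<le> kc S \<and> kc S \<le> 4 * gam s"
  proof (cases "s = k")
    case True
    have a: "(1 - \<epsilon>) * gam k \<le> kc S" "kc S \<le> (1 + \<epsilon>) * gam k"
      using edge_cliques_regular[of S] assms True by (auto simp: Ej_def approx_within_def)
    have "1/4 * gam k \<le> (1 - \<epsilon>) * gam k" "(1 + \<epsilon>) * gam k \<le> 4 * gam k"
      using eps gam_pos[of k] by (intro mult_right_mono; simp)+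
    with a True show ?thesis by simp
  next
    case False
    then have sk: "s < k" using assms by simp
    define q where "q = real ((r - s) choose (k - s))"
    define N where "N = real (card (enbhd G S))"
    define d where "d = avg_degree k G s"
    have q: "q > 0" using assms rk by (simp add: q_def zero_less_binomial_iff)
    have N: "(1 - \<epsilon>) * d \<le> N" "N \<le> (1 + \<epsilon>) * d"
      using degree_regular[OF assms(1) sk] by (auto simp: approx_within_def N_def d_def)
    have sum: "(\<Sum>e\<in>enbhd G S. kc e) = q * kc S"
      using sum_cliques_over_edges[OF assms, of "\<lambda>_. 1"] by (simp add: q_def)
    have up: "q * kc S \<le> N * ((1 + \<epsilon>) * gam k)"
      unfolding sum[symmetric] N_def
      by (rule sum_bounded_above) (use edge_cliques_regular in \<open>auto simp: approx_within_def enbhd_def\<close>)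
    have lo: "N * ((1 - \<epsilon>) * gam k) \<le> q * kc S"
      unfolding sum[symmetric] N_def
      by (rule sum_bounded_below) (use edge_cliques_regular in \<open>auto simp: approx_within_def enbhd_def\<close>)
    have gk: "gam k > 0" and gs: "gam s > 0" using gam_pos assms by auto
    have id: "d * gam k = q * gam s"
    proof -
      have 1: "(r choose k) * (k choose s) = (r choose s) * ((r - s) choose (k - s))"
        using choose_mult[of s k r] assms rk by simp
      have e: "real (card (edges G)) > 0" "real (card (E s)) > 0"
        using E_ne[of k] E_ne[of s] assms by (auto simp: Ej_def[of k G k] card_gt_0_iff)
      have "d * gam k = kc {} * real ((r choose k) * (k choose s)) / real (card (E s))"
        using E_ne[of k] by (simp add: d_def gamma_def avg_degree_def Ej_def[of k G k])
      also have "\<dots> = q * gam s"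
        unfolding 1 by (simp add: q_def gamma_def)
      finally show ?thesis .
    qed
    have d0: "d * gam k > 0" unfolding id using q gs by simp
    have "q * kc S \<le> ((1 + \<epsilon>) * d) * ((1 + \<epsilon>) * gam k)"
      by (rule order_trans[OF up mult_right_mono[OF N(2)]]) (use gk eps in simp)
    also have "\<dots> = ((1 + \<epsilon>) * (1 + \<epsilon>)) * (d * gam k)" by simp
    also have "\<dots> \<le> 4 * (d * gam k)"
    proof (rule mult_right_mono)
      have "(1 + \<epsilon>) * (1 + \<epsilon>) \<le> 2 * 2" using eps by (intro mult_mono) auto
      then show "(1 + \<epsilon>) * (1 + \<epsilon>) \<le> 4" by simp
    qed (use d0 in simp)
    finally have A: "q * kc S \<le> q * (4 * gam s)" unfolding id by simp
    have "1/4 * (d * gam k) \<le> ((1 - \<epsilon>) * (1 - \<epsilon>)) * (d * gam k)"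
    proof (rule mult_right_mono)
      have "(1/2) * (1/2) \<le> (1 - \<epsilon>) * (1 - \<epsilon>)" using eps by (intro mult_mono) auto
      then show "1/4 \<le> (1 - \<epsilon>) * (1 - \<epsilon>)" by simp
    qed (use d0 in simp)
    also have "\<dots> = ((1 - \<epsilon>) * d) * ((1 - \<epsilon>) * gam k)" by simp
    also have "\<dots> \<le> q * kc S"
      by (rule order_trans[OF mult_right_mono[OF N(1)] lo]) (use gk eps in simp)
    finally have B: "q * (gam s / 4) \<le> q * kc S" unfolding id by simp
    from A B q show ?thesis by simp
  qed
  then show "gam s / 4 \<le> kc S" "kc S \<le> 4 * gam s" by auto
qed

lemma kc_pos: "S \<in> E s \<Longrightarrow> s \<le> k \<Longrightarrow> kc S > 0"
  using Cl_ne[of S s] by (simp add: card_gt_0_iff)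

text \<open>Each \<open>U\<close> above \<open>R\<close> carries at least \<open>gam j / 4\<close> cliques, and each clique
  on \<open>R\<close> is counted at most \<open>2^r\<close> times.\<close>
lemma supersets_bound:
  assumes "R \<in> E s" "s \<le> j" "j \<le> k"
  shows "real (card {U\<in>E j. R \<subseteq> U}) \<le> 4 * 2 ^ r * kc R / gam j"
proof -
  have "real (card {U\<in>E j. R \<subseteq> U}) * (gam j / 4) \<le> (\<Sum>U\<in>{U\<in>E j. R \<subseteq> U}. kc U)"
    using kc_regular(1)[of _ j] assms by (intro sum_bounded_below) auto
  also have "\<dots> = real ((r - s) choose (j - s)) * kc R" by (rule sum_cliques_over_sets[OF assms])
  also have "\<dots> \<le> 2 ^ r * kc R"
  proof (rule mult_right_mono)
    have "(r - s) choose (j - s) \<le> 2 ^ (r - s)" by (rule binomial_le_pow2)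
    also have "\<dots> \<le> 2 ^ r" by (rule power_increasing) auto
    finally show "real ((r - s) choose (j - s)) \<le> 2 ^ r" by (metis of_nat_le_iff of_nat_numeral of_nat_power)
  qed simp
  finally show ?thesis using gam_pos[OF assms(3)] by (simp add: field_simps)
qed

end

section \<open>Bags and root sets of clique-paths\<close>

lemma clique_pathD:
  assumes "clique_path r j P"
  shows "length (snd P) = plen P + 1"
    "\<And>i. 1 \<le> i \<Longrightarrow> i \<le> plen P \<Longrightarrow> finite (pverts P i) \<and> card (pverts P i) = r"
    "\<And>i. i \<le> plen P \<Longrightarrow> distinct (root_seq P i) \<and> length (root_seq P i) = j"
    "\<And>i. i \<le> plen P \<Longrightarrow> (\<Union>m\<in>{1..i}. pverts P m) \<inter> pverts P (i + 1) \<subseteq> pverts P i \<inter> pverts P (i + 1)"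
    "\<And>i. i \<le> plen P \<Longrightarrow> pverts P i \<inter> pverts P (i + 1) \<subseteq> rset P i"
    "\<And>i. i \<le> plen P \<Longrightarrow> rset P i \<subseteq> pverts P (i + 1)"
    "\<And>i i'. i \<le> plen P \<Longrightarrow> i' \<le> plen P \<Longrightarrow> filter (\<lambda>x. x \<in> rset P i') (root_seq P i) = filter (\<lambda>x. x \<in> rset P i) (root_seq P i')"
  using assms unfolding clique_path_def by auto

lemma rset_card: "clique_path r j P \<Longrightarrow> i \<le> plen P \<Longrightarrow> finite (rset P i) \<and> card (rset P i) = j"
  using clique_pathD(3)[of r j P i] by (auto simp: rset_def distinct_card)

lemma pverts_last: "pverts P (Suc (plen P)) = rset P (plen P)"
  by (simp add: pverts_def)

lemma finite_pverts: "clique_path r j P \<Longrightarrow> finite (pverts P i)"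
  using clique_pathD(2)[of r j P i] rset_card[of r j P]
  by (cases "1 \<le> i \<and> i \<le> plen P") (auto simp: pverts_def)

text \<open>The orders agree on common vertices, so two root sequences with the same set would be equal as lists.\<close>
lemma rset_distinct:
  assumes cp: "clique_path r j P" and i: "i \<le> plen P" "i' \<le> plen P" "i \<noteq> i'"
  shows "rset P i \<noteq> rset P i'"
proof
  assume eq: "rset P i = rset P i'"
  have "root_seq P i = root_seq P i'"
    using clique_pathD(7)[OF cp i(1,2)] eq
    by (metis (mono_tags, lifting) filter_True rset_def)
  then show False using cp i unfolding clique_path_def by blast
qed

text \<open>The bags form a path decomposition: walking down from the later bag, the vertex has to lie in every bag passed,
  hence in every overlap, and overlaps are contained in root sets.\<close>
lemma bags_meet_in_roots:
  assumes cp: "clique_path r j P" and x: "x \<in> pverts P a" "x \<in> pverts P b"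
    and ab: "1 \<le> a" "a \<le> m" "m < b" "b \<le> plen P + 1"
  shows "x \<in> pverts P m" "x \<in> pverts P (m + 1)" "x \<in> rset P m"
proof -
  have *: "x \<in> pverts P (b - n)" if "n \<le> b - a" for n
    using that
  proof (induction n)
    case 0 then show ?case using x by simp
  next
    case (Suc n)
    let ?i = "b - n - 1"
    have e: "?i + 1 = b - n" using Suc.prems by linarith
    have "x \<in> pverts P (?i + 1)" unfolding e using Suc by simp
    moreover have "x \<in> (\<Union>m\<in>{1..?i}. pverts P m)" using x(1) ab Suc.prems by force
    moreover have "?i \<le> plen P" using ab by simp
    ultimately have "x \<in> pverts P ?i" using clique_pathD(4)[OF cp, of ?i] by blast
    then show ?case by simp
  qed
  show 1: "x \<in> pverts P m" using *[of "b - m"] ab by simp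
  show 2: "x \<in> pverts P (m + 1)" using *[of "b - (m + 1)"] ab by simp
  show "x \<in> rset P m" using clique_pathD(5)[OF cp, of m] 1 2 ab by auto
qed

lemma roots_interval:
  assumes cp: "clique_path r j P" and x: "x \<in> rset P a" "x \<in> rset P b"
    and ab: "a \<le> m" "m \<le> b" "b \<le> plen P"
  shows "x \<in> rset P m"
proof (cases "a = m \<or> m = b")
  case True then show ?thesis using x by auto
next
  case False
  then have "x \<in> pverts P (a + 1)" "x \<in> pverts P (b + 1)"
    using clique_pathD(6)[OF cp, of a] clique_pathD(6)[OF cp, of b] x ab by auto
  then show ?thesis using bags_meet_in_roots(3)[OF cp, of x "a + 1" "b + 1" m] ab False by auto
qed

lemma root_bag: "clique_path r j P \<Longrightarrow> i \<le> plen P \<Longrightarrow> rset P i \<inter> pverts P i = overlap P i"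
  unfolding overlap_def using clique_pathD(5,6)[of r j P i] by auto

lemma overlap_sub: "clique_path r j P \<Longrightarrow> i \<le> plen P \<Longrightarrow> overlap P i \<subseteq> rset P i"
  unfolding overlap_def using clique_pathD(5)[of r j P i] by auto

text \<open>The segment with root sets \<open>S\<^sub>0, \<dots>, S\<^sub>q\<close>. Its last bag is \<open>S\<^sub>q\<close>
  instead of \<open>V(F\<^sub>q\<^sub>+\<^sub>1)\<close>.\<close>
definition ptake :: "nat \<Rightarrow> cpath \<Rightarrow> cpath" where
  "ptake q P = (take q (fst P), take (Suc q) (snd P))"

definition pdrop :: "nat \<Rightarrow> cpath \<Rightarrow> cpath" where
  "pdrop q P = (drop q (fst P), drop q (snd P))"

lemma plen_ptake: "q \<le> plen P \<Longrightarrow> plen (ptake q P) = q"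
  by (simp add: plen_def ptake_def)

lemma plen_pdrop: "plen (pdrop q P) = plen P - q"
  by (simp add: plen_def pdrop_def)

lemma root_ptake: "i \<le> q \<Longrightarrow> root_seq (ptake q P) i = root_seq P i"
  by (simp add: root_seq_def ptake_def)

lemma rset_ptake: "i \<le> q \<Longrightarrow> rset (ptake q P) i = rset P i"
  by (simp add: rset_def root_ptake)

lemma pverts_ptake: "q \<le> plen P \<Longrightarrow> i \<le> q \<Longrightarrow> pverts (ptake q P) i = pverts P i"
  using plen_ptake[of q P] rset_ptake[of 0 q P] by (auto simp: pverts_def ptake_def)

lemma pverts_ptake_last: "q \<le> plen P \<Longrightarrow> pverts (ptake q P) (Suc q) = rset P q"
  using plen_ptake[of q P] rset_ptake[of q q P] by (auto simp: pverts_def)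

lemma root_pdrop: "length (snd P) = plen P + 1 \<Longrightarrow> q + i \<le> plen P \<Longrightarrow> root_seq (pdrop q P) i = root_seq P (q + i)"
  by (simp add: root_seq_def pdrop_def)

lemma rset_pdrop: "length (snd P) = plen P + 1 \<Longrightarrow> q + i \<le> plen P \<Longrightarrow> rset (pdrop q P) i = rset P (q + i)"
  by (simp add: rset_def root_pdrop)

lemma pverts_pdrop:
  assumes "length (snd P) = plen P + 1" "1 \<le> i" "q + i \<le> plen P + 1"
  shows "pverts (pdrop q P) i = pverts P (q + i)"
proof (cases "q + i \<le> plen P")
  case True
  then have "pverts (pdrop q P) i = drop q (fst P) ! (i - 1)" "pverts P (q + i) = fst P ! (q + i - 1)"
    using assms plen_pdrop[of q P] by (auto simp: pverts_def pdrop_def)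
  moreover have "drop q (fst P) ! (i - 1) = fst P ! (q + (i - 1))"
    using True assms by (intro nth_drop) (simp add: plen_def)
  ultimately show ?thesis using assms by simp
next
  case False
  then have "pverts (pdrop q P) i = rset (pdrop q P) (plen P - q)" "pverts P (q + i) = rset P (plen P)"
    using assms plen_pdrop[of q P] by (auto simp: pverts_def)
  then show ?thesis using rset_pdrop[OF assms(1), of q "plen P - q"] assms by simp
qed

lemma ptake_ptake: "p \<le> q \<Longrightarrow> ptake p (ptake q P) = ptake p P"
  by (simp only: ptake_def fst_conv snd_conv take_take min.absorb1 Suc_le_mono)

lemma clique_path_ptake:
  assumes cp: "clique_path r j P" and q: "q \<le> plen P"
  shows "clique_path r j (ptake q P)"
proof -
  have pl: "plen (ptake q P) = q" using q by (rule plen_ptake)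
  have pv: "pverts (ptake q P) i = (if i \<le> q then pverts P i else rset P q)" if "i \<le> Suc q" for i
    using pverts_ptake[OF q] pverts_ptake_last[OF q] that by (cases "i = Suc q") auto
  have sub: "rset P q \<subseteq> pverts P (Suc q)" using clique_pathD(6)[OF cp q] by simp
  have U: "(\<Union>m\<in>{1..i}. pverts (ptake q P) m) = (\<Union>m\<in>{1..i}. pverts P m)" if "i \<le> q" for i
    using that by (auto simp: pv)
  show ?thesis
    unfolding clique_path_def pl
  proof (intro conjI allI ballI impI)
    show "length (snd (ptake q P)) = q + 1"
      using clique_pathD(1)[OF cp] q by (simp add: ptake_def)
    fix i assume i: "i \<in> {1..q}"
    then show "finite (pverts (ptake q P) i)" "card (pverts (ptake q P) i) = r"
      using clique_pathD(2)[OF cp, of i] q by (auto simp: pv)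
  next
    fix i assume i: "i \<le> q"
    show "distinct (root_seq (ptake q P) i)" "length (root_seq (ptake q P) i) = j"
      using clique_pathD(3)[OF cp, of i] i q by (auto simp: root_ptake)
    show "(\<Union>m\<in>{1..i}. pverts (ptake q P) m) \<inter> pverts (ptake q P) (i + 1)
      \<subseteq> pverts (ptake q P) i \<inter> pverts (ptake q P) (i + 1)"
    proof -
      have "pverts (ptake q P) i = pverts P i" "pverts (ptake q P) (i + 1) \<subseteq> pverts P (i + 1)"
        using i sub by (auto simp: pv not_less_eq_eq le_antisym)
      then show ?thesis using clique_pathD(4)[OF cp, of i] i q unfolding U[OF i] by (simp add: subset_iff)
    qed
    show "pverts (ptake q P) i \<inter> pverts (ptake q P) (i + 1) \<subseteq> rset (ptake q P) i"
      using clique_pathD(5)[OF cp, of i] i q sub by (auto simp: pv rset_ptake not_less_eq_eq le_antisym)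
    show "rset (ptake q P) i \<subseteq> pverts (ptake q P) (i + 1)"
      using clique_pathD(6)[OF cp, of i] i q sub by (auto simp: pv rset_ptake not_less_eq_eq le_antisym)
  next
    fix i i' assume "i \<le> q" "i' \<le> q" "i \<noteq> i'"
    then show "root_seq (ptake q P) i \<noteq> root_seq (ptake q P) i'"
      using cp q unfolding clique_path_def by (simp add: root_ptake)
  next
    fix i i' assume "i \<le> q" "i' \<le> q"
    then show "filter (\<lambda>x. x \<in> rset (ptake q P) i') (root_seq (ptake q P) i) =
           filter (\<lambda>x. x \<in> rset (ptake q P) i) (root_seq (ptake q P) i')"
      using clique_pathD(7)[OF cp, of i i'] q by (simp add: root_ptake rset_ptake)
  qed
qed

lemma clique_path_pdrop:
  assumes cp: "clique_path r j P" and q: "q \<le> plen P"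
  shows "clique_path r j (pdrop q P)"
proof -
  note len = clique_pathD(1)[OF cp]
  have pl: "plen (pdrop q P) = plen P - q" by (rule plen_pdrop)
  have pv: "pverts (pdrop q P) i = (if i = 0 then rset P q else pverts P (q + i))" if "i \<le> plen P - q + 1" for i
    using pverts_pdrop[OF len, of i q] that q rset_pdrop[OF len, of q 0] by (cases "i = 0") (auto simp: pverts_def)
  have rs: "rset (pdrop q P) i = rset P (q + i)" if "i \<le> plen P - q" for i
    using rset_pdrop[OF len, of q i] that q by simp
  have ro: "root_seq (pdrop q P) i = root_seq P (q + i)" if "i \<le> plen P - q" for i
    using root_pdrop[OF len, of q i] that q by simp
  show ?thesis
    unfolding clique_path_def pl
  proof (intro conjI allI ballI impI)
    show "length (snd (pdrop q P)) = plen P - q + 1"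
      using len q by (simp add: pdrop_def)
    fix i assume i: "i \<in> {1..plen P - q}"
    then show "finite (pverts (pdrop q P) i)" "card (pverts (pdrop q P) i) = r"
      using clique_pathD(2)[OF cp, of "q + i"] q by (auto simp: pv)
  next
    fix i assume i: "i \<le> plen P - q"
    then have i': "q + i \<le> plen P" using q by simp
    show "distinct (root_seq (pdrop q P) i)" "length (root_seq (pdrop q P) i) = j"
      using clique_pathD(3)[OF cp, of "q + i"] i i' by (auto simp: ro)
    have U: "(\<Union>m\<in>{1..i}. pverts (pdrop q P) m) \<subseteq> (\<Union>m\<in>{1..q+i}. pverts P m)"
      using i by (fastforce simp: pv)
    show "(\<Union>m\<in>{1..i}. pverts (pdrop q P) m) \<inter> pverts (pdrop q P) (i + 1)
      \<subseteq> pverts (pdrop q P) i \<inter> pverts (pdrop q P) (i + 1)"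
    proof (cases "i = 0")
      case False
      have "pverts (pdrop q P) i = pverts P (q + i)" "pverts (pdrop q P) (i + 1) = pverts P (q + i + 1)"
        using pv[of i] pv[of "i + 1"] i False by auto
      then show ?thesis using subset_trans[OF Int_mono[OF U subset_refl] clique_pathD(4)[OF cp i']] by metis
    qed simp
    show "pverts (pdrop q P) i \<inter> pverts (pdrop q P) (i + 1) \<subseteq> rset (pdrop q P) i"
      using clique_pathD(5)[OF cp, of "q + i"] i i' by (auto simp: pv rs)
    show "rset (pdrop q P) i \<subseteq> pverts (pdrop q P) (i + 1)"
      using clique_pathD(6)[OF cp, of "q + i"] i i' by (auto simp: pv rs)
  next
    fix i i' assume "i \<le> plen P - q" "i' \<le> plen P - q" "i \<noteq> i'"
    then show "root_seq (pdrop q P) i \<noteq> root_seq (pdrop q P) i'"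
      using cp q unfolding clique_path_def by (simp add: ro)
  next
    fix i i' assume "i \<le> plen P - q" "i' \<le> plen P - q"
    then show "filter (\<lambda>x. x \<in> rset (pdrop q P) i') (root_seq (pdrop q P) i) =
           filter (\<lambda>x. x \<in> rset (pdrop q P) i) (root_seq (pdrop q P) i')"
      using clique_pathD(7)[OF cp, of "q + i" "q + i'"] q by (simp add: ro rs)
  qed
qed

text \<open>Sorting every root set by the same key keeps the orders compatible. The key will be a homomorphism, which turns a
  map that ignores the orders into an order-preserving one.\<close>
definition reorder :: "(nat \<Rightarrow> nat) \<Rightarrow> cpath \<Rightarrow> cpath" where
  "reorder \<kappa> P = (fst P, map (sort_key \<kappa>) (snd P))"

lemma plen_reorder [simp]: "plen (reorder \<kappa> P) = plen P"
  by (simp add: reorder_def plen_def)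

lemma root_reorder: "i < length (snd P) \<Longrightarrow> root_seq (reorder \<kappa> P) i = sort_key \<kappa> (root_seq P i)"
  by (simp add: reorder_def root_seq_def)

lemma rset_reorder: "i < length (snd P) \<Longrightarrow> rset (reorder \<kappa> P) i = rset P i"
  by (simp add: rset_def root_reorder)

lemma pverts_reorder:
  "length (snd P) = plen P + 1 \<Longrightarrow> pverts (reorder \<kappa> P) i = pverts P i"
  by (simp add: pverts_def rset_reorder) (simp add: reorder_def)

lemma clique_path_reorder:
  assumes cp: "clique_path r j P"
  shows "clique_path r j (reorder \<kappa> P)"
proof -
  note len = clique_pathD(1)[OF cp]
  have pv: "pverts (reorder \<kappa> P) = pverts P" using pverts_reorder[OF len] by auto
  have rs: "rset (reorder \<kappa> P) i = rset P i" if "i \<le> plen P" for i using rset_reorder len that by simp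
  have ro: "root_seq (reorder \<kappa> P) i = sort_key \<kappa> (root_seq P i)" if "i \<le> plen P" for i using root_reorder len that by simp
  show ?thesis
    unfolding clique_path_def plen_reorder pv
  proof (intro conjI allI ballI impI)
    show "length (snd (reorder \<kappa> P)) = plen P + 1"
      using len by (simp add: reorder_def)
  next
    fix i i' assume i: "i \<le> plen P" "i' \<le> plen P" "i \<noteq> i'"
    show "root_seq (reorder \<kappa> P) i \<noteq> root_seq (reorder \<kappa> P) i'"
      using rset_distinct[OF cp i] rs[OF i(1)] rs[OF i(2)] unfolding rset_def by auto
  next
    fix i i' assume i: "i \<le> plen P" "i' \<le> plen P"
    show "filter (\<lambda>x. x \<in> rset (reorder \<kappa> P) i') (root_seq (reorder \<kappa> P) i) =
           filter (\<lambda>x. x \<in> rset (reorder \<kappa> P) i) (root_seq (reorder \<kappa> P) i')"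
      unfolding rs[OF i(1)] rs[OF i(2)] ro[OF i(1)] ro[OF i(2)]
      using clique_pathD(7)[OF cp i] by (simp add: filter_sort)
  qed (use clique_pathD[OF cp] rs ro in auto)
qed

section \<open>Sunflowers of root sets\<close>

text \<open>Either some element survives for \<open>c^j\<close> steps, and then it can be removed from all sets of that
  stretch and put into the kernel; or every element dies within \<open>c^j\<close> steps, and then sets that far apart are
  disjoint.\<close>
lemma sunflower_in_interval_family:
  fixes A :: "nat \<Rightarrow> 'a set"
  assumes "\<And>i. i \<le> m \<Longrightarrow> finite (A i) \<and> card (A i) = j"
    and "\<And>i i'. i < i' \<Longrightarrow> i' \<le> m \<Longrightarrow> A i \<noteq> A i'"
    and "\<And>x i n i'. x \<in> A i \<Longrightarrow> x \<in> A i' \<Longrightarrow> i \<le> n \<Longrightarrow> n \<le> i' \<Longrightarrow> i' \<le> m \<Longrightarrow> x \<in> A n"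
    and "c \<ge> 1" "c ^ j \<le> m"
  shows "\<exists>t B. strict_mono_on {..c} t \<and> t c \<le> m \<and> (\<forall>a b. a < b \<longrightarrow> b \<le> c \<longrightarrow> A (t a) \<inter> A (t b) = B)"
  using assms
proof (induction j arbitrary: A m)
  case 0
  have "A 0 = A 1" using 0(1)[of 0] 0(1)[of 1] 0(5) by auto
  then show ?case using 0(2)[of 0 1] 0(5) by simp
next
  case (Suc j)
  let ?w = "c ^ j"
  have w: "?w \<ge> 1" using Suc.prems(4) by simp
  show ?case
  proof (cases "\<exists>x i. x \<in> A i \<and> x \<in> A (i + ?w) \<and> i + ?w \<le> m")
    case True
    then obtain x i where x: "x \<in> A i" "x \<in> A (i + ?w)" "i + ?w \<le> m" by auto
    have xin: "x \<in> A (i + n)" if "n \<le> ?w" for n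
      using Suc.prems(3)[OF x(1,2), of "i + n"] x(3) that by simp
    let ?A = "\<lambda>n. A (i + n) - {x}"
    have "\<exists>t B. strict_mono_on {..c} t \<and> t c \<le> ?w \<and> (\<forall>a b. a < b \<longrightarrow> b \<le> c \<longrightarrow> ?A (t a) \<inter> ?A (t b) = B)"
    proof (rule Suc.IH[of ?w ?A])
      fix n assume n: "n \<le> ?w"
      show "finite (?A n) \<and> card (?A n) = j"
        using Suc.prems(1)[of "i + n"] n x(3) xin[OF n] by simp
    next
      fix n n' assume n: "n < n'" "n' \<le> ?w"
      then have "A (i + n) \<noteq> A (i + n')" using Suc.prems(2)[of "i + n" "i + n'"] x(3) by simp
      then show "?A n \<noteq> ?A n'" using xin[of n] xin[of n'] n by auto
    next
      fix y a n b assume "y \<in> ?A a" "y \<in> ?A b" "a \<le> n" "n \<le> b" "b \<le> ?w"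
      then show "y \<in> ?A n" using Suc.prems(3)[of y "i + a" "i + b" "i + n"] x(3) by auto
    qed (use Suc.prems in auto)
    then obtain t B where t: "strict_mono_on {..c} t" "t c \<le> ?w"
      and B: "\<And>a b. a < b \<Longrightarrow> b \<le> c \<Longrightarrow> ?A (t a) \<inter> ?A (t b) = B" by blast
    have tb: "t a \<le> ?w" if "a \<le> c" for a
      using strict_mono_on_leD[OF t(1), of a c] t(2) that by simp
    show ?thesis
    proof (intro exI conjI allI impI)
      show "strict_mono_on {..c} (\<lambda>a. i + t a)" using t(1) by (auto simp: strict_mono_on_def)
      show "i + t c \<le> m" using t(2) x(3) by simp
      fix a b :: nat assume ab: "a < b" "b \<le> c"
      show "A (i + t a) \<inter> A (i + t b) = insert x B"
        using B[OF ab] xin[OF tb[of a]] xin[OF tb[of b]] ab by auto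
    qed
  next
    case False
    show ?thesis
    proof (intro exI conjI allI impI)
      show "strict_mono_on {..c} (\<lambda>a. a * ?w)" using w by (auto simp: strict_mono_on_def)
      show "c * ?w \<le> m" using Suc.prems(5) by simp
      fix a b :: nat assume ab: "a < b" "b \<le> c"
      have m: "b * ?w \<le> m" using Suc.prems(5) mult_le_mono1[OF ab(2), of ?w] by (metis le_trans power_Suc)
      have le: "a * ?w + ?w \<le> b * ?w" using mult_right_mono[of "a + 1" b ?w] ab by simp
      have False if "x \<in> A (a * ?w)" "x \<in> A (b * ?w)" for x
        using Suc.prems(3)[OF that, of "a * ?w + ?w"] m le False that(1) by (meson le_add1 le_trans)
      then show "A (a * ?w) \<inter> A (b * ?w) = {}" by auto
    qed
  qed
qed

text \<open>A walk off the kernel \<open>B\<close> has to pass the petals one after the other: a bag lies between two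
  consecutive root sets of the sunflower, and a vertex that is in a bag before \<open>t a\<close> and in a bag after \<open>t
  b\<close> lies in both root sets, hence in \<open>B\<close>. So a step of the walk passes at most one of the
  \<open>c\<close> cut sets.\<close>
lemma centred_from_sunflower:
  assumes cp: "clique_path r j P" and len: "plen P = t c"
    and t0: "t 0 = 0" and mono: "\<And>a b. a < b \<Longrightarrow> b \<le> c \<Longrightarrow> t a < t b"
    and sf: "\<And>a b. a < b \<Longrightarrow> b \<le> c \<Longrightarrow> rset P (t a) \<inter> rset P (t b) = B"
    and c: "c \<ge> 1" and k: "k \<ge> 2"
  shows "centred k (card B) c P" "card B < j"
proof -
  have B: "rset P 0 \<inter> rset P (plen P) = B" using sf[of 0 c] t0 len c by simp
  have pos: "plen P > 0" using mono[of 0 c] len t0 c by simp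
  have "B \<noteq> rset P 0" using rset_distinct[OF cp, of 0 "plen P"] B rset_card[OF cp, of 0] rset_card[OF cp, of "plen P"] pos
    by (metis Int_lower2 card_subset_eq le0 le_refl less_irrefl)
  then show "card B < j" using rset_card[OF cp, of 0] B by (metis Int_lower1 psubset_card_mono psubsetI le0)
  \<comment> \<open>The vertices of the bags after the \<open>a\<close>-th root set of the sunflower, and the last such \<open>a\<close> for a given vertex.\<close>
  define right where "right a = (\<Union>m\<in>{t a + 1..plen P + 1}. pverts P m)" for a
  have mono': "t a \<le> t b" if "a \<le> b" "b \<le> c" for a b
    using mono[of a b] that by (cases "a = b") auto
  have right_mono: "right b \<subseteq> right a" if "a \<le> b" "b \<le> c" for a b
    unfolding right_def using mono'[OF that] by (intro UN_mono) auto
  define h where "h v = Max (insert 0 {a. a \<le> c \<and> v \<in> right a})" for v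
  have fin: "finite (insert 0 {a. a \<le> c \<and> v \<in> right a})" for v by auto
  have hge: "a \<le> h v" if "a \<le> c" "v \<in> right a" for a v
    unfolding h_def by (rule Max_ge) (use that in auto)
  have hle: "h v \<le> a" if "\<And>b. b \<le> c \<Longrightarrow> v \<in> right b \<Longrightarrow> b \<le> a" for a v
    unfolding h_def using that by (subst Max_le_iff) auto
  \<comment> \<open>A vertex both before \<open>t a\<close> and after a later \<open>t b\<close> lies in the kernel.\<close>
  have far: "v \<in> B" if v: "v \<in> pverts P m" "v \<in> right b" and m: "1 \<le> m" "m \<le> t a" "a < b" "b \<le> c" and a: "1 \<le> a" for v m a b
  proof -
    obtain m' where m': "v \<in> pverts P m'" "t b + 1 \<le> m'" "m' \<le> plen P + 1" using v unfolding right_def by auto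
    have "v \<in> rset P (t a)" by (rule bags_meet_in_roots(3)[OF cp v(1) m'(1)]) (use m m' mono[of a b] in auto)
    moreover have "v \<in> rset P (t b)" by (rule bags_meet_in_roots(3)[OF cp v(1) m'(1)]) (use m m' mono[of a b] in auto)
    ultimately show ?thesis using sf[of a b] m by auto
  qed
  \<comment> \<open>The index \<open>a\<close> of the last root set before the bag \<open>m\<close> bounds both values of \<open>h\<close> up to 1.\<close>
  have step: "h w \<le> h v + 1" if vw: "v \<in> pverts P m" "w \<in> pverts P m" "v \<notin> B" "w \<notin> B" "1 \<le> m" "m \<le> plen P + 1" for v w m
  proof (cases "m \<le> plen P")
    case False
    then have "m = plen P + 1" using vw by simp
    then have "v \<in> right c" using vw unfolding right_def by (auto simp: len)
    then show ?thesis using hge[of c v] hle[of w c] by force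
  next
    case True
    define a where "a = Max {a. a \<le> c \<and> t a < m}"
    have fina: "finite {a. a \<le> c \<and> t a < m}" by auto
    have "a \<in> {a. a \<le> c \<and> t a < m}" unfolding a_def using t0 vw by (intro Max_in) auto
    then have a: "a \<le> c" "t a < m" by auto
    have "a \<noteq> c" using a True len by auto
    then have ac: "a + 1 \<le> c" using a by simp
    have "\<not> t (a + 1) < m"
    proof
      assume "t (a + 1) < m"
      then have "a + 1 \<le> a" unfolding a_def by (intro Max_ge) (use fina ac a_def in auto)
      then show False by simp
    qed
    then have tm: "m \<le> t (a + 1)" by simp
    have "v \<in> right a" using vw a unfolding right_def by auto
    then have "a \<le> h v" using hge a by simp
    moreover have "h w \<le> a + 1"
    proof (rule hle)
      fix b assume b: "b \<le> c" "w \<in> right b"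
      show "b \<le> a + 1" using far[of w m b "a + 1"] b vw tm by (metis le_add2 not_le)
    qed
    ultimately show ?thesis by simp
  qed
  show "centred k (card B) c P"
    unfolding centred_def Let_def B
  proof (intro conjI ballI allI impI)
    fix x y d v assume x: "x \<in> rset P 0 - rset P (plen P)" and y: "y \<in> rset P (plen P) - rset P 0"
      and walk: "avoiding_walk (phgraph k P) B x y d v"
    have w: "v 0 = x" "v d = y" "\<And>i. i \<le> d \<Longrightarrow> v i \<notin> B"
      and e: "\<And>i. 1 \<le> i \<Longrightarrow> i \<le> d \<Longrightarrow> \<exists>e\<in>edges (phgraph k P). v (i - 1) \<in> e \<and> v i \<in> e"
      using walk unfolding avoiding_walk_def by auto
    have "h (v i) \<le> i" if "i \<le> d" for i using that
    proof (induction i)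
      case 0
      have "x \<in> pverts P 1" using clique_pathD(6)[OF cp, of 0] x by auto
      moreover have "x \<notin> B" using w(3)[of 0] w(1) by simp
      ultimately have "b \<le> 0" if b: "b \<le> c" "x \<in> right b" for b
      proof (cases "b = 0")
        case False
        obtain m' where m': "x \<in> pverts P m'" "t b + 1 \<le> m'" "m' \<le> plen P + 1" using b unfolding right_def by auto
        have "t b \<ge> 1" using mono[of 0 b] t0 b False by simp
        then have "x \<in> rset P (t b)" using bags_meet_in_roots(3)[OF cp \<open>x \<in> pverts P 1\<close> m'(1), of "t b"] m' by simp
        then show ?thesis using sf[of 0 b] t0 x \<open>x \<notin> B\<close> b False by auto
      qed simp
      then show ?case using hle[of x 0] w by simp
    next
      case (Suc i)
      obtain e where "e \<in> edges (phgraph k P)" "v i \<in> e" "v (Suc i) \<in> e" using e[of "Suc i"] Suc by auto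
      then obtain m where "1 \<le> m" "m \<le> plen P + 1" "v i \<in> pverts P m" "v (Suc i) \<in> pverts P m"
        unfolding phgraph_def nsets_def by (auto; blast)
      then have "h (v (Suc i)) \<le> h (v i) + 1" using step[of "v i" m "v (Suc i)"] w(3) Suc.prems by simp
      then show ?case using Suc by simp
    qed
    then have "h y \<le> d" using w by auto
    moreover have "y \<in> pverts P (Suc (t c))" using y pverts_last[of P] unfolding len by auto
    then have "y \<in> right c" unfolding right_def by (auto simp: len)
    then have "c \<le> h y" by (intro hge) auto
    ultimately show "c \<le> d" by simp
  qed simp
qed

section \<open>Homomorphism sums and gluing\<close>

text \<open>Homomorphisms that need not respect the orders of the root sets.\<close>
definition homs :: "nat \<Rightarrow> hgraph \<Rightarrow> cpath \<Rightarrow> (nat \<Rightarrow> nat) set" where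
  "homs k G P = {\<Phi> \<in> verts (phgraph k P) \<rightarrow>\<^sub>E verts G.
     (\<forall>e\<in>edges (phgraph k P). \<Phi> ` e \<in> edges G) \<and> (\<forall>i\<le>plen P. inj_on \<Phi> (rset P i))}"

text \<open>The first root set is prescribed pointwise, so that maps can be glued.\<close>
definition homs_from :: "nat \<Rightarrow> hgraph \<Rightarrow> cpath \<Rightarrow> (nat \<Rightarrow> nat) \<Rightarrow> (nat \<Rightarrow> nat) set" where
  "homs_from k G P f = {\<Phi> \<in> homs k G P. \<forall>x\<in>rset P 0. \<Phi> x = f x}"

text \<open>With \<open>g\<close> a discrepancy function this is the contribution of one labelled clique-path when a word of
  distributors is unrolled.\<close>
definition hom_sum ::
    "nat \<Rightarrow> nat \<Rightarrow> nat \<Rightarrow> hgraph \<Rightarrow> cpath \<Rightarrow> (nat \<Rightarrow> nat) \<Rightarrow> (nat set \<Rightarrow> real) \<Rightarrow> real" where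
  "hom_sum k r j G P f g =
     (\<Sum>\<Phi>\<in>homs_from k G P f. hom_weight k r j G P \<Phi> * g (\<Phi> ` rset P (plen P)))"

lemma bag_verts: "1 \<le> i \<Longrightarrow> i \<le> plen P + 1 \<Longrightarrow> pverts P i \<subseteq> verts (phgraph k P)"
  by (auto simp: phgraph_def)

lemma bag_edges: "1 \<le> i \<Longrightarrow> i \<le> plen P + 1 \<Longrightarrow> nsets (pverts P i) k \<subseteq> edges (phgraph k P)"
  by (auto simp: phgraph_def)

lemma rset_verts: "clique_path r j P \<Longrightarrow> i \<le> plen P \<Longrightarrow> rset P i \<subseteq> verts (phgraph k P)"
  using clique_pathD(6)[of r j P i] bag_verts[of "i + 1" P k] by auto

lemma finite_verts: "clique_path r j P \<Longrightarrow> finite (verts (phgraph k P))"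
  using finite_pverts[of r j P] by (simp add: phgraph_def)

lemma overlap_verts: "1 \<le> i \<Longrightarrow> i \<le> plen P \<Longrightarrow> overlap P i \<subseteq> verts (phgraph k P)"
  using bag_verts[of i P k] by (auto simp: overlap_def)

lemma hom_weight_cong:
  assumes "\<And>x. x \<in> verts (phgraph k P) \<Longrightarrow> \<Phi> x = \<Psi> x"
  shows "hom_weight k r j G P \<Phi> = hom_weight k r j G P \<Psi>"
  unfolding hom_weight_def
proof (intro prod.cong refl)
  fix i assume "i \<in> {1..plen P}"
  then have "\<Phi> ` overlap P i = \<Psi> ` overlap P i"
    using overlap_verts[of i P k] assms by (intro image_cong) auto
  then show "w_hat r j (card (overlap P i)) / real (card (cliques k r G (\<Phi> ` overlap P i))) =
     w_hat r j (card (overlap P i)) / real (card (cliques k r G (\<Psi> ` overlap P i)))" by simp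
qed

lemma verts_split:
  assumes cp: "clique_path r j P" and q: "q \<le> plen P"
  shows "verts (phgraph k P) = verts (phgraph k (ptake q P)) \<union> verts (phgraph k (pdrop q P))"
    and "verts (phgraph k (ptake q P)) \<inter> verts (phgraph k (pdrop q P)) = rset P q"
    and "edges (phgraph k P) = edges (phgraph k (ptake q P)) \<union> edges (phgraph k (pdrop q P))"
proof -
  note len = clique_pathD(1)[OF cp]
  let ?A = "pverts P ` {1..q}" and ?B = "pverts P ` {q + 1..plen P + 1}"
  have I: "{1..q + 1} = insert (Suc q) {1..q}" by auto
  have t: "pverts (ptake q P) ` {1..q + 1} = insert (rset P q) ?A"
    unfolding I using pverts_ptake[OF q] pverts_ptake_last[OF q] by auto
  have J: "{q + 1..plen P + 1} = (\<lambda>i. q + i) ` {1..plen P - q + 1}"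
  proof -
    have "x \<in> (\<lambda>i. q + i) ` {1..plen P - q + 1}" if "q + 1 \<le> x" "x \<le> plen P + 1" for x
      using that by (intro image_eqI[of _ _ "x - q"]) auto
    then show ?thesis using q by auto
  qed
  have d: "pverts (pdrop q P) ` {1..plen P - q + 1} = ?B"
    unfolding J image_image using pverts_pdrop[OF len, of _ q] q by (intro image_cong) auto
  have sp: "{1..plen P + 1} = {1..q} \<union> {q + 1..plen P + 1}" using q by auto
  have v: "verts (phgraph k P) = \<Union>?A \<union> \<Union>?B"
    unfolding phgraph_def by (simp add: sp image_Un del: One_nat_def)
  have v1: "verts (phgraph k (ptake q P)) = rset P q \<union> \<Union>?A"
    unfolding phgraph_def plen_ptake[OF q] using t by simp
  have v2: "verts (phgraph k (pdrop q P)) = \<Union>?B"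
    unfolding phgraph_def plen_pdrop using d by simp
  have sub: "rset P q \<subseteq> pverts P (q + 1)" using clique_pathD(6)[OF cp q] .
  have subB: "pverts P (q + 1) \<in> ?B" using q by auto
  show "verts (phgraph k P) = verts (phgraph k (ptake q P)) \<union> verts (phgraph k (pdrop q P))"
    unfolding v v1 v2 using sub subB by blast
  have "x \<in> rset P q" if "x \<in> \<Union>?A" "x \<in> \<Union>?B" for x
    using that bags_meet_in_roots(3)[OF cp, of x _ _ q] by (auto simp: Suc_le_eq)
  then show "verts (phgraph k (ptake q P)) \<inter> verts (phgraph k (pdrop q P)) = rset P q"
    unfolding v1 v2 using sub subB by blast
  have e: "edges (phgraph k P) = (\<Union>b\<in>?A. nsets b k) \<union> (\<Union>b\<in>?B. nsets b k)"
    unfolding phgraph_def by (simp add: sp UN_Un del: One_nat_def)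
  have e1: "edges (phgraph k (ptake q P)) = nsets (rset P q) k \<union> (\<Union>b\<in>?A. nsets b k)"
  proof -
    have "edges (phgraph k (ptake q P)) = (\<Union>b\<in>pverts (ptake q P) ` {1..q + 1}. nsets b k)"
      unfolding phgraph_def plen_ptake[OF q] by simp
    then show ?thesis unfolding t by simp
  qed
  have e2: "edges (phgraph k (pdrop q P)) = (\<Union>b\<in>?B. nsets b k)"
  proof -
    have "edges (phgraph k (pdrop q P)) = (\<Union>b\<in>pverts (pdrop q P) ` {1..plen P - q + 1}. nsets b k)"
      unfolding phgraph_def plen_pdrop by simp
    then show ?thesis unfolding d .
  qed
  have "nsets (rset P q) k \<subseteq> nsets (pverts P (q + 1)) k" using sub by (auto simp: nsets_def)
  then show "edges (phgraph k P) = edges (phgraph k (ptake q P)) \<union> edges (phgraph k (pdrop q P))"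
    unfolding e e1 e2 using subB by blast
qed

lemma overlap_ptake:
  assumes cp: "clique_path r j P" and q: "q \<le> plen P" and i: "i \<le> q"
  shows "overlap (ptake q P) i = overlap P i"
proof (cases "i = q")
  case True
  then show ?thesis using root_bag[OF cp q] pverts_ptake[OF q] pverts_ptake_last[OF q]
    by (auto simp: overlap_def)
next
  case False
  then show ?thesis using pverts_ptake[OF q] i by (simp add: overlap_def)
qed

lemma overlap_pdrop:
  assumes cp: "clique_path r j P" and q: "q + i \<le> plen P" and i: "1 \<le> i"
  shows "overlap (pdrop q P) i = overlap P (q + i)"
  using pverts_pdrop[OF clique_pathD(1)[OF cp]] q i by (simp add: overlap_def)

lemma hom_weight_split:
  assumes cp: "clique_path r j P" and q: "q \<le> plen P"
  shows "hom_weight k r j G P \<Phi> = hom_weight k r j G (ptake q P) \<Phi> * hom_weight k r j G (pdrop q P) \<Phi>"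
proof -
  define h where "h i = w_hat r j (card (overlap P i)) / real (card (cliques k r G (\<Phi> ` overlap P i)))" for i
  have "hom_weight k r j G P \<Phi> = prod h {1..q + (plen P - q)}"
    using q by (simp add: hom_weight_def h_def)
  also have "\<dots> = prod h {1..q} * prod h {q + 1..q + (plen P - q)}"
    by (rule prod.ub_add_nat) simp
  also have "prod h {q + 1..q + (plen P - q)} = prod (\<lambda>i. h (i + q)) {1..plen P - q}"
    using prod.shift_bounds_cl_nat_ivl[of h 1 q "plen P - q"] by (simp add: add.commute)
  also have "\<dots> = hom_weight k r j G (pdrop q P) \<Phi>"
    unfolding hom_weight_def plen_pdrop
  proof (intro prod.cong refl)
    fix i assume i: "i \<in> {1..plen P - q}"
    then have "i \<le> plen P - q" by simp
    then have "q + i \<le> plen P" using q by linarith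
    then have "overlap (pdrop q P) i = overlap P (i + q)"
      using overlap_pdrop[OF cp, of q i] i by (simp add: add.commute)
    then show "h (i + q) = w_hat r j (card (overlap (pdrop q P) i)) /
        real (card (cliques k r G (\<Phi> ` overlap (pdrop q P) i)))" by (simp add: h_def)
  qed
  also have "prod h {1..q} = hom_weight k r j G (ptake q P) \<Phi>"
    unfolding hom_weight_def plen_ptake[OF q]
    by (intro prod.cong refl) (use overlap_ptake[OF cp q] in \<open>simp add: h_def\<close>)
  finally show ?thesis .
qed

context host begin

lemma finite_homs: "clique_path r j P \<Longrightarrow> finite (homs k G P)"
  by (rule finite_subset[OF _ finite_PiE[OF finite_verts[of r j P k], of "\<lambda>_. verts G"]])
    (use finV in \<open>auto simp: homs_def\<close>)

lemma finite_homs_from: "clique_path r j P \<Longrightarrow> finite (homs_from k G P f)"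
  using finite_homs by (auto simp: homs_from_def)

lemma homsD:
  assumes "\<Phi> \<in> homs k G P"
  shows "\<Phi> \<in> verts (phgraph k P) \<rightarrow>\<^sub>E verts G" "\<And>e. e \<in> edges (phgraph k P) \<Longrightarrow> \<Phi> ` e \<in> edges G"
    "\<And>i. i \<le> plen P \<Longrightarrow> inj_on \<Phi> (rset P i)"
  using assms by (auto simp: homs_def)

text \<open>A bag has \<open>r > k\<close> vertices and any two of them lie in an edge of the bag, so the map is injective
  there and the image is a clique.\<close>
lemma hom_bag:
  assumes cp: "clique_path r j P" and h: "\<Phi> \<in> homs k G P" and i: "1 \<le> i" "i \<le> plen P"
  shows "inj_on \<Phi> (pverts P i)" "\<Phi> ` pverts P i \<in> Cl {}"
proof -
  let ?F = "pverts P i"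
  have F: "finite ?F" "card ?F = r" using clique_pathD(2)[OF cp i] by auto
  have e: "\<Phi> ` e \<in> edges G" if "e \<subseteq> ?F" "card e = k" for e
  proof -
    have "e \<in> nsets ?F k" using that F finite_subset by (auto simp: nsets_def)
    then show ?thesis using bag_edges[of i P k] i homsD(2)[OF h] by auto
  qed
  show inj: "inj_on \<Phi> ?F"
  proof (rule inj_onI, rule ccontr)
    fix x y assume xy: "x \<in> ?F" "y \<in> ?F" "\<Phi> x = \<Phi> y" "x \<noteq> y"
    have "{x, y} \<subseteq> ?F" "card {x, y} \<le> k" "k \<le> card ?F" using xy k2 rk F by auto
    then obtain e where e': "{x, y} \<subseteq> e" "e \<subseteq> ?F" "card e = k"
      using exists_subset_between[of "{x, y}" k ?F] F by auto
    have "finite e" using e' F finite_subset by auto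
    moreover have "card (\<Phi> ` e) = card e" using e[OF e'(2,3)] edge_D e' by auto
    ultimately have "inj_on \<Phi> e" by (simp add: eq_card_imp_inj_on)
    then show False using xy e' by (auto dest: inj_onD)
  qed
  have "\<Phi> ` ?F \<subseteq> verts G" using homsD(1)[OF h] bag_verts[of i P k] i by auto
  moreover have "card (\<Phi> ` ?F) = r" using inj F by (simp add: card_image)
  moreover have "nsets (\<Phi> ` ?F) k \<subseteq> edges G"
  proof
    fix x assume "x \<in> nsets (\<Phi> ` ?F) k"
    then have x: "x \<subseteq> \<Phi> ` ?F" "card x = k" by (auto simp: nsets_def)
    then obtain e where e': "e \<subseteq> ?F" "x = \<Phi> ` e" by (meson subset_imageE)
    have "card e = k" using e' x inj by (metis card_image inj_on_subset)
    then show "x \<in> edges G" using e e' by auto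
  qed
  ultimately show "\<Phi> ` ?F \<in> Cl {}" using F by (auto simp: cliques_def nsets_def)
qed

lemma hom_root:
  assumes cp: "clique_path r j P" and j: "j \<le> k" and h: "\<Phi> \<in> homs k G P" and i: "i \<le> plen P"
  shows "\<Phi> ` rset P i \<in> E j"
proof -
  have R: "finite (rset P i)" "card (rset P i) = j" using rset_card[OF cp i] by auto
  have sub: "\<Phi> ` rset P i \<subseteq> verts G" using homsD(1)[OF h] rset_verts[OF cp i, of k] by auto
  have c: "card (\<Phi> ` rset P i) = j" using homsD(3)[OF h i] R by (simp add: card_image)
  show ?thesis
  proof (cases "j = k")
    case True
    then have "rset P i \<in> nsets (pverts P (i + 1)) k"
      using R clique_pathD(6)[OF cp i] by (auto simp: nsets_def)
    then have "rset P i \<in> edges (phgraph k P)" using bag_edges[of "i + 1" P k] i by auto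
    then show ?thesis using homsD(2)[OF h] True by (simp add: Ej_def)
  next
    case False
    then show ?thesis using sub c R by (simp add: Ej_def nsets_def)
  qed
qed

text \<open>The two segments share exactly the root set \<open>S\<^sub>q\<close>, so a homomorphism of the whole path is a
  pair of homomorphisms that agree there; overlaps, and hence weights, split accordingly.\<close>
lemma hom_sum_glue:
  assumes cp: "clique_path r j P" and q: "q \<le> plen P"
  shows "hom_sum k r j G P f g =
    (\<Sum>\<Phi>\<in>homs_from k G (ptake q P) f. hom_weight k r j G (ptake q P) \<Phi> * hom_sum k r j G (pdrop q P) \<Phi> g)"
proof -
  let ?P1 = "ptake q P" and ?P2 = "pdrop q P"
  let ?V1 = "verts (phgraph k ?P1)" and ?V2 = "verts (phgraph k ?P2)"
  note len = clique_pathD(1)[OF cp]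
  note sp = verts_split[OF cp q, of k]
  have cp1: "clique_path r j ?P1" and cp2: "clique_path r j ?P2"
    using clique_path_ptake[OF cp q] clique_path_pdrop[OF cp q] by auto
  have pl: "plen ?P1 = q" "plen ?P2 = plen P - q" using plen_ptake[OF q] plen_pdrop by auto
  have r1: "rset ?P1 i = rset P i" if "i \<le> q" for i using rset_ptake that by auto
  have r2: "rset ?P2 i = rset P (q + i)" if "i \<le> plen P - q" for i using rset_pdrop[OF len, of q i] that q by auto
  have rv1: "rset P i \<subseteq> ?V1" if "i \<le> q" for i using rset_verts[OF cp1, of i k] r1 that pl by auto
  have rv2: "rset P i \<subseteq> ?V2" if "q \<le> i" "i \<le> plen P" for i using rset_verts[OF cp2, of "i - q" k] r2[of "i - q"] that pl by auto
  have ev1: "e \<subseteq> ?V1" if "e \<in> edges (phgraph k ?P1)" for e using that by (auto simp: phgraph_def nsets_def)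
  have ev2: "e \<subseteq> ?V2" if "e \<in> edges (phgraph k ?P2)" for e using that by (auto simp: phgraph_def nsets_def)
  let ?j = "\<lambda>\<Phi>. (restrict \<Phi> ?V1, restrict \<Phi> ?V2)"
  let ?i = "\<lambda>(\<Phi>1::nat \<Rightarrow> nat, \<Phi>2::nat \<Rightarrow> nat). \<lambda>x. if x \<in> ?V1 then \<Phi>1 x else \<Phi>2 x"
  let ?T = "SIGMA \<Phi>1:homs_from k G ?P1 f. homs_from k G ?P2 \<Phi>1"
  let ?w1 = "hom_weight k r j G ?P1" and ?w2 = "hom_weight k r j G ?P2"
  have "hom_sum k r j G P f g = (\<Sum>(\<Phi>1, \<Phi>2)\<in>?T. ?w1 \<Phi>1 * (?w2 \<Phi>2 * g (\<Phi>2 ` rset ?P2 (plen ?P2))))"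
    unfolding hom_sum_def
  proof (rule sum.reindex_bij_witness[where i = ?i and j = ?j])
    fix \<Phi> assume "\<Phi> \<in> homs_from k G P f"
    then have h: "\<Phi> \<in> homs k G P" and f: "\<And>x. x \<in> rset P 0 \<Longrightarrow> \<Phi> x = f x" by (auto simp: homs_from_def)
    note hD = homsD[OF h]
    have "x \<in> ?V1 \<union> ?V2 \<longleftrightarrow> x \<in> verts (phgraph k P)" for x using sp by auto
    moreover have "\<Phi> x = undefined" if "x \<notin> verts (phgraph k P)" for x using PiE_arb[OF hD(1) that] .
    ultimately show "?i (?j \<Phi>) = \<Phi>" by (fastforce simp: fun_eq_iff restrict_def)
    have "restrict \<Phi> ?V1 \<in> homs_from k G ?P1 f"
    proof -
      have "restrict \<Phi> ?V1 ` e = \<Phi> ` e" if "e \<in> edges (phgraph k ?P1)" for e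
        using ev1[OF that] by (auto simp: subset_iff image_def)
      moreover have "inj_on (restrict \<Phi> ?V1) (rset ?P1 i)" if "i \<le> q" for i
        using hD(3)[of i] rv1[OF that] r1[OF that] that q by (auto simp: inj_on_def subset_iff)
      moreover have "restrict \<Phi> ?V1 x = f x" if "x \<in> rset ?P1 0" for x using f that r1[of 0] rv1[of 0] by auto
      ultimately show ?thesis using hD(1,2) sp by (auto simp: homs_from_def homs_def pl)
    qed
    moreover have "restrict \<Phi> ?V2 \<in> homs_from k G ?P2 (restrict \<Phi> ?V1)"
    proof -
      have "restrict \<Phi> ?V2 ` e = \<Phi> ` e" if "e \<in> edges (phgraph k ?P2)" for e
        using ev2[OF that] by (auto simp: subset_iff image_def)
      moreover have "inj_on (restrict \<Phi> ?V2) (rset ?P2 i)" if "i \<le> plen P - q" for i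
        using hD(3)[of "q + i"] rv2[of "q + i"] r2[OF that] that q by (auto simp: inj_on_def subset_iff)
      moreover have "restrict \<Phi> ?V2 x = restrict \<Phi> ?V1 x" if "x \<in> rset ?P2 0" for x using that r2[of 0] rv1[of q] rv2[of q] q by auto
      ultimately show ?thesis using hD(1,2) sp by (auto simp: homs_from_def homs_def pl)
    qed
    ultimately show "?j \<Phi> \<in> ?T" by simp
    have "restrict \<Phi> ?V2 ` rset ?P2 (plen ?P2) = \<Phi> ` rset P (plen P)"
      using r2[of "plen P - q"] rv2[of "plen P"] q by (auto simp: pl subset_iff image_def)
    moreover have "?w1 (restrict \<Phi> ?V1) = ?w1 \<Phi>" "?w2 (restrict \<Phi> ?V2) = ?w2 \<Phi>"
      by (rule hom_weight_cong; simp)+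
    ultimately show "(case ?j \<Phi> of (\<Phi>1, \<Phi>2) \<Rightarrow> ?w1 \<Phi>1 * (?w2 \<Phi>2 * g (\<Phi>2 ` rset ?P2 (plen ?P2)))) =
       hom_weight k r j G P \<Phi> * g (\<Phi> ` rset P (plen P))"
      using hom_weight_split[OF cp q, of k G \<Phi>] by simp
  next
    fix b assume "b \<in> ?T"
    then obtain \<Phi>1 \<Phi>2 where b: "b = (\<Phi>1, \<Phi>2)" "\<Phi>1 \<in> homs k G ?P1" "\<Phi>2 \<in> homs k G ?P2"
      and f: "\<And>x. x \<in> rset P 0 \<Longrightarrow> \<Phi>1 x = f x" and ag: "\<And>x. x \<in> rset P q \<Longrightarrow> \<Phi>2 x = \<Phi>1 x"
      using r1[of 0] r2[of 0] by (auto simp: homs_from_def)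
    note h1 = homsD[OF b(2)] and h2 = homsD[OF b(3)]
    let ?\<Phi> = "?i b"
    have e1: "?\<Phi> x = \<Phi>1 x" if "x \<in> ?V1" for x using that b by simp
    have e2: "?\<Phi> x = \<Phi>2 x" if "x \<in> ?V2" for x
    proof (cases "x \<in> ?V1")
      case True
      then have "x \<in> rset P q" using that sp(2) by blast
      then show ?thesis using ag[of x] b True by simp
    qed (simp add: b)
    show "?j ?\<Phi> = b"
      using e1 e2 h1(1) h2(1) by (auto simp: b(1) fun_eq_iff restrict_def PiE_def extensional_def)
    have "?\<Phi> \<in> verts (phgraph k P) \<rightarrow>\<^sub>E verts G"
    proof (rule PiE_I)
      fix x assume "x \<in> verts (phgraph k P)"
      then consider "x \<in> ?V1" | "x \<in> ?V2" using sp by auto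
      then show "?\<Phi> x \<in> verts G" using e1 e2 h1(1) h2(1) by cases auto
    next
      fix x assume "x \<notin> verts (phgraph k P)"
      then have "x \<notin> ?V1" "x \<notin> ?V2" using sp by auto
      then show "?\<Phi> x = undefined" using h2(1) by (auto simp: b(1) PiE_def extensional_def)
    qed
    moreover have "?\<Phi> ` e \<in> edges G" if "e \<in> edges (phgraph k P)" for e
    proof -
      consider "e \<in> edges (phgraph k ?P1)" | "e \<in> edges (phgraph k ?P2)" using \<open>e \<in> _\<close> sp by auto
      then show ?thesis
      proof cases
        case 1
        then have "?\<Phi> ` e = \<Phi>1 ` e" using ev1 e1 by (intro image_cong) auto
        then show ?thesis using 1 h1(2) by simp
      next
        case 2
        then have "?\<Phi> ` e = \<Phi>2 ` e" using ev2 e2 by (intro image_cong) auto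
        then show ?thesis using 2 h2(2) by simp
      qed
    qed
    moreover have "inj_on ?\<Phi> (rset P i)" if i: "i \<le> plen P" for i
    proof (cases "i \<le> q")
      case True
      have "inj_on ?\<Phi> (rset P i) = inj_on \<Phi>1 (rset P i)"
        using e1 rv1[OF True] by (intro inj_on_cong) auto
      then show ?thesis using h1(3)[of i] r1[OF True] True pl by simp
    next
      case False
      have "inj_on ?\<Phi> (rset P i) = inj_on \<Phi>2 (rset P i)"
        using e2 rv2[of i] i False by (intro inj_on_cong) auto
      then show ?thesis using h2(3)[of "i - q"] r2[of "i - q"] False pl i by simp
    qed
    moreover have "?\<Phi> x = f x" if "x \<in> rset P 0" for x using e1[of x] f[OF that] rv1[of 0] that by auto
    ultimately show "?\<Phi> \<in> homs_from k G P f" by (auto simp: homs_from_def homs_def)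
  qed
  also have "\<dots> = (\<Sum>\<Phi>1\<in>homs_from k G ?P1 f. \<Sum>\<Phi>2\<in>homs_from k G ?P2 \<Phi>1. ?w1 \<Phi>1 * (?w2 \<Phi>2 * g (\<Phi>2 ` rset ?P2 (plen ?P2))))"
    using finite_homs_from[OF cp1] finite_homs_from[OF cp2] by (subst sum.Sigma) auto
  finally show ?thesis by (simp add: hom_sum_def sum_distrib_left)
qed

end

section \<open>Clique-paths of length one\<close>

lemma card_extend_bij:
  fixes N M :: "nat set" and B :: "nat set"
  assumes "finite M" "finite B" "card M = card B" "N \<inter> M = {}" "X \<subseteq> extensional N"
  shows "card {\<Phi> \<in> extensional (N \<union> M). restrict \<Phi> N \<in> X \<and> bij_betw \<Phi> M B} = card X * fact (card M)"
proof -
  let ?L = "{\<Phi> \<in> extensional (N \<union> M). restrict \<Phi> N \<in> X \<and> bij_betw \<Phi> M B}"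
  let ?H = "{h \<in> M \<rightarrow>\<^sub>E B. inj_on h M}"
  have H: "h \<in> ?H \<longleftrightarrow> h \<in> extensional M \<and> bij_betw h M B" for h
  proof
    assume h: "h \<in> ?H"
    then have "h ` M \<subseteq> B" "card (h ` M) = card B" using assms by (auto simp: card_image)
    then have "h ` M = B" using assms by (simp add: card_subset_eq)
    then show "h \<in> extensional M \<and> bij_betw h M B" using h by (auto simp: bij_betw_def PiE_def)
  qed (auto simp: bij_betw_def PiE_def)
  have "bij_betw (\<lambda>\<Phi>. (restrict \<Phi> N, restrict \<Phi> M)) ?L (X \<times> ?H)"
  proof (rule bij_betw_byWitness[where f' = "\<lambda>(\<Phi>, h) x. if x \<in> N then \<Phi> x else h x"])
    show "\<forall>\<Phi>\<in>?L. (case (restrict \<Phi> N, restrict \<Phi> M) of (\<Phi>, h) \<Rightarrow> \<lambda>x. if x \<in> N then \<Phi> x else h x) = \<Phi>"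
      by (auto simp: fun_eq_iff restrict_def extensional_def)
    show "\<forall>z\<in>X \<times> ?H. (restrict (case z of (\<Phi>, h) \<Rightarrow> \<lambda>x. if x \<in> N then \<Phi> x else h x) N,
       restrict (case z of (\<Phi>, h) \<Rightarrow> \<lambda>x. if x \<in> N then \<Phi> x else h x) M) = z"
    proof clarify
      fix \<Phi> h assume "\<Phi> \<in> X" "h \<in> M \<rightarrow>\<^sub>E B"
      then have "\<Phi> \<in> extensional N" "h \<in> extensional M" using assms by (auto simp: PiE_def)
      then show "restrict (\<lambda>x. if x \<in> N then \<Phi> x else h x) N = \<Phi> \<and> restrict (\<lambda>x. if x \<in> N then \<Phi> x else h x) M = h"
        using assms(4) by (auto simp: fun_eq_iff restrict_def extensional_def)
    qed
    show "(\<lambda>\<Phi>. (restrict \<Phi> N, restrict \<Phi> M)) ` ?L \<subseteq> X \<times> ?H"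
      by (auto simp: bij_betw_def)
    show "(\<lambda>(\<Phi>, h) x. if x \<in> N then \<Phi> x else h x) ` (X \<times> ?H) \<subseteq> ?L"
    proof clarify
      fix \<Phi> h assume z: "\<Phi> \<in> X" "h \<in> M \<rightarrow>\<^sub>E B" "inj_on h M"
      then have e: "\<Phi> \<in> extensional N" "h \<in> extensional M" "bij_betw h M B" using assms H by auto
      let ?f = "\<lambda>x. if x \<in> N then \<Phi> x else h x"
      have "restrict ?f N = \<Phi>" using e by (auto simp: fun_eq_iff restrict_def extensional_def)
      moreover have "bij_betw ?f M B"
        using e(3) assms(4) by (subst bij_betw_cong[of M ?f h]) auto
      moreover have "?f \<in> extensional (N \<union> M)" using e by (auto simp: extensional_def)
      ultimately show "?f \<in> extensional (N \<union> M) \<and> restrict ?f N \<in> X \<and> bij_betw ?f M B" using z by simp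
    qed
  qed
  then have "card ?L = card X * card ?H"
    by (simp add: bij_betw_same_card card_cartesian_product)
  also have "card ?H = fact (card M)"
    using card_inj_on_subset_funcset[of M B M] assms by (simp add: fact_prod_rev)
  finally show ?thesis .
qed

text \<open>The number of ways to label one walk step: the new vertices fall into three blocks, each of which is mapped
  bijectively onto a prescribed set.\<close>
definition step_factor :: "cpath \<Rightarrow> nat" where
  "step_factor P = fact (card (overlap P 1 - rset P 0)) * fact (card (pverts P 1 - (rset P 0 \<union> overlap P 1)))
     * fact (card (rset P 1 - overlap P 1))"

context host begin

text \<open>Over fixed images \<open>K\<close>, \<open>R\<close>, \<open>U\<close> of the bag, the overlap and the last root
  set, the homomorphisms are the choices of three bijections on disjoint blocks. So the sum over homomorphisms is a constant
  times the sum over walk steps in which \<open>R\<close> meets \<open>T\<close> in the image of the retained roots.\<close>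
lemma hom_sum_single_clique:
  assumes cp: "clique_path r j P" and pl: "plen P = 1" and j: "j \<le> k"
    and f: "inj_on f (rset P 0)" and T: "f ` rset P 0 = T" "T \<in> E j"
  shows "hom_sum k r j G P f g = real (step_factor P) * w_hat r j (card (overlap P 1)) *
    (\<Sum>K\<in>Cl T. \<Sum>R\<in>{R \<in> nsets K (card (overlap P 1)). R \<inter> T = f ` (overlap P 1 \<inter> rset P 0)}.
      (\<Sum>U\<in>{U\<in>E j. R \<subseteq> U}. g U) / kc R)"
proof -
  let ?F = "pverts P 1" and ?S0 = "rset P 0" and ?S1 = "rset P 1" and ?O = "overlap P 1"
  let ?A = "?O \<inter> ?S0" and ?s = "card ?O"
  let ?N1 = "?O - ?S0" and ?N2 = "?F - (?S0 \<union> ?O)" and ?N3 = "?S1 - ?O"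
  let ?V = "verts (phgraph k P)"
  have p2: "pverts P (Suc (Suc 0)) = rset P (Suc 0)" using pverts_last[of P] pl by simp
  have O: "?O = ?F \<inter> ?S1" using p2 by (simp add: overlap_def)
  have F: "finite ?F" "card ?F = r" using clique_pathD(2)[OF cp, of 1] pl by auto
  have S0F: "?S0 \<subseteq> ?F" using clique_pathD(6)[OF cp, of 0] by simp
  have S: "finite ?S0" "card ?S0 = j" "finite ?S1" "card ?S1 = j" using rset_card[OF cp] pl by auto
  have I2: "{Suc 0..Suc (Suc 0)} = {Suc 0, Suc (Suc 0)}" by auto
  have V: "?V = ?F \<union> ?S1" using pl p2 by (simp add: phgraph_def I2)
  have ed: "edges (phgraph k P) = nsets ?F k \<union> nsets ?S1 k"
    using pl p2 by (simp add: phgraph_def I2)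
  have Vp: "?V = ((?S0 \<union> ?N1) \<union> ?N2) \<union> ?N3" using V O S0F by auto
  define Z where "Z = (SIGMA K:Cl T. SIGMA R:{R \<in> nsets K ?s. R \<inter> T = f ` ?A}. {U\<in>E j. R \<subseteq> U})"
  define m where "m \<Phi> = (\<Phi> ` ?F, \<Phi> ` ?O, \<Phi> ` ?S1)" for \<Phi> :: "nat \<Rightarrow> nat"
  have finNs: "finite (nsets K s)" if "K \<in> Cl T" for K s
    using cliquesD(2)[OF that] by (rule finite_imp_finite_nsets)
  have finZ: "finite Z"
    unfolding Z_def using finNs by (intro finite_SigmaI) auto
  have wt: "hom_weight k r j G P \<Phi> = w_hat r j ?s / kc (\<Phi> ` ?O)" for \<Phi>
    by (simp add: hom_weight_def pl)
  have mZ: "m ` homs_from k G P f \<subseteq> Z"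
  proof (rule image_subsetI)
    fix \<Phi> assume "\<Phi> \<in> homs_from k G P f"
    then have h: "\<Phi> \<in> homs k G P" and ff: "\<And>x. x \<in> ?S0 \<Longrightarrow> \<Phi> x = f x" by (auto simp: homs_from_def)
    have T': "\<Phi> ` ?S0 = T" using ff T by auto
    have inj: "inj_on \<Phi> ?F" and K: "\<Phi> ` ?F \<in> Cl {}" using hom_bag[OF cp h, of 1] pl by auto
    have "\<Phi> ` ?F \<in> Cl T" using K T' S0F by (auto simp: cliques_def)
    moreover have "\<Phi> ` ?O \<in> nsets (\<Phi> ` ?F) ?s"
      using O F inj by (auto simp: nsets_def intro: card_image inj_on_subset)
    moreover have "\<Phi> ` ?O \<inter> T = f ` ?A"
    proof -
      have "\<Phi> ` ?O \<inter> \<Phi> ` ?S0 = \<Phi> ` ?A" using inj_on_image_Int[OF inj, of ?O ?S0] O S0F by auto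
      also have "\<dots> = f ` ?A" using ff by auto
      finally show ?thesis using T' by simp
    qed
    moreover have "\<Phi> ` ?S1 \<in> E j" using hom_root[OF cp j h, of 1] pl by simp
    moreover have "\<Phi> ` ?O \<subseteq> \<Phi> ` ?S1" using O by auto
    ultimately show "m \<Phi> \<in> Z" by (simp add: m_def Z_def)
  qed
  \<comment> \<open>The fibre is built block by block: the old roots, the rest of the overlap, the rest of the bag, the rest of the new root set.\<close>
  have fib: "card {\<Phi> \<in> homs_from k G P f. m \<Phi> = z} = step_factor P" if zZ: "z \<in> Z" for z
  proof -
    obtain K R U where z: "z = (K, R, U)" and K: "K \<in> Cl T" and R: "R \<subseteq> K" "finite R" "card R = ?s" "R \<inter> T = f ` ?A"
      and U: "U \<in> E j" "R \<subseteq> U"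
      using zZ by (auto simp: Z_def nsets_def)
    have Kf: "finite K" "card K = r" "T \<subseteq> K" using cliquesD[OF K] by auto
    have Uf: "finite U" "card U = j" "U \<subseteq> verts G" using E_D[OF U(1)] by auto
    have Tf: "finite T" "card T = j" using E_D[OF T(2)] by auto
    have cA: "card (R \<inter> T) = card ?A" using R(4) f by (metis card_image inf_le2 inj_on_subset)
    have finO: "finite ?O" using O F by simp
    have c1: "card ?N1 = card (R - T)"
      using card_Diff_subset_Int[of ?O ?S0] card_Diff_subset_Int[of R T] cA R finO by simp
    have c2: "card ?N2 = card (K - (T \<union> R))"
    proof -
      have "card (?S0 \<union> ?O) = card (T \<union> R)"
        using card_Un_Int[of ?S0 ?O] card_Un_Int[of T R] cA S Tf R finO by (simp add: Int_commute)
      then show ?thesis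
        using card_Diff_subset[of "?S0 \<union> ?O" ?F] card_Diff_subset[of "T \<union> R" K] F Kf S0F O R S Tf finO by auto
    qed
    have c3: "card ?N3 = card (U - R)"
      using card_Diff_subset[of ?O ?S1] card_Diff_subset[of R U] O finO R U Uf S by auto
    define X0 where "X0 = {restrict f ?S0}"
    define X1 where "X1 = {\<Phi> \<in> extensional (?S0 \<union> ?N1). restrict \<Phi> ?S0 \<in> X0 \<and> bij_betw \<Phi> ?N1 (R - T)}"
    define X2 where "X2 = {\<Phi> \<in> extensional ((?S0 \<union> ?N1) \<union> ?N2). restrict \<Phi> (?S0 \<union> ?N1) \<in> X1 \<and> bij_betw \<Phi> ?N2 (K - (T \<union> R))}"
    define X3 where "X3 = {\<Phi> \<in> extensional (((?S0 \<union> ?N1) \<union> ?N2) \<union> ?N3). restrict \<Phi> ((?S0 \<union> ?N1) \<union> ?N2) \<in> X2 \<and> bij_betw \<Phi> ?N3 (U - R)}"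
    have "card X1 = card X0 * fact (card ?N1)"
      unfolding X1_def by (rule card_extend_bij) (use finO R c1 in \<open>auto simp: X0_def\<close>)
    moreover have "card X2 = card X1 * fact (card ?N2)"
      unfolding X2_def by (rule card_extend_bij) (use F Kf c2 in \<open>auto simp: X1_def\<close>)
    moreover have "card X3 = card X2 * fact (card ?N3)"
      unfolding X3_def by (rule card_extend_bij) (use S Uf c3 O S0F in \<open>auto simp: X2_def\<close>)
    ultimately have cX: "card X3 = step_factor P" by (simp add: step_factor_def X0_def)
    have X3: "\<Phi> \<in> X3 \<longleftrightarrow> \<Phi> \<in> extensional ?V \<and> (\<forall>x\<in>?S0. \<Phi> x = f x) \<and> bij_betw \<Phi> ?N1 (R - T) \<and>
       bij_betw \<Phi> ?N2 (K - (T \<union> R)) \<and> bij_betw \<Phi> ?N3 (U - R)" for \<Phi>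
    proof -
      have b1: "bij_betw (restrict \<Phi> ((?S0 \<union> ?N1) \<union> ?N2)) ?N2 B = bij_betw \<Phi> ?N2 B" for B by (intro bij_betw_cong) auto
      have b2: "bij_betw (restrict \<Phi> (?S0 \<union> ?N1)) ?N1 B = bij_betw \<Phi> ?N1 B" for B by (intro bij_betw_cong) auto
      have i1: "((?S0 \<union> ?N1) \<union> ?N2) \<inter> (?S0 \<union> ?N1) = ?S0 \<union> ?N1" "(?S0 \<union> ?N1) \<inter> ?S0 = ?S0"
        "((?S0 \<union> ?N1) \<union> ?N2) \<inter> ?S0 = ?S0" by auto
      have e: "restrict \<Phi> ?S0 = restrict f ?S0 \<longleftrightarrow> (\<forall>x\<in>?S0. \<Phi> x = f x)" by (auto simp: fun_eq_iff restrict_def)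
      show ?thesis
        unfolding X3_def X2_def X1_def X0_def mem_Collect_eq restrict_restrict i1 b1 b2 Vp[symmetric] singleton_iff e
        by auto
    qed
    have "{\<Phi> \<in> homs_from k G P f. m \<Phi> = z} = X3"
    proof (intro set_eqI iffI)
      fix \<Phi> assume "\<Phi> \<in> {\<Phi> \<in> homs_from k G P f. m \<Phi> = z}"
      then have h: "\<Phi> \<in> homs k G P" and ff: "\<And>x. x \<in> ?S0 \<Longrightarrow> \<Phi> x = f x"
        and im: "\<Phi> ` ?F = K" "\<Phi> ` ?O = R" "\<Phi> ` ?S1 = U" by (auto simp: homs_from_def m_def z)
      have T': "\<Phi> ` ?S0 = T" using ff T by auto
      have inj: "inj_on \<Phi> ?F" using hom_bag[OF cp h, of 1] pl by auto
      have inj1: "inj_on \<Phi> ?S1" using homsD(3)[OF h, of 1] pl by auto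
      have "\<Phi> ` ?N1 = R - T" using inj_on_image_set_diff[OF inj, of ?O ?S0] O S0F im T' by auto
      moreover have "\<Phi> ` ?N2 = K - (T \<union> R)"
        using inj_on_image_set_diff[OF inj, of ?F "?S0 \<union> ?O"] O S0F im T' by (auto simp: image_Un)
      moreover have "\<Phi> ` ?N3 = U - R" using inj_on_image_set_diff[OF inj1, of ?S1 ?O] O im by auto
      ultimately show "\<Phi> \<in> X3"
        unfolding X3 bij_betw_def using ff homsD(1)[OF h] inj inj1 O by (auto simp: PiE_def intro: inj_on_subset)
    next
      fix \<Phi> assume "\<Phi> \<in> X3"
      then have ex: "\<Phi> \<in> extensional ?V" and ff: "\<And>x. x \<in> ?S0 \<Longrightarrow> \<Phi> x = f x"
        and b: "bij_betw \<Phi> ?N1 (R - T)" "bij_betw \<Phi> ?N2 (K - (T \<union> R))" "bij_betw \<Phi> ?N3 (U - R)"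
        unfolding X3 by auto
      have b0: "bij_betw \<Phi> ?S0 T" using f T ff by (auto simp: bij_betw_def inj_on_def)
      have bF: "bij_betw \<Phi> ?F K"
      proof -
        have "bij_betw \<Phi> (?S0 \<union> ?N1) (T \<union> (R - T))" by (rule bij_betw_combine[OF b0 b(1)]) auto
        then have "bij_betw \<Phi> ((?S0 \<union> ?N1) \<union> ?N2) ((T \<union> (R - T)) \<union> (K - (T \<union> R)))"
          by (rule bij_betw_combine[OF _ b(2)]) auto
        moreover have "(?S0 \<union> ?N1) \<union> ?N2 = ?F" using S0F O by auto
        moreover have "(T \<union> (R - T)) \<union> (K - (T \<union> R)) = K" using R Kf by auto
        ultimately show ?thesis by simp
      qed
      have imA: "\<Phi> ` ?A = R \<inter> T" using ff R(4) by auto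
      have imO: "\<Phi> ` ?O = R"
      proof -
        have "\<Phi> ` ?O = \<Phi> ` ?A \<union> \<Phi> ` ?N1" by auto
        then show ?thesis using imA b(1) by (auto simp: bij_betw_def)
      qed
      have bO: "bij_betw \<Phi> ?O R" using bF imO O by (auto simp: bij_betw_def intro: inj_on_subset)
      have b1: "bij_betw \<Phi> ?S1 U"
      proof -
        have "bij_betw \<Phi> (?O \<union> ?N3) (R \<union> (U - R))" by (rule bij_betw_combine[OF bO b(3)]) auto
        moreover have "?O \<union> ?N3 = ?S1" "R \<union> (U - R) = U" using O U by auto
        ultimately show ?thesis by simp
      qed
      have "\<Phi> ` ?V \<subseteq> verts G" using bF b1 V cliquesD[OF K] Uf by (auto simp: bij_betw_def)
      moreover have "\<Phi> ` e \<in> edges G" if e: "e \<in> edges (phgraph k P)" for e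
        using e unfolding ed
      proof
        assume e: "e \<in> nsets ?F k"
        then have "\<Phi> ` e \<subseteq> K" "card (\<Phi> ` e) = k" using bF by (auto simp: nsets_def bij_betw_def card_image inj_on_subset)
        then show ?thesis using sub_Cl_E[OF K, of "\<Phi> ` e" k] by (simp add: Ej_def)
      next
        assume e: "e \<in> nsets ?S1 k"
        then have "e \<subseteq> ?S1" "card e = k" by (auto simp: nsets_def)
        moreover have "card e \<le> card ?S1" by (rule card_mono[OF S(3) \<open>e \<subseteq> ?S1\<close>])
        ultimately have "e = ?S1" "j = k" using S j card_subset_eq[of ?S1 e] by auto
        then show ?thesis using b1 U by (auto simp: bij_betw_def Ej_def)
      qed
      moreover have "inj_on \<Phi> (rset P i)" if "i \<le> 1" for i
        using that b0 b1 by (cases "i = 0") (auto simp: bij_betw_def le_Suc_eq)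
      ultimately show "\<Phi> \<in> {\<Phi> \<in> homs_from k G P f. m \<Phi> = z}"
        using ex ff bF imO b1 pl by (auto simp: homs_from_def homs_def m_def z PiE_def bij_betw_def)
    qed
    then show ?thesis using cX by simp
  qed
  have "hom_sum k r j G P f g = (\<Sum>z\<in>Z. \<Sum>\<Phi>\<in>{\<Phi> \<in> homs_from k G P f. m \<Phi> = z}. hom_weight k r j G P \<Phi> * g (\<Phi> ` rset P (plen P)))"
    unfolding hom_sum_def by (rule sum.group[symmetric]) (use finite_homs_from[OF cp] finZ mZ in auto)
  also have "\<dots> = (\<Sum>z\<in>Z. real (step_factor P) * w_hat r j ?s * (g (snd (snd z)) / kc (fst (snd z))))"
  proof (intro sum.cong refl)
    fix z assume z: "z \<in> Z"
    have "(\<Sum>\<Phi>\<in>{\<Phi> \<in> homs_from k G P f. m \<Phi> = z}. hom_weight k r j G P \<Phi> * g (\<Phi> ` rset P (plen P))) =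
      (\<Sum>\<Phi>\<in>{\<Phi> \<in> homs_from k G P f. m \<Phi> = z}. w_hat r j ?s * (g (snd (snd z)) / kc (fst (snd z))))"
      by (intro sum.cong refl) (auto simp: wt m_def pl)
    then show "(\<Sum>\<Phi>\<in>{\<Phi> \<in> homs_from k G P f. m \<Phi> = z}. hom_weight k r j G P \<Phi> * g (\<Phi> ` rset P (plen P))) =
      real (step_factor P) * w_hat r j ?s * (g (snd (snd z)) / kc (fst (snd z)))" using fib[OF z] by simp
  qed
  also have "\<dots> = real (step_factor P) * w_hat r j ?s * (\<Sum>z\<in>Z. g (snd (snd z)) / kc (fst (snd z)))"
    by (simp add: sum_distrib_left)
  also have "(\<Sum>z\<in>Z. g (snd (snd z)) / kc (fst (snd z))) =
    (\<Sum>K\<in>Cl T. \<Sum>R\<in>{R \<in> nsets K ?s. R \<inter> T = f ` ?A}. \<Sum>U\<in>{U\<in>E j. R \<subseteq> U}. g U / kc R)"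
  proof -
    have "(\<Sum>R\<in>{R \<in> nsets K ?s. R \<inter> T = f ` ?A}. \<Sum>U\<in>{U\<in>E j. R \<subseteq> U}. g U / kc R)
      = (\<Sum>y\<in>(SIGMA R:{R \<in> nsets K ?s. R \<inter> T = f ` ?A}. {U\<in>E j. R \<subseteq> U}). g (snd y) / kc (fst y))"
      if "K \<in> Cl T" for K
      using finNs[OF that] by (subst sum.Sigma) (auto simp: case_prod_beta)
    then have "(\<Sum>K\<in>Cl T. \<Sum>R\<in>{R \<in> nsets K ?s. R \<inter> T = f ` ?A}. \<Sum>U\<in>{U\<in>E j. R \<subseteq> U}. g U / kc R)
      = (\<Sum>K\<in>Cl T. \<Sum>y\<in>(SIGMA R:{R \<in> nsets K ?s. R \<inter> T = f ` ?A}. {U\<in>E j. R \<subseteq> U}). g (snd y) / kc (fst y))"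
      by (intro sum.cong) auto
    also have "\<dots> = (\<Sum>z\<in>Z. g (snd (snd z)) / kc (fst (snd z)))"
      unfolding Z_def using finNs by (subst sum.Sigma) (auto simp: case_prod_beta)
    finally show ?thesis by simp
  qed
  finally show ?thesis by (simp add: sum_divide_distrib)
qed

end

section \<open>Unrolling distributors along clique-paths\<close>

text \<open>In the paths built by unrolling, every root set carries the order of its labels, so compatibility of the orders
  is automatic.\<close>
definition sorted_roots :: "cpath \<Rightarrow> bool" where
  "sorted_roots P \<longleftrightarrow> (\<forall>i\<le>plen P. root_seq P i = sorted_list_of_set (rset P i))"

lemma filter_sorted_list_of_set:
  "finite B \<Longrightarrow> filter (\<lambda>x. x \<in> B') (sorted_list_of_set B) = sorted_list_of_set (B \<inter> B')" for B :: "nat set"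
  by (rule sorted_distinct_set_unique) (auto simp: sorted_wrt_filter)

text \<open>New vertices get labels from \<open>N\<close> upwards. The first \<open>s - card A\<close> of them lie in the
  overlap, the remaining ones of the first \<open>r - j\<close> complete the bag, and the last \<open>j - s\<close> complete
  the new root set outside the bag.\<close>
lemma clique_path_extend:
  assumes cp: "clique_path r j P" and so: "sorted_roots P" and A: "A \<subset> rset P (plen P)"
    and s: "card A \<le> s" "s \<le> j" "s - card A \<le> r - j" "j \<le> r"
  shows "\<exists>P'. clique_path r j P' \<and> sorted_roots P' \<and> plen P' = Suc (plen P) \<and> ptake (plen P) P' = P \<and>
    overlap P' (Suc (plen P)) \<inter> rset P (plen P) = A \<and> card (overlap P' (Suc (plen P))) = s"
proof -
  define p where "p = plen P"
  define S where "S = rset P p"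
  have len: "length (snd P) = Suc p" "length (fst P) = p" using clique_pathD(1)[OF cp] by (auto simp: p_def plen_def)
  have "finite (verts (phgraph 0 P))" by (rule finite_verts[OF cp])
  then obtain N where N: "\<And>x. x \<in> verts (phgraph 0 P) \<Longrightarrow> x < N"
    using finite_nat_set_iff_bounded by auto
  have Sc: "finite S" "card S = j" using rset_card[OF cp, of p] by (auto simp: S_def p_def)
  have AS: "A \<subseteq> S" "A \<noteq> S" using A by (auto simp: S_def p_def)
  have fA: "finite A" using AS Sc finite_subset by auto
  have bagN: "x < N" if "x \<in> pverts P i" "i \<le> p + 1" for x i
  proof (cases "i = 0")
    case True
    then have "x \<in> rset P 0" using that by (simp add: pverts_def)
    then show ?thesis using N rset_verts[OF cp, of 0 0] by auto
  next
    case False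
    then show ?thesis using N bag_verts[of i P 0] that by (auto simp: p_def)
  qed
  have rootN: "x < N" if "x \<in> rset P i" "i \<le> p" for x i
    using N rset_verts[OF cp, of i 0] that by (auto simp: p_def)
  have SN: "x < N" if "x \<in> S" for x using rootN that by (auto simp: S_def)
  define F where "F = S \<union> {N..<N + (r - j)}"
  define S' where "S' = A \<union> {N..<N + (s - card A)} \<union> {N + (r - j)..<N + (r - j) + (j - s)}"
  define P' where "P' = (fst P @ [F], snd P @ [sorted_list_of_set S'])"
  have fS': "finite S'" using fA by (simp add: S'_def)
  have pl: "plen P' = Suc p" by (simp add: P'_def plen_def p_def)
  have ro: "root_seq P' i = root_seq P i" if "i \<le> p" for i
    using that len by (simp add: root_seq_def P'_def nth_append)
  have ro': "root_seq P' (Suc p) = sorted_list_of_set S'"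
    using len by (simp add: root_seq_def P'_def nth_append)
  have rs: "rset P' i = rset P i" if "i \<le> p" for i using ro[OF that] by (simp add: rset_def)
  have rs': "rset P' (Suc p) = S'" using ro' fS' by (simp add: rset_def)
  have pv: "pverts P' i = pverts P i" if "i \<le> p" for i
  proof (cases "i = 0")
    case True
    then show ?thesis using rs[of 0] by (simp add: pverts_def)
  next
    case False
    then have "i - 1 < p" using that by simp
    then show ?thesis using that False pl len by (simp add: pverts_def P'_def nth_append p_def)
  qed
  have pv1: "pverts P' (Suc p) = F" using pl len by (simp add: pverts_def P'_def nth_append)
  have pv2: "pverts P' (Suc (Suc p)) = S'" using rs' pl by (simp add: pverts_def)
  have pvS: "pverts P (Suc p) = S" using pverts_last[of P] by (simp add: p_def S_def)
  have cF: "card F = r" "finite F"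
    using Sc SN s(4) by (auto simp: F_def card_Un_disjoint disjoint_iff) (subst card_Un_disjoint; force)
  have cS': "card S' = j"
  proof -
    have "card (A \<union> {N..<N + (s - card A)}) = card A + (s - card A)"
      using fA AS SN by (subst card_Un_disjoint) force+
    moreover have "card S' = card (A \<union> {N..<N + (s - card A)}) + (j - s)"
      unfolding S'_def using fA AS SN s(3) by (subst card_Un_disjoint) force+
    ultimately show ?thesis using s by simp
  qed
  have S'old: "x \<in> A" if "x \<in> S'" "x < N" for x using that by (auto simp: S'_def)
  \<comment> \<open>Since \<open>A\<close> is a proper subset, the new root set has a new label and so differs from all earlier ones.\<close>
  have fresh: "\<exists>x\<in>S'. x \<ge> N"
  proof (rule ccontr)
    assume "\<not> ?thesis"
    then have "S' \<subseteq> A" using S'old by (meson not_le subsetI)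
    then have "card S' \<le> card A" using fA by (simp add: card_mono)
    then show False using cS' AS Sc psubset_card_mono[of S A] by auto
  qed
  have Fold: "x \<in> S" if "x \<in> F" "x < N" for x using that by (auto simp: F_def)
  have new: "root_seq P' (Suc p) \<noteq> root_seq P' i" if "i \<le> p" for i
  proof
    assume "root_seq P' (Suc p) = root_seq P' i"
    then have "S' = rset P i" using rs[OF that] rs' by (simp add: rset_def)
    then show False using fresh rootN[of _ i] that by force
  qed
  have so': "sorted_roots P'"
    using so ro rs ro' rs' by (auto simp: sorted_roots_def pl le_Suc_eq p_def)
  have "clique_path r j P'"
    unfolding clique_path_def pl
  proof (intro conjI allI ballI impI)
    show "length (snd P') = Suc p + 1" using len by (simp add: P'_def)
    fix i assume "i \<in> {1..Suc p}"
    then consider "1 \<le> i" "i \<le> p" | "i = Suc p" by force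
    then show "finite (pverts P' i)" "card (pverts P' i) = r"
      using pv[of i] clique_pathD(2)[OF cp, of i] pv1 cF by (cases; simp add: p_def)+
  next
    fix i assume "i \<le> Suc p"
    then consider "i \<le> p" | "i = Suc p" by force
    then show "distinct (root_seq P' i)" "length (root_seq P' i) = j"
      using ro[of i] clique_pathD(3)[OF cp, of i] ro' cS' by (cases; simp add: p_def)+
  next
    fix i i' assume i: "i \<le> Suc p" "i' \<le> Suc p" "i \<noteq> i'"
    show "root_seq P' i \<noteq> root_seq P' i'"
    proof (cases "i \<le> p \<and> i' \<le> p")
      case True
      then show ?thesis using cp i ro unfolding clique_path_def by (simp add: p_def)
    next
      case False
      then consider "i = Suc p" "i' \<le> p" | "i' = Suc p" "i \<le> p" using i by force
      then show ?thesis using new by cases metis+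
    qed
  next
    fix i assume i: "i \<le> Suc p"
    have U: "x < N" if "x \<in> pverts P' m" "m \<le> p" for x m
      using that pv[of m] bagN[of x m] by simp
    consider "i < p" | "i = p" | "i = Suc p" using i by linarith
    then show "(\<Union>m\<in>{1..i}. pverts P' m) \<inter> pverts P' (i + 1) \<subseteq> pverts P' i \<inter> pverts P' (i + 1)"
    proof cases
      case 1
      then have "(\<Union>m\<in>{1..i}. pverts P' m) = (\<Union>m\<in>{1..i}. pverts P m)" using pv by auto
      then show ?thesis using 1 clique_pathD(4)[OF cp, of i] pv[of i] pv[of "i + 1"] by (simp add: p_def)
    next
      case 2
      then have e: "(\<Union>m\<in>{1..i}. pverts P' m) = (\<Union>m\<in>{1..i}. pverts P m)" using pv by auto
      have "x \<in> pverts P p" if "x \<in> pverts P m" "m \<in> {1..p}" "x \<in> F" for x m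
      proof -
        have "x \<in> S" using Fold[OF that(3)] bagN[of x m] that by auto
        then have "x \<in> (\<Union>m\<in>{1..p}. pverts P m) \<inter> pverts P (p + 1)" using that pvS by auto
        then show ?thesis using clique_pathD(4)[OF cp, of p] unfolding p_def by blast
      qed
      then show ?thesis unfolding e using 2 pv1 pv[of p] by auto
    next
      case 3
      have "x \<in> F" if "x \<in> pverts P' m" "m \<in> {1..Suc p}" "x \<in> S'" for x m
      proof (cases "m = Suc p")
        case True then show ?thesis using that pv1 by simp
      next
        case False
        then have "x < N" using U[of x m] that by auto
        then show ?thesis using S'old that AS by (auto simp: F_def)
      qed
      then show ?thesis using 3 pv1 pv2 by auto
    qed
    consider "i < p" | "i = p" | "i = Suc p" using i by linarith
    then show "pverts P' i \<inter> pverts P' (i + 1) \<subseteq> rset P' i"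
    proof cases
      case 1
      then show ?thesis using clique_pathD(5)[OF cp, of i] pv[of i] pv[of "i + 1"] rs[of i] by (simp add: p_def)
    next
      case 2
      then show ?thesis using Fold bagN[of _ p] pv[of p] pv1 rs[of p] by (auto simp: S_def)
    next
      case 3
      then show ?thesis using pv2 rs' by auto
    qed
    consider "i < p" | "i = p" | "i = Suc p" using i by linarith
    then show "rset P' i \<subseteq> pverts P' (i + 1)"
    proof cases
      case 1
      then show ?thesis using clique_pathD(6)[OF cp, of i] pv[of "i + 1"] rs[of i] by (simp add: p_def)
    next
      case 2
      then show ?thesis using pv1 rs[of p] by (auto simp: S_def F_def)
    next
      case 3
      then show ?thesis using pv2 rs' by auto
    qed
  next
    fix i i' assume i: "i \<le> Suc p" "i' \<le> Suc p"
    have fin: "finite (rset P' n)" for n by (simp add: rset_def)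
    show "filter (\<lambda>x. x \<in> rset P' i') (root_seq P' i) = filter (\<lambda>x. x \<in> rset P' i) (root_seq P' i')"
      using so' i filter_sorted_list_of_set[OF fin, of "rset P' i'" i] filter_sorted_list_of_set[OF fin, of "rset P' i" i']
      by (simp add: sorted_roots_def pl Int_commute)
  qed
  moreover have "ptake p P' = P"
    using len by (simp add: ptake_def P'_def)
  moreover have ov: "overlap P' (Suc p) = A \<union> {N..<N + (s - card A)}"
  proof -
    have "overlap P' (Suc p) = F \<inter> S'" using pv1 pv2 by (simp add: overlap_def)
    then show ?thesis using AS SN s(3) by (force simp: F_def S'_def)
  qed
  moreover have "overlap P' (Suc p) \<inter> S = A" unfolding ov using AS SN by force
  moreover have "card (overlap P' (Suc p)) = s"
    unfolding ov using fA AS SN s(1) by (subst card_Un_disjoint) force+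
  ultimately show ?thesis using so' pl unfolding p_def S_def by blast
qed

lemma w_hat_le: "s \<le> j \<Longrightarrow> j \<le> r \<Longrightarrow> w_hat r j s < 0 \<and> \<bar>w_hat r j s\<bar> \<le> 1"
proof -
  assume "s \<le> j" "j \<le> r"
  then have "((r - s) choose (j - s)) > 0" by (simp add: zero_less_binomial_iff)
  then have "1 \<le> real ((r - s) choose (j - s))" by linarith
  then have "0 < inverse (real ((r - s) choose (j - s)))" "inverse (real ((r - s) choose (j - s))) \<le> 1"
    by (simp_all add: inverse_le_1_iff del: One_nat_def of_nat_0_less_iff of_nat_1_eq_iff)
  then show ?thesis unfolding w_hat_def by linarith
qed

lemma step_factor_ge: "step_factor P \<ge> 1"
  by (simp add: step_factor_def Suc_le_eq)

text \<open>A word lists distributors in the order of composition, the last letter being applied first.\<close>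
definition word_op :: "nat \<Rightarrow> nat \<Rightarrow> hgraph \<Rightarrow> nat list \<Rightarrow> (nat set \<Rightarrow> real) \<Rightarrow> (nat set \<Rightarrow> real)" where
  "word_op k r G ws \<phi> = foldr (distributor k r G) ws \<phi>"

lemma word_op_simps [simp]:
  "word_op k r G [] \<phi> = \<phi>"
  "word_op k r G (s # ws) \<phi> = distributor k r G s (word_op k r G ws \<phi>)"
  "word_op k r G (us @ ws) \<phi> = word_op k r G us (word_op k r G ws \<phi>)"
  by (simp_all add: word_op_def)

context host begin

abbreviation "HS j \<equiv> hom_sum k r j G"

text \<open>The walk steps from \<open>T\<close> are sorted by the set \<open>A\<close> of roots that \<open>R\<close>
  retains. For \<open>A\<close> different from the whole root set they form a clique-path that is one longer. Retaining all
  roots is possible only for \<open>s = j\<close>, and then this term is \<open>-xi j \<phi> T\<close> and cancels the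
  identity term: a distributor at level \<open>j\<close> always moves on to a new root set.\<close>
lemma hom_sum_step:
  assumes cp: "clique_path r j P" and so: "sorted_roots P" and j: "1 \<le> j" "j \<le> k" "s \<le> j"
    and Y: "Y \<ge> 0" and pos: "\<And>S. S \<in> E j \<Longrightarrow> kc S > 0"
    and H0: "s < j \<Longrightarrow> \<bar>HS j P f (xi j \<phi>)\<bar> \<le> Y"
    and H1: "\<And>P'. clique_path r j P' \<Longrightarrow> sorted_roots P' \<Longrightarrow> plen P' = Suc (plen P) \<Longrightarrow>
       ptake (plen P) P' = P \<Longrightarrow> \<bar>HS j P' f (xi j \<phi>)\<bar> \<le> Y"
  shows "\<bar>HS j P f (xi j (Rd s \<phi>))\<bar> \<le> (2 ^ r + 1) * Y"
proof -
  define p where "p = plen P"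
  define S where "S = rset P p"
  have Sc: "finite S" "card S = j" using rset_card[OF cp, of p] by (auto simp: S_def p_def)
  define w where "w = hom_weight k r j G P"
  define u where "u R = (\<Sum>U\<in>{U\<in>E j. R \<subseteq> U}. xi j \<phi> U) / kc R" for R
  define c where "c A \<Phi> = (\<Sum>K\<in>Cl (\<Phi> ` S). \<Sum>R\<in>{R \<in> nsets K s. R \<inter> \<Phi> ` S = \<Phi> ` A}. u R)" for A \<Phi>
  define D where "D A = (\<Sum>\<Phi>\<in>homs_from k G P f. w \<Phi> * (w_hat r j s * c A \<Phi>))" for A
  have jr: "j \<le> r" using j rk by simp
  have hom: "\<Phi> ` S \<in> E j" "inj_on \<Phi> S" if "\<Phi> \<in> homs_from k G P f" for \<Phi>
    using that hom_root[OF cp j(2), of \<Phi> p] homsD(3)[of \<Phi> P p] by (auto simp: homs_from_def S_def p_def)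
  have finNs: "finite (nsets K s)" if "K \<in> Cl T" for K T
    using cliquesD(2)[OF that] by (rule finite_imp_finite_nsets)
  have split: "xi j (Rd s \<phi>) (\<Phi> ` S) = xi j \<phi> (\<Phi> ` S) + (\<Sum>A\<in>Pow S. w_hat r j s * c A \<Phi>)"
    if h: "\<Phi> \<in> homs_from k G P f" for \<Phi>
  proof -
    have A: "(\<Sum>R\<in>nsets K s. u R) = (\<Sum>A\<in>Pow S. \<Sum>R\<in>{R \<in> nsets K s. R \<inter> \<Phi> ` S = \<Phi> ` A}. u R)" if "K \<in> Cl (\<Phi> ` S)" for K
    proof -
      have "(\<Sum>R\<in>nsets K s. u R) = (\<Sum>A\<in>Pow S. \<Sum>R\<in>{R \<in> nsets K s. {x \<in> S. \<Phi> x \<in> R} = A}. u R)"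
        by (rule sum.group[symmetric]) (use finNs[OF that] Sc in auto)
      also have "\<dots> = (\<Sum>A\<in>Pow S. \<Sum>R\<in>{R \<in> nsets K s. R \<inter> \<Phi> ` S = \<Phi> ` A}. u R)"
      proof (intro sum.cong refl)
        fix A assume "A \<in> Pow S"
        then have "{x \<in> S. \<Phi> x \<in> R} = A \<longleftrightarrow> R \<inter> \<Phi> ` S = \<Phi> ` A" for R
          using hom(2)[OF h] by (auto simp: inj_on_def) blast+
        then show "{R \<in> nsets K s. {x \<in> S. \<Phi> x \<in> R} = A} = {R \<in> nsets K s. R \<inter> \<Phi> ` S = \<Phi> ` A}" by auto
      qed
      finally show ?thesis .
    qed
    have "(\<Sum>K\<in>Cl (\<Phi> ` S). \<Sum>R\<in>nsets K s. u R) = (\<Sum>K\<in>Cl (\<Phi> ` S). \<Sum>A\<in>Pow S. \<Sum>R\<in>{R \<in> nsets K s. R \<inter> \<Phi> ` S = \<Phi> ` A}. u R)"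
      by (rule sum.cong[OF refl A])
    also have "\<dots> = (\<Sum>A\<in>Pow S. c A \<Phi>)" unfolding c_def by (rule sum.swap)
    finally show ?thesis
      using discrepancy_distributor_below[OF hom(1)[OF h] j(3,2), of \<phi>] by (simp add: u_def sum_distrib_left)
  qed
  have "HS j P f (xi j (Rd s \<phi>)) = (\<Sum>\<Phi>\<in>homs_from k G P f. w \<Phi> * xi j \<phi> (\<Phi> ` S) + (\<Sum>A\<in>Pow S. w \<Phi> * (w_hat r j s * c A \<Phi>)))"
    unfolding hom_sum_def using split
    by (intro sum.cong refl) (simp add: w_def S_def p_def distrib_left sum_distrib_left)
  also have "\<dots> = HS j P f (xi j \<phi>) + (\<Sum>A\<in>Pow S. D A)"
    unfolding sum.distrib D_def by (subst sum.swap[of _ "Pow S"]) (simp add: hom_sum_def w_def S_def p_def)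
  also have "(\<Sum>A\<in>Pow S. D A) = D S + (\<Sum>A\<in>Pow S - {S}. D A)"
    using Sc by (intro sum.remove) auto
  finally have eq: "HS j P f (xi j (Rd s \<phi>)) = (HS j P f (xi j \<phi>) + D S) + (\<Sum>A\<in>Pow S - {S}. D A)" by simp
  \<comment> \<open>Retaining all roots: nothing for \<open>s < j\<close>, cancellation of the identity term for \<open>s = j\<close>.\<close>
  have top: "\<bar>HS j P f (xi j \<phi>) + D S\<bar> \<le> Y"
  proof (cases "s < j")
    case True
    have "c S \<Phi> = 0" if h: "\<Phi> \<in> homs_from k G P f" for \<Phi>
    proof -
      have "{R \<in> nsets K s. R \<inter> \<Phi> ` S = \<Phi> ` S} = {}" for K
      proof -
        have False if "R \<in> nsets K s" "R \<inter> \<Phi> ` S = \<Phi> ` S" for R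
        proof -
          have "card (\<Phi> ` S) \<le> card R" using that by (intro card_mono) (auto simp: nsets_def)
          then show False using that E_D(3)[OF hom(1)[OF h]] True by (auto simp: nsets_def)
        qed
        then show ?thesis by auto
      qed
      then show ?thesis by (simp only: c_def sum.empty sum.neutral_const)
    qed
    then show ?thesis using H0[OF True] by (simp add: D_def)
  next
    case False
    then have s: "s = j" using j by simp
    have w1: "w_hat r j s = - 1" by (simp add: s w_hat_def)
    have "c S \<Phi> = xi j \<phi> (\<Phi> ` S)" if h: "\<Phi> \<in> homs_from k G P f" for \<Phi>
    proof -
      let ?T = "\<Phi> ` S"
      have T: "finite ?T" "card ?T = j" using E_D[OF hom(1)[OF h]] by auto
      have one: "{R \<in> nsets K s. R \<inter> ?T = ?T} = {?T}" if "K \<in> Cl ?T" for K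
      proof -
        have "R = ?T" if "R \<in> nsets K s" "R \<inter> ?T = ?T" for R
          using that T card_subset_eq[of R ?T] s by (auto simp: nsets_def)
        moreover have "?T \<in> nsets K s" using cliquesD(4)[OF that] T s by (auto simp: nsets_def)
        ultimately show ?thesis by auto
      qed
      have oneU: "{U\<in>E j. ?T \<subseteq> U} = {?T}"
      proof -
        have "U = ?T" if "U \<in> E j" "?T \<subseteq> U" for U
          using that E_D[OF that(1)] T card_subset_eq[of U ?T] by auto
        then show ?thesis using hom(1)[OF h] by auto
      qed
      have "c S \<Phi> = (\<Sum>K\<in>Cl ?T. u ?T)"
        unfolding c_def by (intro sum.cong refl) (simp add: one)
      also have "\<dots> = xi j \<phi> ?T" using pos[OF hom(1)[OF h]] by (auto simp: u_def oneU)
      finally show ?thesis .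
    qed
    then have "D S = - HS j P f (xi j \<phi>)"
      by (simp add: D_def w1 hom_sum_def w_def S_def p_def sum_negf)
    then show ?thesis using Y by simp
  qed
  \<comment> \<open>All other \<open>A\<close> are realised by a longer path, or by no \<open>R\<close> at all when the sizes do not fit.\<close>
  have small: "\<bar>D A\<bar> \<le> Y" if A: "A \<in> Pow S - {S}" for A
  proof (cases "card A \<le> s \<and> s - card A \<le> r - j")
    case True
    obtain P' where P': "clique_path r j P'" "sorted_roots P'" "plen P' = Suc p" "ptake p P' = P"
      "overlap P' (Suc p) \<inter> rset P p = A" "card (overlap P' (Suc p)) = s"
      using clique_path_extend[OF cp so, of A s] True A j jr by (auto simp: p_def S_def)
    have pP: "p \<le> plen P'" using P' by simp
    let ?Q = "pdrop p P'"
    have cpQ: "clique_path r j ?Q" by (rule clique_path_pdrop[OF P'(1) pP])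
    have plQ: "plen ?Q = 1" using P' plen_pdrop by simp
    note lenP' = clique_pathD(1)[OF P'(1)]
    have r0: "rset ?Q 0 = S" using rset_pdrop[OF lenP', of p 0] P' rset_ptake[of p p P'] by (simp add: S_def)
    have ovQ: "overlap ?Q 1 = overlap P' (Suc p)" using overlap_pdrop[OF P'(1), of p 1] P' by simp
    have "HS j P' f (xi j \<phi>) = (\<Sum>\<Phi>\<in>homs_from k G P f. w \<Phi> * HS j ?Q \<Phi> (xi j \<phi>))"
      using hom_sum_glue[OF P'(1) pP] P' by (simp add: w_def)
    also have "\<dots> = (\<Sum>\<Phi>\<in>homs_from k G P f. real (step_factor ?Q) * (w \<Phi> * (w_hat r j s * c A \<Phi>)))"
    proof (intro sum.cong refl)
      fix \<Phi> assume h: "\<Phi> \<in> homs_from k G P f"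
      have "HS j ?Q \<Phi> (xi j \<phi>) = real (step_factor ?Q) * w_hat r j s * c A \<Phi>"
        using hom_sum_single_clique[OF cpQ plQ j(2), of \<Phi> "\<Phi> ` S" "xi j \<phi>"] hom[OF h] r0 ovQ P'
        by (simp add: c_def u_def S_def)
      then show "w \<Phi> * HS j ?Q \<Phi> (xi j \<phi>) = real (step_factor ?Q) * (w \<Phi> * (w_hat r j s * c A \<Phi>))" by simp
    qed
    also have "\<dots> = real (step_factor ?Q) * D A" by (simp add: D_def sum_distrib_left)
    finally have "real (step_factor ?Q) * \<bar>D A\<bar> \<le> Y"
      using H1[OF P'(1,2)] P' by (simp add: p_def abs_mult)
    moreover have "1 * \<bar>D A\<bar> \<le> real (step_factor ?Q) * \<bar>D A\<bar>"
      using step_factor_ge[of ?Q] by (intro mult_right_mono) linarith+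
    ultimately show ?thesis by simp
  next
    case False
    have "c A \<Phi> = 0" if h: "\<Phi> \<in> homs_from k G P f" for \<Phi>
    proof -
      let ?T = "\<Phi> ` S"
      have T: "finite ?T" "card ?T = j" using E_D[OF hom(1)[OF h]] by auto
      have cA: "card (\<Phi> ` A) = card A" using hom(2)[OF h] A by (auto intro: card_image inj_on_subset)
      have none: "{R \<in> nsets K s. R \<inter> ?T = \<Phi> ` A} = {}" if K: "K \<in> Cl ?T" for K
      proof -
        have False if R: "R \<in> nsets K s" "R \<inter> ?T = \<Phi> ` A" for R
        proof -
          have R': "finite R" "card R = s" "R \<subseteq> K" using R by (auto simp: nsets_def)
          have AR: "\<Phi> ` A \<subseteq> R" using R by auto
          then have "card A \<le> s" using card_mono[OF R'(1)] R' cA by metis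
          moreover have "card (R - ?T) = s - card A" using card_Diff_subset_Int[of R ?T] finite_subset[OF AR R'(1)] R R' cA by simp
          moreover have "card (R - ?T) \<le> card (K - ?T)" using R' cliquesD(2)[OF K] by (intro card_mono) auto
          moreover have "card (K - ?T) = r - j" using cliquesD[OF K] T by (simp add: card_Diff_subset)
          ultimately show False using False by simp
        qed
        then show ?thesis by auto
      qed
      show ?thesis unfolding c_def by (rule sum.neutral, rule ballI, simp only: none sum.empty)
    qed
    then show ?thesis using Y by (simp add: D_def)
  qed
  have "\<bar>\<Sum>A\<in>Pow S - {S}. D A\<bar> \<le> (\<Sum>A\<in>Pow S - {S}. \<bar>D A\<bar>)" by (rule sum_abs)
  also have "\<dots> \<le> real (card (Pow S - {S})) * Y" using small by (rule sum_bounded_above)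
  also have "\<dots> \<le> 2 ^ r * Y"
  proof (rule mult_right_mono[OF _ Y])
    have "card (Pow S - {S}) \<le> card (Pow S)" using Sc by (intro card_mono) auto
    also have "\<dots> \<le> 2 ^ r" using Sc jr by (simp add: card_Pow)
    finally show "real (card (Pow S - {S})) \<le> 2 ^ r" by (metis of_nat_le_iff of_nat_numeral of_nat_power)
  qed
  finally show ?thesis using eq top by (simp add: algebra_simps)
qed

abbreviation "wop \<equiv> word_op k r G"

text \<open>Unrolling a word. A letter \<open>j\<close> makes the path strictly longer, which keeps root sets at different
  checkpoints distinct.\<close>
lemma hom_sum_word:
  assumes j: "1 \<le> j" "j \<le> k" and Y: "Y \<ge> 0" and pos: "\<And>S. S \<in> E j \<Longrightarrow> kc S > 0"
  shows "clique_path r j P \<Longrightarrow> sorted_roots P \<Longrightarrow> set ws \<subseteq> {..j} \<Longrightarrow>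
    (\<And>P'. clique_path r j P' \<Longrightarrow> sorted_roots P' \<Longrightarrow> ptake (plen P) P' = P \<Longrightarrow> plen P \<le> plen P' \<Longrightarrow>
       plen P' \<le> plen P + length ws \<Longrightarrow> (j \<in> set ws \<Longrightarrow> plen P < plen P') \<Longrightarrow> \<bar>HS j P' f (xi j \<phi>)\<bar> \<le> Y) \<Longrightarrow>
    \<bar>HS j P f (xi j (wop ws \<phi>))\<bar> \<le> (2 ^ r + 1) ^ length ws * Y"
proof (induction ws arbitrary: P)
  case Nil
  have "ptake (plen P) P = P" using clique_pathD(1)[OF Nil(1)] by (simp add: ptake_def plen_def)
  then show ?case using Nil(4)[OF Nil(1,2)] by simp
next
  case (Cons s ws)
  let ?Y = "(2 ^ r + 1) ^ length ws * Y"
  have "\<bar>HS j P f (xi j (Rd s (wop ws \<phi>)))\<bar> \<le> (2 ^ r + 1) * ?Y"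
  proof (rule hom_sum_step[OF Cons.prems(1,2) j _ _ pos])
    show "s \<le> j" using Cons.prems by simp
    show "0 \<le> ?Y" using Y by simp
    assume sj: "s < j"
    show "\<bar>HS j P f (xi j (wop ws \<phi>))\<bar> \<le> ?Y"
      by (rule Cons.IH[OF Cons.prems(1,2)]) (use Cons.prems sj in auto)
  next
    fix P1 assume P1: "clique_path r j P1" "sorted_roots P1" "plen P1 = Suc (plen P)" "ptake (plen P) P1 = P"
    show "\<bar>HS j P1 f (xi j (wop ws \<phi>))\<bar> \<le> ?Y"
    proof (rule Cons.IH[OF P1(1,2)])
      fix P' assume P': "clique_path r j P'" "sorted_roots P'" "ptake (plen P1) P' = P1" "plen P1 \<le> plen P'"
        "plen P' \<le> plen P1 + length ws"
      have "ptake (plen P) P' = P" using ptake_ptake[of "plen P" "plen P1" P'] P1 P' by simp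
      then show "\<bar>HS j P' f (xi j \<phi>)\<bar> \<le> Y" using Cons.prems(4)[OF P'(1,2)] P' P1 by simp
    qed (use Cons.prems in auto)
  qed
  then show ?case by (simp add: mult.assoc)
qed

end

section \<open>Isomorphisms of clique-paths\<close>

text \<open>Helly property of a path decomposition: any two vertices of \<open>K\<close> share a bag, so the bag in which the
  last vertex of \<open>K\<close> appears contains all of \<open>K\<close>. It is not the final root set, which is too
  small.\<close>
lemma cliques_of_path_are_bags:
  assumes cp: "clique_path r j P" and k: "k \<ge> 2" "k \<le> r" "j < r"
    and K: "K \<subseteq> verts (phgraph k P)" "finite K" "card K = r" "nsets K k \<subseteq> edges (phgraph k P)"
  shows "\<exists>m. 1 \<le> m \<and> m \<le> plen P \<and> K = pverts P m"
proof -
  let ?L = "plen P + 1"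
  have pair: "\<exists>i. 1 \<le> i \<and> i \<le> ?L \<and> x \<in> pverts P i \<and> y \<in> pverts P i" if xy: "x \<in> K" "y \<in> K" for x y
  proof -
    have "card {x, y} \<le> k" using k by (cases "x = y") auto
    then obtain e where e: "{x, y} \<subseteq> e" "e \<subseteq> K" "card e = k"
      using exists_subset_between[of "{x, y}" k K] K k xy by auto
    then have "e \<in> nsets K k" using K finite_subset by (auto simp: nsets_def)
    then have "e \<in> edges (phgraph k P)" using K by auto
    then obtain i where "i \<in> {1..?L}" "e \<in> nsets (pverts P i) k" unfolding phgraph_def by auto
    then have "1 \<le> i \<and> i \<le> ?L \<and> x \<in> pverts P i \<and> y \<in> pverts P i" using e by (auto simp: nsets_def)
    then show ?thesis by blast
  qed
  define mn where "mn v = (LEAST i. 1 \<le> i \<and> v \<in> pverts P i)" for v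
  have mn: "1 \<le> mn v \<and> v \<in> pverts P (mn v)" "\<And>i. 1 \<le> i \<Longrightarrow> v \<in> pverts P i \<Longrightarrow> mn v \<le> i" if vK: "v \<in> K" for v
  proof -
    obtain i where "1 \<le> i \<and> v \<in> pverts P i" using pair[OF vK vK] by blast
    then show "1 \<le> mn v \<and> v \<in> pverts P (mn v)" unfolding mn_def by (rule LeastI)
    show "mn v \<le> i" if "1 \<le> i" "v \<in> pverts P i" for i unfolding mn_def using that by (intro Least_le) auto
  qed
  have "K \<noteq> {}" using K k by auto
  define m where "m = Max (mn ` K)"
  have "m \<in> mn ` K" unfolding m_def using K \<open>K \<noteq> {}\<close> by (intro Max_in) auto
  then obtain v0 where v0: "v0 \<in> K" "m = mn v0" by auto
  have sub: "v \<in> pverts P m" if v: "v \<in> K" for v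
  proof -
    obtain i where i: "1 \<le> i" "i \<le> ?L" "v \<in> pverts P i" "v0 \<in> pverts P i" using pair[OF v v0(1)] by blast
    have 1: "m \<le> i" using mn(2)[OF v0(1) i(1,4)] v0 by simp
    have 2: "mn v \<le> m" unfolding m_def using K v by simp
    show ?thesis
    proof (cases "m = i")
      case True then show ?thesis using i by simp
    next
      case False
      show ?thesis by (rule bags_meet_in_roots(1)[OF cp _ i(3)]) (use mn(1)[OF v] 1 2 False i in auto)
    qed
  qed
  have m1: "1 \<le> m" using mn(1)[OF v0(1)] v0 by simp
  obtain i where "i \<le> ?L" "1 \<le> i" "v0 \<in> pverts P i" using pair[OF v0(1) v0(1)] by blast
  then have mL: "m \<le> ?L" using mn(2)[OF v0(1), of i] v0 by simp
  have "m \<noteq> ?L"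
  proof
    assume "m = ?L"
    then have "K \<subseteq> rset P (plen P)" using sub pverts_last[of P] by auto
    then have "card K \<le> j" using rset_card[OF cp, of "plen P"] card_mono by fastforce
    then show False using K k by simp
  qed
  then have m2: "m \<le> plen P" using mL by simp
  have "K = pverts P m"
    using sub K clique_pathD(2)[OF cp m1 m2] by (intro card_subset_eq) auto
  then show ?thesis using m1 m2 by blast
qed

lemma image_nsets: "inj_on f B \<Longrightarrow> (\<lambda>e. f ` e) ` nsets B k = nsets (f ` B) k"
proof (intro equalityI subsetI)
  fix x assume f: "inj_on f B" and "x \<in> nsets (f ` B) k"
  then have x: "x \<subseteq> f ` B" "finite x" "card x = k" by (auto simp: nsets_def)
  then obtain e where e: "e \<subseteq> B" "x = f ` e" by (meson subset_imageE)
  have "inj_on f e" using f e inj_on_subset by blast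
  then have "finite e" "card e = k" using x e by (auto simp: card_image finite_image_iff)
  then show "x \<in> (\<lambda>e. f ` e) ` nsets B k" using e by (auto simp: nsets_def)
qed (auto simp: nsets_def card_image inj_on_subset)

lemma edges_sub_verts: "e \<in> edges (phgraph k P) \<Longrightarrow> e \<subseteq> verts (phgraph k P)"
  by (auto simp: phgraph_def nsets_def)

text \<open>Isomorphisms that preserve the order of the root sets with index in \<open>M\<close>: \<open>M = {0}\<close>
  gives semi-isomorphisms, \<open>M = UNIV\<close> gives isomorphisms. Maps are extensional so that they can be
  counted.\<close>
definition path_isos :: "nat \<Rightarrow> nat set \<Rightarrow> cpath \<Rightarrow> cpath \<Rightarrow> (nat \<Rightarrow> nat) set" where
  "path_isos k M Q P = {f \<in> extensional (verts (phgraph k Q)). hgraph_iso (phgraph k Q) (phgraph k P) f \<and>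
     (\<forall>i\<in>M. i \<le> plen Q \<longrightarrow> map f (root_seq Q i) = root_seq P i) \<and> (\<forall>i\<le>plen Q. f ` rset Q i = rset P i)}"

abbreviation semi_isos :: "nat \<Rightarrow> cpath \<Rightarrow> cpath \<Rightarrow> (nat \<Rightarrow> nat) set" where
  "semi_isos k \<equiv> path_isos k {0}"

abbreviation isos :: "nat \<Rightarrow> cpath \<Rightarrow> cpath \<Rightarrow> (nat \<Rightarrow> nat) set" where
  "isos k \<equiv> path_isos k UNIV"

lemma semi_isos_def:
  "semi_isos k Q P = {f \<in> extensional (verts (phgraph k Q)). hgraph_iso (phgraph k Q) (phgraph k P) f \<and>
     map f (root_seq Q 0) = root_seq P 0 \<and> (\<forall>i\<le>plen Q. f ` rset Q i = rset P i)}"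
  by (simp add: path_isos_def)

lemma isos_def:
  "isos k Q P = {f \<in> extensional (verts (phgraph k Q)). hgraph_iso (phgraph k Q) (phgraph k P) f \<and>
     (\<forall>i\<le>plen Q. map f (root_seq Q i) = root_seq P i)}"
proof -
  have "f ` rset Q i = rset P i" if "map f (root_seq Q i) = root_seq P i" for f i
    using arg_cong[OF that, of set] by (simp add: rset_def)
  then show ?thesis by (auto simp: path_isos_def)
qed

lemma isos_semi: "isos k Q P \<subseteq> semi_isos k Q P"
  by (auto simp: path_isos_def)

lemma hgraph_isoD:
  assumes "hgraph_iso H H' f"
  shows "inj_on f (verts H)" "f ` verts H = verts H'" "\<And>e. e \<in> edges H \<Longrightarrow> f ` e \<in> edges H'" "(\<lambda>e. f ` e) ` edges H = edges H'"
  using assms by (auto simp: hgraph_iso_def bij_betw_def)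

lemma hgraph_iso_cong:
  assumes "\<And>x. x \<in> verts H \<Longrightarrow> f x = g x" "\<And>e. e \<in> edges H \<Longrightarrow> e \<subseteq> verts H"
  shows "hgraph_iso H H' f = hgraph_iso H H' g"
proof -
  have A: "f ` e = g ` e" if "e \<in> edges H" for e using assms(1) assms(2)[OF that] by (intro image_cong) auto
  have "(\<lambda>e. f ` e) ` edges H = (\<lambda>e. g ` e) ` edges H" by (rule image_cong[OF refl A])
  then show ?thesis unfolding hgraph_iso_def using assms(1) by (simp cong: bij_betw_cong)
qed

lemma hgraph_iso_comp:
  assumes "hgraph_iso H H' f" "hgraph_iso H' H'' g"
  shows "hgraph_iso H H'' (g \<circ> f)"
proof -
  have "(\<lambda>e. (g \<circ> f) ` e) ` edges H = (\<lambda>e. g ` e) ` (\<lambda>e. f ` e) ` edges H" by (auto simp: image_image image_comp)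
  then show ?thesis using assms by (auto simp: hgraph_iso_def intro: bij_betw_trans)
qed

lemma hgraph_iso_inv:
  assumes f: "hgraph_iso H H' f" and e: "\<And>e. e \<in> edges H \<Longrightarrow> e \<subseteq> verts H"
  shows "hgraph_iso H' H (inv_into (verts H) f)"
proof -
  have "(\<lambda>e. inv_into (verts H) f ` e) ` edges H' = (\<lambda>x. inv_into (verts H) f ` (f ` x)) ` edges H"
    unfolding hgraph_isoD(4)[OF f, symmetric] image_image ..
  also have "\<dots> = (\<lambda>x. x) ` edges H"
    using inv_into_image_cancel[OF hgraph_isoD(1)[OF f]] e by (intro image_cong) auto
  finally have "(\<lambda>e. inv_into (verts H) f ` e) ` edges H' = edges H" by simp
  then show ?thesis using f by (auto simp: hgraph_iso_def intro: bij_betw_inv_into)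
qed

lemma path_isos_comp:
  assumes f: "f \<in> path_isos k M Q P" and g: "g \<in> path_isos k M P R" and pl: "plen P = plen Q" and cp: "clique_path r j Q"
  shows "compose (verts (phgraph k Q)) g f \<in> path_isos k M Q R"
proof -
  have "hgraph_iso (phgraph k Q) (phgraph k R) (g \<circ> f)"
    using f g by (auto simp: path_isos_def intro: hgraph_iso_comp)
  then have "hgraph_iso (phgraph k Q) (phgraph k R) (compose (verts (phgraph k Q)) g f)"
    by (subst hgraph_iso_cong[where g = "g \<circ> f"]) (auto simp: compose_def dest: edges_sub_verts)
  moreover have "map (compose (verts (phgraph k Q)) g f) (root_seq Q i) = root_seq R i" if i: "i \<in> M" "i \<le> plen Q" for i
  proof -
    have "map (compose (verts (phgraph k Q)) g f) (root_seq Q i) = map g (map f (root_seq Q i))"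
      using rset_verts[OF cp i(2), of k] by (auto simp: compose_def rset_def)
    also have "\<dots> = root_seq R i" using f g i pl by (simp add: path_isos_def del: map_map)
    finally show ?thesis .
  qed
  moreover have "compose (verts (phgraph k Q)) g f ` rset Q i = rset R i" if i: "i \<le> plen Q" for i
  proof -
    have "compose (verts (phgraph k Q)) g f ` rset Q i = g ` (f ` rset Q i)"
      unfolding image_image using rset_verts[OF cp i, of k] by (intro image_cong) (auto simp: compose_def)
    then show ?thesis using f g i pl by (simp add: path_isos_def)
  qed
  ultimately show ?thesis by (auto simp: path_isos_def compose_def)
qed

definition pinv :: "nat \<Rightarrow> cpath \<Rightarrow> cpath \<Rightarrow> (nat \<Rightarrow> nat) \<Rightarrow> nat \<Rightarrow> nat" where
  "pinv k Q P f = restrict (inv_into (verts (phgraph k Q)) f) (verts (phgraph k P))"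

lemma hgraph_iso_pinv:
  assumes "hgraph_iso (phgraph k Q) (phgraph k P) f"
  shows "hgraph_iso (phgraph k P) (phgraph k Q) (pinv k Q P f)"
    and "\<And>x. x \<in> verts (phgraph k Q) \<Longrightarrow> pinv k Q P f (f x) = x"
    and "\<And>y. y \<in> verts (phgraph k P) \<Longrightarrow> f (pinv k Q P f y) = y"
proof -
  have "hgraph_iso (phgraph k P) (phgraph k Q) (inv_into (verts (phgraph k Q)) f)"
    by (rule hgraph_iso_inv[OF assms edges_sub_verts])
  then show "hgraph_iso (phgraph k P) (phgraph k Q) (pinv k Q P f)"
    unfolding pinv_def by (subst hgraph_iso_cong[where g = "inv_into (verts (phgraph k Q)) f"]) (auto dest: edges_sub_verts)
  show "pinv k Q P f (f x) = x" if "x \<in> verts (phgraph k Q)" for x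
    using hgraph_isoD(1,2)[OF assms] that by (auto simp: pinv_def)
  show "f (pinv k Q P f y) = y" if "y \<in> verts (phgraph k P)" for y
    using hgraph_isoD(2)[OF assms] that by (auto simp: pinv_def f_inv_into_f)
qed

lemma path_isos_inv:
  assumes f: "f \<in> path_isos k M Q P" and pl: "plen P = plen Q" and cp: "clique_path r j Q"
  shows "pinv k Q P f \<in> path_isos k M P Q"
proof -
  have h: "hgraph_iso (phgraph k Q) (phgraph k P) f" using f by (simp add: path_isos_def)
  note pinv_f = hgraph_iso_pinv(2)[OF h]
  have "map (pinv k Q P f) (root_seq P i) = root_seq Q i" if i: "i \<in> M" "i \<le> plen Q" for i
  proof -
    have "root_seq P i = map f (root_seq Q i)" using f i by (simp add: path_isos_def)
    then show ?thesis using pinv_f rset_verts[OF cp i(2), of k] by (auto simp: map_idI rset_def subset_iff)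
  qed
  moreover have "pinv k Q P f ` rset P i = rset Q i" if i: "i \<le> plen Q" for i
  proof -
    have "rset P i = f ` rset Q i" using f i by (simp add: path_isos_def)
    then have "pinv k Q P f ` rset P i = (\<lambda>x. pinv k Q P f (f x)) ` rset Q i" by (simp add: image_image)
    also have "\<dots> = (\<lambda>x. x) ` rset Q i" using pinv_f rset_verts[OF cp i, of k] by (intro image_cong) auto
    finally show ?thesis by simp
  qed
  ultimately show ?thesis using hgraph_iso_pinv(1)[OF h] pl by (auto simp: path_isos_def pinv_def)
qed

text \<open>An isomorphism of hypergraphs permutes the bags, because these are the \<open>r\<close>-cliques. The bag
  \<open>i\<close> contains \<open>S\<^sub>i\<^sub>-\<^sub>1\<close>; if it were sent to a later bag,
  \<open>S\<^sub>i\<^sub>-\<^sub>1\<close> would be contained in \<open>S\<^sub>i\<close>. A permutation that never moves an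
  index up is the identity.\<close>
lemma semi_iso_bags:
  assumes cpQ: "clique_path r j Q" and cpP: "clique_path r j P" and pl: "plen P = plen Q"
    and k: "k \<ge> 2" "k \<le> r" "j < r" and f: "f \<in> semi_isos k Q P" and i: "1 \<le> i" "i \<le> plen Q + 1"
  shows "f ` pverts Q i = pverts P i"
proof (cases "i = plen Q + 1")
  case True
  then show ?thesis using f pl pverts_last[of Q] pverts_last[of P] by (simp add: semi_isos_def)
next
  case False
  then have "i \<le> plen Q" using i by simp
  then show ?thesis using i(1)
  proof (induction i rule: less_induct)
    case (less i)
    have h: "hgraph_iso (phgraph k Q) (phgraph k P) f" using f by (simp add: semi_isos_def)
    note hD = hgraph_isoD[OF h]
    have bQ: "pverts Q i \<subseteq> verts (phgraph k Q)" using bag_verts[of i Q k] less by simp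
    have inj: "inj_on f (pverts Q i)" using hD(1) bQ inj_on_subset by blast
    have F: "finite (pverts Q i)" "card (pverts Q i) = r" using clique_pathD(2)[OF cpQ, of i] less by auto
    have "\<exists>m. 1 \<le> m \<and> m \<le> plen P \<and> f ` pverts Q i = pverts P m"
    proof (rule cliques_of_path_are_bags[OF cpP k])
      show "f ` pverts Q i \<subseteq> verts (phgraph k P)" using bQ hD(2) by auto
      show "finite (f ` pverts Q i)" "card (f ` pverts Q i) = r" using F inj by (auto simp: card_image)
      show "nsets (f ` pverts Q i) k \<subseteq> edges (phgraph k P)"
        unfolding image_nsets[OF inj, symmetric] using hD(3) bag_edges[of i Q k] less by auto
    qed
    then obtain m where m: "1 \<le> m" "m \<le> plen P" "f ` pverts Q i = pverts P m" by blast
    \<comment> \<open>Otherwise \<open>S\<^sub>i\<^sub>-\<^sub>1\<close> would lie in the bags \<open>i\<close> and \<open>m > i\<close>, hence in \<open>S\<^sub>i\<close>.\<close>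
    have "\<not> i < m"
    proof
      assume im: "i < m"
      have "rset P (i - 1) = f ` rset Q (i - 1)" using f less by (simp add: semi_isos_def)
      also have "\<dots> \<subseteq> f ` pverts Q i" using clique_pathD(6)[OF cpQ, of "i - 1"] less by (intro image_mono) auto
      also have "\<dots> = pverts P m" by (rule m(3))
      finally have a: "rset P (i - 1) \<subseteq> pverts P m" .
      have b: "rset P (i - 1) \<subseteq> pverts P i" using clique_pathD(6)[OF cpP, of "i - 1"] less pl by auto
      have "rset P (i - 1) \<subseteq> rset P i"
        using bags_meet_in_roots(3)[OF cpP, of _ i m i] a b im less m by auto
      then have "rset P (i - 1) = rset P i"
        using rset_card[OF cpP, of "i - 1"] rset_card[OF cpP, of i] less pl by (intro card_subset_eq) auto
      moreover have "i - 1 \<noteq> i" "i - 1 \<le> plen P" "i \<le> plen P" using less.prems pl by arith+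
      ultimately show False using rset_distinct[OF cpP, of "i - 1" i] by blast
    qed
    moreover have "\<not> m < i"
    proof
      assume mi: "m < i"
      have "f ` pverts Q m = pverts P m" using less.IH[OF mi] m mi less by simp
      then have "f ` pverts Q m = f ` pverts Q i" using m by simp
      then have "pverts Q m = pverts Q i"
        using inj_on_image_eq_iff[OF hD(1), of "pverts Q m" "pverts Q i"] bQ bag_verts[of m Q k] m pl by auto
      then have "pverts Q i \<subseteq> rset Q m"
        using bags_meet_in_roots(3)[OF cpQ, of _ m i m] m mi less by auto
      then have "card (pverts Q i) \<le> card (rset Q m)" using rset_card[OF cpQ, of m] m pl by (intro card_mono) auto
      then show False using rset_card[OF cpQ, of m] m pl F k by simp
    qed
    ultimately have "m = i" by simp
    then show ?case using m by simp
  qed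
qed

lemma semi_iso_overlap:
  assumes cpQ: "clique_path r j Q" and cpP: "clique_path r j P" and pl: "plen P = plen Q"
    and k: "k \<ge> 2" "k \<le> r" "j < r" and f: "f \<in> semi_isos k Q P" and i: "1 \<le> i" "i \<le> plen Q"
  shows "f ` overlap Q i = overlap P i" "card (overlap Q i) = card (overlap P i)"
proof -
  have h: "hgraph_iso (phgraph k Q) (phgraph k P) f" using f by (simp add: semi_isos_def)
  have b: "pverts Q i \<subseteq> verts (phgraph k Q)" "pverts Q (i + 1) \<subseteq> verts (phgraph k Q)"
    using bag_verts[of i Q k] bag_verts[of "i + 1" Q k] i by auto
  show 1: "f ` overlap Q i = overlap P i"
    unfolding overlap_def inj_on_image_Int[OF hgraph_isoD(1)[OF h] b]
    using semi_iso_bags[OF cpQ cpP pl k f, of i] semi_iso_bags[OF cpQ cpP pl k f, of "i + 1"] i by simp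
  have "inj_on f (overlap Q i)"
    by (rule inj_on_subset[OF hgraph_isoD(1)[OF h]]) (use b in \<open>auto simp: overlap_def\<close>)
  then show "card (overlap Q i) = card (overlap P i)" using 1 card_image by metis
qed

lemma card_le_postcompose:
  assumes "finite B" "\<And>h. h \<in> A \<Longrightarrow> h \<in> extensional V \<and> h ` V \<subseteq> W" "inj_on f W" "\<And>h. h \<in> A \<Longrightarrow> compose V f h \<in> B"
  shows "card A \<le> card B"
proof (rule card_inj_on_le[where f = "compose V f"])
  show "inj_on (compose V f) A"
  proof (rule inj_onI)
    fix h h' assume h: "h \<in> A" "h' \<in> A" "compose V f h = compose V f h'"
    show "h = h'"
    proof (rule extensionalityI[of _ V])
      fix x assume x: "x \<in> V"
      have "f (h x) = f (h' x)" using fun_cong[OF h(3), of x] x by (simp add: compose_def)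
      then show "h x = h' x" using assms(2)[OF h(1)] assms(2)[OF h(2)] x assms(3) by (auto dest: inj_onD)
    qed (use assms(2) h in auto)
  qed
qed (use assms in auto)

lemma card_le_precompose:
  assumes "finite B" "\<And>h. h \<in> A \<Longrightarrow> h \<in> extensional W" "f ` V = W" "\<And>h. h \<in> A \<Longrightarrow> compose V h f \<in> B"
  shows "card A \<le> card B"
proof (rule card_inj_on_le[where f = "\<lambda>h. compose V h f"])
  show "inj_on (\<lambda>h. compose V h f) A"
  proof (rule inj_onI)
    fix h h' assume h: "h \<in> A" "h' \<in> A" "compose V h f = compose V h' f"
    show "h = h'"
    proof (rule extensionalityI[of _ W])
      fix y assume "y \<in> W"
      then obtain x where x: "x \<in> V" "y = f x" using assms(3) by auto
      show "h y = h' y" using fun_cong[OF h(3), of x] x by (simp add: compose_def)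
    qed (use assms(2) h in auto)
  qed
qed (use assms in auto)

lemma finite_semi_isos:
  assumes "clique_path r j Q" "clique_path r j P"
  shows "finite (semi_isos k Q P)"
proof -
  have "semi_isos k Q P \<subseteq> verts (phgraph k Q) \<rightarrow>\<^sub>E verts (phgraph k P)"
    by (auto simp: semi_isos_def PiE_def dest: hgraph_isoD(2))
  then show ?thesis using finite_PiE[OF finite_verts[OF assms(1)]] finite_verts[OF assms(2)] finite_subset by fastforce
qed

text \<open>Composition with a fixed semi-isomorphism and with its inverse.\<close>
lemma card_semi_isos:
  assumes cpQ: "clique_path r j Q" and cpP: "clique_path r j P" and pl: "plen P = plen Q" and f: "f \<in> semi_isos k Q P"
  shows "card (semi_isos k Q P) = card (semi_isos k Q Q)"
proof (rule antisym)
  have h: "hgraph_iso (phgraph k Q) (phgraph k P) f" using f by (simp add: semi_isos_def)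
  have ex: "g \<in> extensional (verts (phgraph k Q)) \<and> g ` verts (phgraph k Q) \<subseteq> verts (phgraph k R)" if "g \<in> semi_isos k Q R" for g R
    using that by (auto simp: semi_isos_def dest: hgraph_isoD(2))
  show "card (semi_isos k Q Q) \<le> card (semi_isos k Q P)"
    by (rule card_le_postcompose[OF finite_semi_isos[OF cpQ cpP] ex hgraph_isoD(1)[OF h]])
      (use path_isos_comp[OF _ f _ cpQ] in auto)
  show "card (semi_isos k Q P) \<le> card (semi_isos k Q Q)"
    by (rule card_le_postcompose[OF finite_semi_isos[OF cpQ cpQ] ex hgraph_isoD(1)[OF hgraph_iso_pinv(1)[OF h]]])
      (use path_isos_comp[OF _ path_isos_inv[OF f pl cpQ] pl cpQ] in auto)
qed

lemma card_isos:
  assumes cpQ: "clique_path r j Q" and cpP: "clique_path r j P" and pl: "plen P = plen Q" and f: "f \<in> isos k Q P"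
  shows "card (isos k Q P) = card (isos k P P)"
proof (rule antisym)
  have h: "hgraph_iso (phgraph k Q) (phgraph k P) f" using f by (simp add: isos_def)
  have ex: "g \<in> extensional (verts (phgraph k R))" if "g \<in> isos k R R'" for g R R'
    using that by (auto simp: isos_def)
  have fin: "finite (isos k R P)" if "clique_path r j R" for R
    using finite_semi_isos[OF that cpP] isos_semi finite_subset by metis
  show "card (isos k P P) \<le> card (isos k Q P)"
    by (rule card_le_precompose[OF fin[OF cpQ] ex hgraph_isoD(2)[OF h]]) (use path_isos_comp[OF f _ pl cpQ] in auto)
  show "card (isos k Q P) \<le> card (isos k P P)"
    by (rule card_le_precompose[OF fin[OF cpP] ex hgraph_isoD(2)[OF hgraph_iso_pinv(1)[OF h]]])
      (use path_isos_comp[OF path_isos_inv[OF f pl cpQ] _ pl[symmetric] cpP] in auto)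
qed

section \<open>Semi-copies\<close>

text \<open>The permutations that identify homomorphisms in a semi-copy. The next lemmas show that they are the automorphisms
  of the clique-path.\<close>
definition free_perms :: "cpath \<Rightarrow> (nat \<Rightarrow> nat) set" where
  "free_perms P = {\<sigma>. \<sigma> permutes (\<Union>i\<in>{1..plen P}. free_block P i) \<and>
     (\<forall>i\<in>{1..plen P}. \<sigma> ` free_block P i = free_block P i)}"

lemma free_block_not_root:
  assumes cp: "clique_path r j P" and x: "x \<in> free_block P i" "1 \<le> i" "i \<le> plen P" and m: "m \<le> plen P"
  shows "x \<notin> rset P m"
proof
  assume xm: "x \<in> rset P m"
  have xi: "x \<in> pverts P i" "x \<notin> rset P (i - 1)" "x \<notin> rset P i" using x by (auto simp: free_block_def)
  have xb: "x \<in> pverts P (m + 1)" using clique_pathD(6)[OF cp m] xm by auto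
  consider "i < m + 1" | "i = m + 1" | "m + 1 < i" by linarith
  then show False
  proof cases
    case 1 then show False using bags_meet_in_roots(3)[OF cp xi(1) xb, of i] x m xi by auto
  next
    case 2 then show False using xm xi by auto
  next
    case 3 then show False using bags_meet_in_roots(3)[OF cp xb xi(1), of "i - 1"] x xi by auto
  qed
qed

lemma verts_free_or_root:
  assumes cp: "clique_path r j P" and x: "x \<in> verts (phgraph k P)"
  shows "x \<in> (\<Union>i\<in>{1..plen P}. free_block P i) \<or> (\<exists>m\<le>plen P. x \<in> rset P m)"
proof -
  obtain i where i: "1 \<le> i" "i \<le> plen P + 1" "x \<in> pverts P i" using x by (auto simp: phgraph_def)
  show ?thesis
  proof (cases "i = plen P + 1")
    case True
    then show ?thesis using i pverts_last[of P] by auto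
  next
    case False
    then show ?thesis using i by (auto simp: free_block_def intro: exI[of _ "i - 1"] exI[of _ i])
  qed
qed

lemma free_perm_iso:
  assumes cp: "clique_path r j P" and \<sigma>: "\<sigma> \<in> free_perms P"
  shows "restrict \<sigma> (verts (phgraph k P)) \<in> isos k P P"
proof -
  let ?V = "verts (phgraph k P)" and ?B = "\<Union>i\<in>{1..plen P}. free_block P i"
  have p: "\<sigma> permutes ?B" and b: "\<And>i. 1 \<le> i \<Longrightarrow> i \<le> plen P \<Longrightarrow> \<sigma> ` free_block P i = free_block P i"
    using \<sigma> by (auto simp: free_perms_def)
  have fx: "\<sigma> x = x" if "x \<in> rset P m" "m \<le> plen P" for x m
  proof -
    have "x \<notin> free_block P i" if "i \<in> {1..plen P}" for i
      using free_block_not_root[OF cp, of x i m] \<open>x \<in> rset P m\<close> \<open>m \<le> plen P\<close> that by auto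
    then show ?thesis by (intro permutes_not_in[OF p]) blast
  qed
  have inj: "inj \<sigma>" using p by (rule permutes_inj)
  have fixr: "\<sigma> ` A = A" if "\<And>x. x \<in> A \<Longrightarrow> \<exists>m\<le>plen P. x \<in> rset P m" for A
  proof -
    have "\<sigma> ` A = (\<lambda>x. x) ` A" using that fx by (intro image_cong refl) blast
    then show ?thesis by simp
  qed
  have bag: "\<sigma> ` pverts P i = pverts P i" if i: "1 \<le> i" "i \<le> plen P + 1" for i
  proof (cases "i = plen P + 1")
    case True
    then show ?thesis using fixr[of "pverts P i"] pverts_last[of P] by auto
  next
    case False
    then have sp: "pverts P i = free_block P i \<union> (pverts P i \<inter> (rset P (i - 1) \<union> rset P i))" by (auto simp: free_block_def)
    have "\<sigma> ` (pverts P i \<inter> (rset P (i - 1) \<union> rset P i)) = pverts P i \<inter> (rset P (i - 1) \<union> rset P i)"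
      using False i by (intro fixr) (auto intro: exI[of _ "i - 1"] exI[of _ i])
    moreover have "\<sigma> ` free_block P i = free_block P i" using b False i by auto
    ultimately show ?thesis using arg_cong[OF sp, of "image \<sigma>"] sp by (simp add: image_Un)
  qed
  have V: "\<sigma> ` ?V = ?V" using bag by (auto simp: phgraph_def image_UN)
  have "(\<lambda>e. \<sigma> ` e) ` edges (phgraph k P) = (\<Union>i\<in>{1..plen P + 1}. (\<lambda>e. \<sigma> ` e) ` nsets (pverts P i) k)"
    by (simp add: phgraph_def image_UN)
  also have "\<dots> = (\<Union>i\<in>{1..plen P + 1}. nsets (pverts P i) k)"
  proof (intro SUP_cong refl)
    fix i assume i: "i \<in> {1..plen P + 1}"
    have "(\<lambda>e. \<sigma> ` e) ` nsets (pverts P i) k = nsets (\<sigma> ` pverts P i) k"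
      by (rule image_nsets[OF inj_on_subset[OF inj subset_UNIV]])
    then show "(\<lambda>e. \<sigma> ` e) ` nsets (pverts P i) k = nsets (pverts P i) k" using bag i by simp
  qed
  finally have "(\<lambda>e. \<sigma> ` e) ` edges (phgraph k P) = edges (phgraph k P)" by (simp add: phgraph_def)
  then have "hgraph_iso (phgraph k P) (phgraph k P) \<sigma>"
    using V inj by (auto simp: hgraph_iso_def bij_betw_def intro: inj_on_subset)
  then have "hgraph_iso (phgraph k P) (phgraph k P) (restrict \<sigma> ?V)"
    by (subst hgraph_iso_cong[where g = \<sigma>]) (auto dest: edges_sub_verts)
  moreover have "map (restrict \<sigma> ?V) (root_seq P i) = root_seq P i" if i: "i \<le> plen P" for i
    using fx[OF _ i] rset_verts[OF cp i, of k] by (auto simp: map_idI rset_def subset_iff)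
  ultimately show ?thesis by (simp add: isos_def)
qed

lemma iso_free_perm:
  assumes cp: "clique_path r j P" and k: "k \<ge> 2" "k \<le> r" "j < r" and f: "f \<in> isos k P P"
  shows "\<exists>\<sigma>\<in>free_perms P. restrict \<sigma> (verts (phgraph k P)) = f"
proof -
  let ?V = "verts (phgraph k P)" and ?B = "\<Union>i\<in>{1..plen P}. free_block P i"
  have h: "hgraph_iso (phgraph k P) (phgraph k P) f" using f by (simp add: isos_def)
  have fs: "f \<in> semi_isos k P P" by (rule subsetD[OF isos_semi f])
  have fx: "f x = x" if "x \<in> rset P m" "m \<le> plen P" for x m
  proof -
    have "map f (root_seq P m) = map (\<lambda>x. x) (root_seq P m)" using f that by (simp add: isos_def)
    then show ?thesis using that unfolding map_eq_conv rset_def by simp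
  qed
  have bag: "f ` pverts P i = pverts P i" if "1 \<le> i" "i \<le> plen P + 1" for i
    using semi_iso_bags[OF cp cp refl k fs that] .
  have inj: "inj_on f ?V" using hgraph_isoD(1)[OF h] .
  have fb: "f ` free_block P i = free_block P i" if i: "1 \<le> i" "i \<le> plen P" for i
  proof -
    have e: "free_block P i = pverts P i - (pverts P i \<inter> (rset P (i - 1) \<union> rset P i))" by (auto simp: free_block_def)
    have "inj_on f (pverts P i)" using inj bag_verts[of i P k] i inj_on_subset by auto
    then have "f ` free_block P i = f ` pverts P i - f ` (pverts P i \<inter> (rset P (i - 1) \<union> rset P i))"
      unfolding e by (intro inj_on_image_set_diff) auto
    also have "f ` (pverts P i \<inter> (rset P (i - 1) \<union> rset P i)) = (\<lambda>x. x) ` (pverts P i \<inter> (rset P (i - 1) \<union> rset P i))"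
      using fx i by (intro image_cong refl) auto
    finally show ?thesis using e bag i by simp
  qed
  define \<sigma> where "\<sigma> x = (if x \<in> ?B then f x else x)" for x
  have "free_block P i \<subseteq> ?V" if "i \<in> {1..plen P}" for i
    using bag_verts[of i P k] that by (auto simp: free_block_def)
  then have BV: "?B \<subseteq> ?V" by blast
  have "f ` ?B = ?B" using fb by (auto simp: image_UN)
  then have "bij_betw f ?B ?B" using inj BV inj_on_subset by (auto simp: bij_betw_def)
  then have "bij_betw \<sigma> ?B ?B" by (subst bij_betw_cong[where g = f]) (auto simp: \<sigma>_def)
  then have "\<sigma> permutes ?B" by (rule bij_imp_permutes) (auto simp: \<sigma>_def)
  moreover have "\<sigma> ` free_block P i = free_block P i" if "i \<in> {1..plen P}" for i
  proof -
    have "\<sigma> ` free_block P i = f ` free_block P i" using that by (intro image_cong refl) (auto simp: \<sigma>_def)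
    then show ?thesis using fb that by simp
  qed
  moreover have "restrict \<sigma> ?V = f"
  proof (rule extensionalityI[of _ ?V])
    show "f \<in> extensional ?V" using f by (simp add: isos_def)
    fix x assume x: "x \<in> ?V"
    then show "restrict \<sigma> ?V x = f x" using verts_free_or_root[OF cp x] fx by (auto simp: \<sigma>_def)
  qed simp
  ultimately have "\<sigma> \<in> free_perms P" "restrict \<sigma> ?V = f" by (simp_all add: free_perms_def)
  then show ?thesis by blast
qed

lemma free_perms_comp:
  assumes "\<sigma> \<in> free_perms P" "\<tau> \<in> free_perms P"
  shows "\<sigma> \<circ> \<tau> \<in> free_perms P"
proof -
  have "(\<sigma> \<circ> \<tau>) ` free_block P i = free_block P i" if "i \<in> {1..plen P}" for i
    unfolding image_comp[symmetric] using assms that by (simp add: free_perms_def)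
  then show ?thesis using assms by (simp add: free_perms_def permutes_compose)
qed

lemma free_perms_inv: "\<sigma> \<in> free_perms P \<Longrightarrow> inv \<sigma> \<in> free_perms P"
proof -
  assume s: "\<sigma> \<in> free_perms P"
  then have p: "\<sigma> permutes (\<Union>i\<in>{1..plen P}. free_block P i)" by (simp add: free_perms_def)
  have "inv \<sigma> ` free_block P i = free_block P i" if "i \<in> {1..plen P}" for i
  proof -
    have "inv \<sigma> ` free_block P i = inv \<sigma> ` (\<sigma> ` free_block P i)" using s that by (simp add: free_perms_def)
    then show ?thesis by (simp add: image_inv_f_f[OF permutes_inj[OF p]])
  qed
  then show ?thesis using permutes_inv[OF p] by (simp add: free_perms_def)
qed

lemma free_perms_id: "id \<in> free_perms P"
  by (simp add: free_perms_def permutes_id)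

lemma semi_copy_rel_iff:
  "(\<Phi>, \<Psi>) \<in> semi_copy_rel k G P S T \<longleftrightarrow> \<Phi> \<in> rooted_homs k G P S T \<and> \<Psi> \<in> rooted_homs k G P S T \<and>
     (\<exists>\<sigma>\<in>free_perms P. \<Psi> = \<Phi> \<circ> \<sigma>)"
  by (auto simp: semi_copy_rel_def free_perms_def)

lemma equiv_semi_copy_rel: "equiv (rooted_homs k G P S T) (semi_copy_rel k G P S T)"
proof (rule equivI)
  show "semi_copy_rel k G P S T \<subseteq> rooted_homs k G P S T \<times> rooted_homs k G P S T" by (auto simp: semi_copy_rel_iff)
  show "refl_on (rooted_homs k G P S T) (semi_copy_rel k G P S T)"
    using free_perms_id[of P] by (intro refl_onI) (auto simp: semi_copy_rel_iff intro!: bexI[of _ id])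
  show "sym (semi_copy_rel k G P S T)"
  proof (rule symI)
    fix \<Phi> \<Psi> assume "(\<Phi>, \<Psi>) \<in> semi_copy_rel k G P S T"
    then obtain \<sigma> where a: "\<Phi> \<in> rooted_homs k G P S T" "\<Psi> \<in> rooted_homs k G P S T" "\<sigma> \<in> free_perms P" "\<Psi> = \<Phi> \<circ> \<sigma>"
      by (auto simp: semi_copy_rel_iff)
    have "surj \<sigma>" using a(3) permutes_surj by (auto simp: free_perms_def)
    then have "\<Phi> = \<Psi> \<circ> inv \<sigma>" using a(4) by (simp add: fun_eq_iff surj_f_inv_f)
    then show "(\<Psi>, \<Phi>) \<in> semi_copy_rel k G P S T"
      unfolding semi_copy_rel_iff using a(1,2) free_perms_inv[OF a(3)] by blast
  qed
  show "trans (semi_copy_rel k G P S T)"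
  proof (rule transI)
    fix \<Phi> \<Psi> \<Omega> assume "(\<Phi>, \<Psi>) \<in> semi_copy_rel k G P S T" "(\<Psi>, \<Omega>) \<in> semi_copy_rel k G P S T"
    then obtain \<sigma> \<tau> where a: "\<Phi> \<in> rooted_homs k G P S T" "\<Omega> \<in> rooted_homs k G P S T"
      "\<sigma> \<in> free_perms P" "\<tau> \<in> free_perms P" "\<Omega> = \<Phi> \<circ> (\<sigma> \<circ> \<tau>)"
      by (auto simp: semi_copy_rel_iff comp_assoc)
    then show "(\<Phi>, \<Omega>) \<in> semi_copy_rel k G P S T"
      unfolding semi_copy_rel_iff using free_perms_comp[OF a(3,4)] by blast
  qed
qed

context host begin

lemma rooted_homs_sub: "rooted_homs k G P S T \<subseteq> homs k G P"
proof
  fix \<Phi> assume h: "\<Phi> \<in> rooted_homs k G P S T"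
  have "inj_on \<Phi> (rset P i)" if "i \<le> plen P" for i
  proof -
    have "sorted_wrt (<) (map \<Phi> (root_seq P i))" using h that by (auto simp: rooted_homs_def)
    then have "distinct (map \<Phi> (root_seq P i))" using strict_sorted_iff by blast
    then show ?thesis by (simp add: distinct_map rset_def)
  qed
  then show "\<Phi> \<in> homs k G P" using h by (auto simp: rooted_homs_def homs_def)
qed

lemma homs_compose:
  assumes cpQ: "clique_path r j Q" and cpP: "clique_path r j P" and pl: "plen P = plen Q" and jk: "j \<le> k"
    and f: "f \<in> semi_isos k Q P" and h: "\<Psi> \<in> homs k G P"
  defines "\<Phi> \<equiv> compose (verts (phgraph k Q)) \<Psi> f"
  shows "\<Phi> \<in> homs k G Q" "hom_weight k r j G Q \<Phi> = hom_weight k r j G P \<Psi>"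
    "\<And>i. i \<le> plen Q \<Longrightarrow> \<Phi> ` rset Q i = \<Psi> ` rset P i"
proof -
  let ?V = "verts (phgraph k Q)"
  have kr: "k \<ge> 2" "k \<le> r" "j < r" using k2 rk jk by auto
  have i: "hgraph_iso (phgraph k Q) (phgraph k P) f" using f by (simp add: semi_isos_def)
  note iD = hgraph_isoD[OF i] and hD = homsD[OF h]
  have im: "\<Phi> ` A = \<Psi> ` (f ` A)" if "A \<subseteq> ?V" for A
    unfolding image_image using that by (intro image_cong refl) (auto simp: \<Phi>_def compose_def)
  have fr: "f ` rset Q m = rset P m" if "m \<le> plen Q" for m using f that by (simp add: semi_isos_def)
  show "\<Phi> ` rset Q m = \<Psi> ` rset P m" if "m \<le> plen Q" for m
    using im[OF rset_verts[OF cpQ that]] fr[OF that] by simp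
  have "\<Phi> \<in> ?V \<rightarrow>\<^sub>E verts G"
    using hD(1) iD(2) by (auto simp: \<Phi>_def compose_def)
  moreover have "\<Phi> ` e \<in> edges G" if "e \<in> edges (phgraph k Q)" for e
    using im[OF edges_sub_verts[OF that]] iD(3)[OF that] hD(2) by simp
  moreover have "inj_on \<Phi> (rset Q m)" if m: "m \<le> plen Q" for m
  proof -
    have "inj_on f (rset Q m)" using iD(1) rset_verts[OF cpQ m] inj_on_subset by blast
    moreover have "inj_on \<Psi> (f ` rset Q m)" using hD(3) m pl fr by simp
    ultimately have "inj_on (\<Psi> \<circ> f) (rset Q m)" by (rule comp_inj_on)
    then show ?thesis using rset_verts[OF cpQ m, of k]
      by (subst inj_on_cong[of _ _ "\<Psi> \<circ> f"]) (auto simp: \<Phi>_def compose_def)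
  qed
  ultimately show "\<Phi> \<in> homs k G Q" by (auto simp: homs_def)
  show "hom_weight k r j G Q \<Phi> = hom_weight k r j G P \<Psi>"
    unfolding hom_weight_def pl
  proof (intro prod.cong refl)
    fix m assume m: "m \<in> {1..plen Q}"
    have "overlap Q m \<subseteq> ?V" using overlap_verts[of m Q k] m by simp
    then show "w_hat r j (card (overlap Q m)) / kc (\<Phi> ` overlap Q m) = w_hat r j (card (overlap P m)) / kc (\<Psi> ` overlap P m)"
      using semi_iso_overlap[OF cpQ cpP pl kr f] m im by simp
  qed
qed

lemma rooted_homs_compose_iso:
  assumes cp: "clique_path r j P" and jk: "j \<le> k" and f: "f \<in> isos k P P" and h: "\<Psi> \<in> rooted_homs k G P S T"
  shows "compose (verts (phgraph k P)) \<Psi> f \<in> rooted_homs k G P S T"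
proof -
  let ?\<Phi> = "compose (verts (phgraph k P)) \<Psi> f"
  have hh: "\<Psi> \<in> homs k G P" by (rule subsetD[OF rooted_homs_sub h])
  note c = homs_compose[OF cp cp refl jk subsetD[OF isos_semi f] hh]
  have "map ?\<Phi> (root_seq P i) = map \<Psi> (root_seq P i)" if i: "i \<le> plen P" for i
  proof -
    have "map ?\<Phi> (root_seq P i) = map \<Psi> (map f (root_seq P i))"
      using rset_verts[OF cp i, of k] by (auto simp: compose_def rset_def)
    then show ?thesis using f i by (simp add: isos_def del: map_map)
  qed
  then show ?thesis using c h homsD(1,2)[OF c(1)] by (simp add: rooted_homs_def del: map_eq_conv)
qed

text \<open>A homomorphism is injective on every bag and automorphisms preserve bags, so different automorphisms give
  different members of the class.\<close>
lemma semi_copy_class: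
  assumes cp: "clique_path r j P" and jk: "j \<le> k" and h: "\<Psi> \<in> rooted_homs k G P S T"
  shows "semi_copy_rel k G P S T `` {\<Psi>} = (\<lambda>f. compose (verts (phgraph k P)) \<Psi> f) ` isos k P P"
    and "card (semi_copy_rel k G P S T `` {\<Psi>}) = card (isos k P P)"
proof -
  let ?V = "verts (phgraph k P)"
  have kr: "k \<ge> 2" "k \<le> r" "j < r" using k2 rk jk by auto
  have hh: "\<Psi> \<in> homs k G P" by (rule subsetD[OF rooted_homs_sub h])
  note hD = homsD[OF hh]
  have comp: "\<Psi> \<circ> \<sigma> = compose ?V \<Psi> (restrict \<sigma> ?V)" if "\<sigma> \<in> free_perms P" for \<sigma>
  proof
    fix x
    show "(\<Psi> \<circ> \<sigma>) x = compose ?V \<Psi> (restrict \<sigma> ?V) x"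
    proof (cases "x \<in> ?V")
      case False
      have "x \<notin> (\<Union>i\<in>{1..plen P}. free_block P i)" using False bag_verts[of _ P k] by (force simp: free_block_def)
      then have "\<sigma> x = x" using that permutes_not_in by (fastforce simp: free_perms_def)
      then show ?thesis using False PiE_arb[OF hD(1) False] by (simp add: compose_def)
    qed (simp add: compose_def)
  qed
  show eq: "semi_copy_rel k G P S T `` {\<Psi>} = (\<lambda>f. compose ?V \<Psi> f) ` isos k P P"
  proof (intro set_eqI iffI)
    fix \<Phi> assume "\<Phi> \<in> semi_copy_rel k G P S T `` {\<Psi>}"
    then obtain \<sigma> where \<sigma>: "\<sigma> \<in> free_perms P" "\<Phi> = \<Psi> \<circ> \<sigma>" by (auto simp: semi_copy_rel_iff)
    then show "\<Phi> \<in> (\<lambda>f. compose ?V \<Psi> f) ` isos k P P"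
      using comp[OF \<sigma>(1)] free_perm_iso[OF cp \<sigma>(1), of k] by auto
  next
    fix \<Phi> assume "\<Phi> \<in> (\<lambda>f. compose ?V \<Psi> f) ` isos k P P"
    then obtain f where f: "f \<in> isos k P P" "\<Phi> = compose ?V \<Psi> f" by auto
    obtain \<sigma> where \<sigma>: "\<sigma> \<in> free_perms P" "restrict \<sigma> ?V = f" using iso_free_perm[OF cp kr f(1)] by auto
    have "\<Phi> = \<Psi> \<circ> \<sigma>" using comp[OF \<sigma>(1)] \<sigma>(2) f(2) by simp
    moreover have "\<Phi> \<in> rooted_homs k G P S T" using rooted_homs_compose_iso[OF cp jk f(1) h] f(2) by simp
    ultimately show "\<Phi> \<in> semi_copy_rel k G P S T `` {\<Psi>}" using \<sigma> h by (auto simp: semi_copy_rel_iff)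
  qed
  have "inj_on (\<lambda>f. compose ?V \<Psi> f) (isos k P P)"
  proof (rule inj_onI)
    fix f g assume f: "f \<in> isos k P P" and g: "g \<in> isos k P P" and e: "compose ?V \<Psi> f = compose ?V \<Psi> g"
    show "f = g"
    proof (rule extensionalityI[of _ ?V])
      show "f \<in> extensional ?V" "g \<in> extensional ?V" using f g by (auto simp: isos_def)
      fix x assume x: "x \<in> ?V"
      then obtain i where i: "1 \<le> i" "i \<le> plen P + 1" "x \<in> pverts P i" by (auto simp: phgraph_def)
      have b: "f x \<in> pverts P i" "g x \<in> pverts P i"
        using semi_iso_bags[OF cp cp refl kr _ i(1,2)] subsetD[OF isos_semi f] subsetD[OF isos_semi g] i(3) by blast+
      have "inj_on \<Psi> (pverts P i)"
      proof (cases "i \<le> plen P")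
        case True then show ?thesis using hom_bag(1)[OF cp hh i(1)] by simp
      next
        case False
        then have "i = Suc (plen P)" using i by simp
        then show ?thesis using hD(3)[of "plen P"] pverts_last[of P] by simp
      qed
      moreover have "\<Psi> (f x) = \<Psi> (g x)" using fun_cong[OF e, of x] x by (simp add: compose_def)
      ultimately show "f x = g x" using b by (auto dest: inj_onD)
    qed
  qed
  then show "card (semi_copy_rel k G P S T `` {\<Psi>}) = card (isos k P P)"
    unfolding eq by (rule card_image)
qed

text \<open>All classes have the same size, namely the number of automorphisms, and the weight is constant on each
  class.\<close>
lemma sum_rooted_homs:
  assumes cp: "clique_path r j P" and jk: "j \<le> k"
  shows "(\<Sum>\<Psi>\<in>rooted_homs k G P S T. hom_weight k r j G P \<Psi>) = real (card (isos k P P)) * Xi_path k r j G P S T"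
proof -
  let ?R = "semi_copy_rel k G P S T" and ?A = "rooted_homs k G P S T" and ?w = "hom_weight k r j G P"
  note eq = equiv_semi_copy_rel[of k G P S T]
  have finA: "finite ?A" by (rule finite_subset[OF rooted_homs_sub finite_homs[OF cp]])
  have fin: "finite (?A // ?R)" using finA by (simp add: quotient_def)
  have "(\<Sum>\<Psi>\<in>?A. ?w \<Psi>) = (\<Sum>X\<in>?A // ?R. \<Sum>\<Psi>\<in>{\<Psi>\<in>?A. ?R `` {\<Psi>} = X}. ?w \<Psi>)"
    by (rule sum.group[symmetric]) (use finA fin quotientI in auto)
  also have "\<dots> = (\<Sum>X\<in>?A // ?R. real (card (isos k P P)) * ?w (SOME \<Phi>. \<Phi> \<in> X))"
  proof (intro sum.cong refl)
    fix X assume X: "X \<in> ?A // ?R"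
    then obtain \<Psi>0 where \<Psi>0: "\<Psi>0 \<in> ?A" "X = ?R `` {\<Psi>0}" by (auto elim: quotientE)
    have XA: "{\<Psi>\<in>?A. ?R `` {\<Psi>} = X} = X"
    proof (intro set_eqI iffI)
      fix \<Psi> assume "\<Psi> \<in> {\<Psi>\<in>?A. ?R `` {\<Psi>} = X}"
      then show "\<Psi> \<in> X" using equiv_class_self[OF eq] by auto
    next
      fix \<Psi> assume p: "\<Psi> \<in> X"
      then have "(\<Psi>0, \<Psi>) \<in> ?R" using \<Psi>0 by auto
      then show "\<Psi> \<in> {\<Psi>\<in>?A. ?R `` {\<Psi>} = X}" using equiv_class_eq[OF eq] \<Psi>0 by (auto simp: semi_copy_rel_iff)
    qed
    have w: "?w \<Psi> = ?w \<Psi>0" if p: "\<Psi> \<in> X" for \<Psi>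
    proof -
      obtain f where f: "f \<in> isos k P P" "\<Psi> = compose (verts (phgraph k P)) \<Psi>0 f"
        using p semi_copy_class(1)[OF cp jk \<Psi>0(1)] \<Psi>0(2) by auto
      show ?thesis
        using homs_compose(2)[OF cp cp refl jk subsetD[OF isos_semi f(1)] subsetD[OF rooted_homs_sub \<Psi>0(1)]] f(2) by simp
    qed
    have "(SOME \<Phi>. \<Phi> \<in> X) \<in> X" using \<Psi>0 equiv_class_self[OF eq \<Psi>0(1)] by (metis someI)
    then have "(\<Sum>\<Psi>\<in>X. ?w \<Psi>) = real (card X) * ?w (SOME \<Phi>. \<Phi> \<in> X)" using w by simp
    then show "(\<Sum>\<Psi>\<in>{\<Psi>\<in>?A. ?R `` {\<Psi>} = X}. ?w \<Psi>) = real (card (isos k P P)) * ?w (SOME \<Phi>. \<Phi> \<in> X)"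
      unfolding XA using semi_copy_class(2)[OF cp jk \<Psi>0(1)] \<Psi>0(2) by simp
  qed
  finally show ?thesis by (simp add: Xi_path_def semi_copies_def sum_distrib_left)
qed

end

section \<open>Labelled homomorphisms and semi-ordered clique-paths\<close>

lemma iso_rel_iff:
  "(P, Q) \<in> iso_rel k r j \<longleftrightarrow> clique_path r j P \<and> clique_path r j Q \<and> plen P = plen Q \<and> isos k P Q \<noteq> {}"
proof
  assume a: "(P, Q) \<in> iso_rel k r j"
  then obtain f where f: "hgraph_iso (phgraph k P) (phgraph k Q) f" "\<forall>i\<le>plen P. map f (root_seq P i) = root_seq Q i"
    and cp: "clique_path r j P" by (auto simp: iso_rel_def)
  have "restrict f (verts (phgraph k P)) \<in> isos k P Q"
  proof -
    have "hgraph_iso (phgraph k P) (phgraph k Q) (restrict f (verts (phgraph k P)))"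
      using f(1) by (subst hgraph_iso_cong[where g = f]) (auto dest: edges_sub_verts)
    moreover have "map (restrict f (verts (phgraph k P))) (root_seq P i) = root_seq Q i" if i: "i \<le> plen P" for i
    proof -
      have "map (restrict f (verts (phgraph k P))) (root_seq P i) = map f (root_seq P i)"
        using rset_verts[OF cp i, of k] by (auto simp: rset_def)
      then show ?thesis using f(2) i by (simp del: map_eq_conv)
    qed
    ultimately show ?thesis by (simp add: isos_def del: map_eq_conv)
  qed
  then show "clique_path r j P \<and> clique_path r j Q \<and> plen P = plen Q \<and> isos k P Q \<noteq> {}"
    using a by (auto simp: iso_rel_def)
next
  assume "clique_path r j P \<and> clique_path r j Q \<and> plen P = plen Q \<and> isos k P Q \<noteq> {}"
  then show "(P, Q) \<in> iso_rel k r j" by (auto simp: iso_rel_def isos_def)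
qed

lemma semi_iso_relD:
  assumes a: "(P, Q) \<in> semi_iso_rel k r j"
  shows "clique_path r j P" "clique_path r j Q" "plen Q = plen P" "semi_isos k P Q \<noteq> {}"
proof -
  show cp: "clique_path r j P" "clique_path r j Q" "plen Q = plen P" using a by (auto simp: semi_iso_rel_def)
  obtain f where f: "hgraph_iso (phgraph k P) (phgraph k Q) f" "map f (root_seq P 0) = root_seq Q 0"
     "\<forall>i\<le>plen P. f ` rset P i = rset Q i"
    using a by (auto simp: semi_iso_rel_def)
  have "hgraph_iso (phgraph k P) (phgraph k Q) (restrict f (verts (phgraph k P)))"
    using f(1) by (subst hgraph_iso_cong[where g = f]) (auto dest: edges_sub_verts)
  moreover have "map (restrict f (verts (phgraph k P))) (root_seq P 0) = root_seq Q 0"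
  proof -
    have "map (restrict f (verts (phgraph k P))) (root_seq P 0) = map f (root_seq P 0)"
      using rset_verts[OF cp(1), of 0 k] by (auto simp: rset_def)
    then show ?thesis using f(2) by (simp del: map_eq_conv)
  qed
  moreover have "restrict f (verts (phgraph k P)) ` rset P i = rset Q i" if i: "i \<le> plen P" for i
  proof -
    have "restrict f (verts (phgraph k P)) ` rset P i = f ` rset P i"
      using rset_verts[OF cp(1) i, of k] by (intro image_cong refl) auto
    then show ?thesis using f(3) i by simp
  qed
  ultimately have "restrict f (verts (phgraph k P)) \<in> semi_isos k P Q" by (simp add: semi_isos_def del: map_eq_conv)
  then show "semi_isos k P Q \<noteq> {}" by blast
qed

lemma id_isos:
  assumes cp: "clique_path r j P" shows "restrict (\<lambda>x. x) (verts (phgraph k P)) \<in> isos k P P"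
proof -
  have "hgraph_iso (phgraph k P) (phgraph k P) (\<lambda>x. x)" by (auto simp: hgraph_iso_def bij_betw_def)
  then have "hgraph_iso (phgraph k P) (phgraph k P) (restrict (\<lambda>x. x) (verts (phgraph k P)))"
    by (subst hgraph_iso_cong[where g = "\<lambda>x. x"]) (auto dest: edges_sub_verts)
  moreover have "map (restrict (\<lambda>x. x) (verts (phgraph k P))) (root_seq P i) = root_seq P i" if "i \<le> plen P" for i
    using rset_verts[OF cp that, of k] by (auto simp: map_idI rset_def subset_iff)
  ultimately show ?thesis by (simp add: isos_def)
qed

lemma equiv_iso_rel: "equiv {P. clique_path r j P} (iso_rel k r j)"
proof (rule equivI)
  show "iso_rel k r j \<subseteq> {P. clique_path r j P} \<times> {P. clique_path r j P}" by (auto simp: iso_rel_def)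
  show "refl_on {P. clique_path r j P} (iso_rel k r j)"
  proof (rule refl_onI)
    fix P assume "P \<in> {P. clique_path r j P}"
    then show "(P, P) \<in> iso_rel k r j" unfolding iso_rel_iff using id_isos by blast
  qed
  show "sym (iso_rel k r j)"
  proof (rule symI)
    fix P Q assume "(P, Q) \<in> iso_rel k r j"
    then show "(Q, P) \<in> iso_rel k r j" unfolding iso_rel_iff using path_isos_inv by (metis ex_in_conv)
  qed
  show "trans (iso_rel k r j)"
  proof (rule transI)
    fix P Q R assume "(P, Q) \<in> iso_rel k r j" "(Q, R) \<in> iso_rel k r j"
    then show "(P, R) \<in> iso_rel k r j" unfolding iso_rel_iff using path_isos_comp by (metis ex_in_conv)
  qed
qed

text \<open>Pulling the root orders of \<open>P\<close> back along a semi-isomorphism from \<open>Q\<close> gives a list of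
  orders on the vertices of \<open>Q\<close>, which determines \<open>P\<close> up to isomorphism; there are finitely many
  such lists.\<close>
lemma finite_semi_ordered:
  assumes cp: "clique_path r j Q"
  shows "finite (semi_ordered k r j Q)"
proof -
  let ?V = "verts (phgraph k Q)" and ?A = "semi_iso_rel k r j `` {Q}"
  define D where "D = {xss. set xss \<subseteq> {xs. set xs \<subseteq> ?V \<and> length xs = j} \<and> length xss = plen Q + 1}"
  have finD: "finite D"
    unfolding D_def by (intro finite_lists_length_eq finite_verts[OF cp])
  define fi where "fi P = (SOME f. f \<in> semi_isos k Q P)" for P
  have fi: "fi P \<in> semi_isos k Q P" if "P \<in> ?A" for P
    unfolding fi_def some_in_eq using semi_iso_relD(4)[of Q P k r j] that by auto
  \<comment> \<open>The root orders of \<open>P\<close>, pulled back to the vertices of \<open>Q\<close>.\<close>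
  define code where "code P = map (\<lambda>i. map (pinv k Q P (fi P)) (root_seq P i)) [0..<plen Q + 1]" for P
  have codeD: "code P \<in> D" if P: "P \<in> ?A" for P
  proof -
    have cpP: "clique_path r j P" and pl: "plen P = plen Q" using semi_iso_relD(2,3)[of Q P k r j] P by auto
    have h: "hgraph_iso (phgraph k P) (phgraph k Q) (pinv k Q P (fi P))"
      using path_isos_inv[OF fi[OF P] pl cp] by (simp add: semi_isos_def)
    have A: "set (map (pinv k Q P (fi P)) (root_seq P i)) \<subseteq> ?V" "length (root_seq P i) = j" if "i \<le> plen Q" for i
      using hgraph_isoD(2)[OF h] rset_verts[OF cpP, of i k] that pl clique_pathD(3)[OF cpP, of i] by (auto simp: rset_def)
    have "xs \<in> {xs. set xs \<subseteq> ?V \<and> length xs = j}" if xs: "xs \<in> set (code P)" for xs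
    proof -
      obtain i where "i \<in> set [0..<plen Q + 1]" "xs = map (pinv k Q P (fi P)) (root_seq P i)"
        using xs unfolding code_def set_map by blast
      then show ?thesis using A[of i] by (auto simp del: set_map)
    qed
    moreover have "length (code P) = plen Q + 1" by (simp add: code_def)
    ultimately show ?thesis unfolding D_def by blast
  qed
  have rel: "iso_rel k r j `` {P} = iso_rel k r j `` {P'}" if P: "P \<in> ?A" "P' \<in> ?A" and c: "code P = code P'" for P P'
  proof -
    have cpP: "clique_path r j P" and pl: "plen P = plen Q" using semi_iso_relD(2,3)[of Q P k r j] P by auto
    have cpP': "clique_path r j P'" and pl': "plen P' = plen Q" using semi_iso_relD(2,3)[of Q P' k r j] P by auto
    let ?g = "pinv k Q P (fi P)" and ?f' = "fi P'"
    have h: "hgraph_iso (phgraph k P) (phgraph k Q) ?g"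
      using path_isos_inv[OF fi[OF P(1)] pl cp] by (simp add: semi_isos_def)
    have h': "hgraph_iso (phgraph k Q) (phgraph k P') ?f'"
      using fi[OF P(2)] by (simp add: semi_isos_def)
    have "map (?f' \<circ> ?g) (root_seq P i) = root_seq P' i" if i: "i \<le> plen P" for i
    proof -
      have "code P ! i = map ?g (root_seq P i)" "code P' ! i = map (pinv k Q P' ?f') (root_seq P' i)"
        using i pl unfolding code_def by (simp_all del: upt_Suc)
      then have "map ?g (root_seq P i) = map (pinv k Q P' ?f') (root_seq P' i)" using c by simp
      then have "map (?f' \<circ> ?g) (root_seq P i) = map (?f' \<circ> pinv k Q P' ?f') (root_seq P' i)"
        by (simp flip: map_map)
      also have "\<dots> = root_seq P' i"
        using hgraph_iso_pinv(3)[OF h'] rset_verts[OF cpP', of i k] i pl pl' by (auto simp: map_idI rset_def subset_iff)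
      finally show ?thesis .
    qed
    then have "(P, P') \<in> iso_rel k r j"
      unfolding iso_rel_def using hgraph_iso_comp[OF h h'] cpP cpP' pl pl' by auto
    then show ?thesis using equiv_class_eq[OF equiv_iso_rel] by blast
  qed
  have "finite ((\<lambda>P. iso_rel k r j `` {P}) ` ?A)"
  proof -
    have "(\<lambda>P. iso_rel k r j `` {P}) ` ?A \<subseteq> (\<lambda>d. iso_rel k r j `` {SOME P. P \<in> ?A \<and> code P = d}) ` D"
    proof
      fix X assume "X \<in> (\<lambda>P. iso_rel k r j `` {P}) ` ?A"
      then obtain P where P: "P \<in> ?A" "X = iso_rel k r j `` {P}" by auto
      let ?P' = "SOME P'. P' \<in> ?A \<and> code P' = code P"
      have "?P' \<in> ?A \<and> code ?P' = code P" by (rule someI[of _ P]) (use P in auto)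
      then have "X = iso_rel k r j `` {?P'}" using rel[of ?P' P] P by auto
      then show "X \<in> (\<lambda>d. iso_rel k r j `` {SOME P. P \<in> ?A \<and> code P = d}) ` D" using codeD[OF P(1)] by blast
    qed
    then show ?thesis using finD by (meson finite_imageI finite_subset)
  qed
  moreover have "semi_ordered k r j Q = (\<lambda>P. iso_rel k r j `` {P}) ` ?A"
    by (auto simp: semi_ordered_def quotient_def)
  ultimately show ?thesis by simp
qed

lemma phgraph_reorder: "clique_path r j Q \<Longrightarrow> phgraph k (reorder \<kappa> Q) = phgraph k Q"
  using pverts_reorder[OF clique_pathD(1)] by (simp add: phgraph_def)

lemma strict_sorted_eqI:
  fixes xs ys :: "nat list"
  shows "sorted_wrt (<) xs \<Longrightarrow> sorted_wrt (<) ys \<Longrightarrow> set xs = set ys \<Longrightarrow> xs = ys"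
  by (meson strict_sorted_equal)

lemma map_sort_key_strict:
  fixes \<kappa> :: "nat \<Rightarrow> nat"
  assumes "distinct xs" "inj_on \<kappa> (set xs)"
  shows "sorted_wrt (<) (map \<kappa> (sort_key \<kappa> xs))"
  unfolding strict_sorted_iff using assms by (simp add: distinct_map)

context host begin

text \<open>Order-preserving on the first root set only: these are the maps that unrolling produces.\<close>
definition labelled_homs :: "cpath \<Rightarrow> nat set \<Rightarrow> nat set \<Rightarrow> (nat \<Rightarrow> nat) set" where
  "labelled_homs Q S T = {\<Phi> \<in> homs k G Q. map \<Phi> (root_seq Q 0) = sorted_list_of_set S \<and> \<Phi> ` rset Q (plen Q) = T}"

lemma semi_iso_reorder:
  assumes cp: "clique_path r j Q" and so: "sorted (map \<Phi> (root_seq Q 0))"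
  shows "(Q, reorder \<Phi> Q) \<in> semi_iso_rel k r j" "root_seq (reorder \<Phi> Q) 0 = root_seq Q 0"
proof -
  note len = clique_pathD(1)[OF cp]
  show r0: "root_seq (reorder \<Phi> Q) 0 = root_seq Q 0"
    using root_reorder[of 0 Q \<Phi>] len sort_key_id_if_sorted[OF so] by simp
  have "hgraph_iso (phgraph k Q) (phgraph k (reorder \<Phi> Q)) (\<lambda>x. x)"
    using phgraph_reorder[OF cp] by (auto simp: hgraph_iso_def bij_betw_def)
  moreover have "(\<lambda>x. x) ` rset Q i = rset (reorder \<Phi> Q) i" if "i \<le> plen Q" for i using rset_reorder[of i Q \<Phi>] len that by simp
  ultimately show "(Q, reorder \<Phi> Q) \<in> semi_iso_rel k r j"
    using cp clique_path_reorder[OF cp] r0 unfolding semi_iso_rel_def by (auto intro!: exI[of _ "\<lambda>x. x"])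
qed

text \<open>Two strictly sorted lists with the same elements are equal; so sorting the roots of \<open>Q\<close> by the
  composed map gives the order that \<open>f\<close> transports to that of \<open>P\<close>.\<close>
lemma compose_rooted_homs:
  assumes cpQ: "clique_path r j Q" and cpP: "clique_path r j P" and pl: "plen P = plen Q" and jk: "j \<le> k"
    and S: "finite S" and f: "f \<in> semi_isos k Q P" and h: "\<Psi> \<in> rooted_homs k G P S T"
  defines "\<Phi> \<equiv> compose (verts (phgraph k Q)) \<Psi> f"
  shows "\<Phi> \<in> labelled_homs Q S T" "f \<in> isos k (reorder \<Phi> Q) P"
proof -
  note len = clique_pathD(1)[OF cpQ]
  have hh: "\<Psi> \<in> homs k G P" by (rule subsetD[OF rooted_homs_sub h])
  note c = homs_compose[OF cpQ cpP pl jk f hh, folded \<Phi>_def]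
  have sP: "sorted_wrt (<) (map \<Psi> (root_seq P i))" if "i \<le> plen P" for i using h that by (auto simp: rooted_homs_def)
  have mp: "map \<Phi> xs = map \<Psi> (map f xs)" if "set xs \<subseteq> verts (phgraph k Q)" for xs
    using that by (auto simp: \<Phi>_def compose_def subset_iff)
  have rv: "set (root_seq Q i) \<subseteq> verts (phgraph k Q)" if "i \<le> plen Q" for i
    using rset_verts[OF cpQ that, of k] by (simp add: rset_def)
  have f0: "map f (root_seq Q 0) = root_seq P 0" and fr: "\<And>i. i \<le> plen Q \<Longrightarrow> f ` rset Q i = rset P i"
    using f by (auto simp: semi_isos_def)
  have "map \<Phi> (root_seq Q 0) = map \<Psi> (root_seq P 0)" unfolding mp[OF rv[of 0, simplified]] f0 ..
  also have "\<dots> = sorted_list_of_set S"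
  proof (rule strict_sorted_eqI)
    have "\<Psi> ` rset P 0 = S" using h by (simp add: rooted_homs_def)
    then show "set (map \<Psi> (root_seq P 0)) = set (sorted_list_of_set S)" using S by (simp add: rset_def)
  qed (use sP in auto)
  finally show "\<Phi> \<in> labelled_homs Q S T"
    using c(1) c(3)[of "plen Q"] h pl by (simp add: labelled_homs_def rooted_homs_def)
  have "map f (root_seq (reorder \<Phi> Q) i) = root_seq P i" if i: "i \<le> plen Q" for i
  proof -
    let ?xs = "root_seq (reorder \<Phi> Q) i"
    have xs: "?xs = sort_key \<Phi> (root_seq Q i)" using root_reorder[of i Q \<Phi>] len i by simp
    have "map \<Psi> (map f ?xs) = map \<Phi> ?xs" using mp[of ?xs] rv[OF i] xs by simp
    also have "\<dots> = map \<Psi> (root_seq P i)"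
    proof (rule strict_sorted_eqI)
      show "sorted_wrt (<) (map \<Phi> ?xs)"
        unfolding xs using clique_pathD(3)[OF cpQ i] homsD(3)[OF c(1) i] by (intro map_sort_key_strict) (auto simp: rset_def)
      show "sorted_wrt (<) (map \<Psi> (root_seq P i))" using sP i pl by simp
      show "set (map \<Phi> ?xs) = set (map \<Psi> (root_seq P i))" using c(3)[OF i] xs by (simp add: rset_def)
    qed
    finally have e: "map \<Psi> (map f ?xs) = map \<Psi> (root_seq P i)" .
    have "set (map f ?xs) = rset P i" using fr[OF i] xs by (simp add: rset_def)
    then have "inj_on \<Psi> (set (map f ?xs) \<union> set (root_seq P i))" using homsD(3)[OF hh, of i] i pl by (simp add: rset_def)
    then show ?thesis using e by (rule map_inj_on[rotated])
  qed
  then show "f \<in> isos k (reorder \<Phi> Q) P"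
    using f by (simp add: isos_def semi_isos_def phgraph_reorder[OF cpQ])
qed

lemma labelled_homs_decompose:
  assumes cpQ: "clique_path r j Q" and cpP: "clique_path r j P" and pl: "plen P = plen Q" and jk: "j \<le> k"
    and S: "finite S" and h: "\<Phi> \<in> labelled_homs Q S T" and f: "f \<in> isos k (reorder \<Phi> Q) P"
  defines "\<Psi> \<equiv> compose (verts (phgraph k P)) \<Phi> (pinv k Q P f)"
  shows "f \<in> semi_isos k Q P" "\<Psi> \<in> rooted_homs k G P S T" "compose (verts (phgraph k Q)) \<Psi> f = \<Phi>"
proof -
  note len = clique_pathD(1)[OF cpQ]
  have hh: "\<Phi> \<in> homs k G Q" and h0: "map \<Phi> (root_seq Q 0) = sorted_list_of_set S" and hT: "\<Phi> ` rset Q (plen Q) = T"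
    using h by (auto simp: labelled_homs_def)
  have r0: "root_seq (reorder \<Phi> Q) 0 = root_seq Q 0" using semi_iso_reorder(2)[OF cpQ, of \<Phi>] h0 by simp
  have fi: "map f (root_seq (reorder \<Phi> Q) i) = root_seq P i" if "i \<le> plen Q" for i
    using f that by (simp add: isos_def)
  show fs: "f \<in> semi_isos k Q P"
  proof -
    have "f \<in> semi_isos k (reorder \<Phi> Q) P" by (rule subsetD[OF isos_semi f])
    then show ?thesis using rset_reorder[of _ Q \<Phi>] len by (simp add: semi_isos_def phgraph_reorder[OF cpQ] r0)
  qed
  then have hi: "hgraph_iso (phgraph k Q) (phgraph k P) f" by (simp add: semi_isos_def)
  note c = homs_compose[OF cpP cpQ pl[symmetric] jk path_isos_inv[OF fs pl cpQ] hh, folded \<Psi>_def]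
  have pf: "\<Psi> (f x) = \<Phi> x" if "x \<in> verts (phgraph k Q)" for x
    using hgraph_iso_pinv(2)[OF hi that] hgraph_isoD(2)[OF hi] that by (auto simp: \<Psi>_def compose_def)
  have "sorted_wrt (<) (map \<Psi> (root_seq P i))" if i: "i \<le> plen P" for i
  proof -
    have i': "i \<le> plen Q" using i pl by simp
    have xs: "root_seq (reorder \<Phi> Q) i = sort_key \<Phi> (root_seq Q i)" using root_reorder[of i Q \<Phi>] len i' by simp
    have "map \<Psi> (root_seq P i) = map (\<lambda>x. \<Psi> (f x)) (root_seq (reorder \<Phi> Q) i)"
      unfolding fi[OF i', symmetric] by simp
    also have "\<dots> = map \<Phi> (root_seq (reorder \<Phi> Q) i)"
      using pf rset_verts[OF cpQ i', of k] xs by (auto simp: rset_def)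
    finally show ?thesis
      unfolding xs using clique_pathD(3)[OF cpQ i'] homsD(3)[OF hh i'] map_sort_key_strict[of "root_seq Q i" \<Phi>] by (simp add: rset_def)
  qed
  moreover have "\<Psi> ` rset P 0 = S"
  proof -
    have "\<Phi> ` rset Q 0 = set (map \<Phi> (root_seq Q 0))" by (simp add: rset_def)
    then show ?thesis using c(3)[of 0] h0 S by simp
  qed
  ultimately show "\<Psi> \<in> rooted_homs k G P S T"
    using c(3)[of "plen P"] hT pl homsD(1,2)[OF c(1)] by (simp add: rooted_homs_def)
  show "compose (verts (phgraph k Q)) \<Psi> f = \<Phi>"
  proof (rule extensionalityI[of _ "verts (phgraph k Q)"])
    show "\<Phi> \<in> extensional (verts (phgraph k Q))" using homsD(1)[OF hh] by (simp add: PiE_def)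
  qed (use pf in \<open>auto simp: compose_def\<close>)
qed

text \<open>Orbit counting. A labelled homomorphism \<open>\<Phi>\<close> orders all root sets of \<open>Q\<close>, and so
  belongs to exactly one isomorphism class in the semi-ordered path. For a representative \<open>P\<close> of the class, the
  pairs of a rooted homomorphism of \<open>P\<close> and a semi-isomorphism from \<open>Q\<close> to \<open>P\<close> that
  compose to \<open>\<Phi>\<close> are in bijection with the isomorphisms from the reordered \<open>Q\<close> to
  \<open>P\<close>. Their number is also the number of maps in a semi-copy, so it cancels and only the number of
  semi-automorphisms of \<open>Q\<close> remains, the same for all classes.\<close>
lemma sum_labelled_homs:
  assumes cp: "clique_path r j Q" and jk: "j \<le> k" and S: "finite S"
  shows "(\<Sum>\<Phi>\<in>labelled_homs Q S T. hom_weight k r j G Q \<Phi>)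
    = real (card (semi_isos k Q Q)) * Xi_semi k r j G (semi_ordered k r j Q) S T"
proof -
  let ?I = "iso_rel k r j" and ?U = "labelled_homs Q S T" and ?w = "hom_weight k r j G"
  define cls where "cls \<Phi> = ?I `` {reorder \<Phi> Q}" for \<Phi>
  note eq = equiv_iso_rel[of r j k]
  have finU: "finite ?U" using finite_homs[OF cp] by (simp add: labelled_homs_def)
  have so: "sorted (map \<Phi> (root_seq Q 0))" if "\<Phi> \<in> ?U" for \<Phi> using that by (simp add: labelled_homs_def)
  have clsin: "cls \<Phi> \<in> semi_ordered k r j Q" if "\<Phi> \<in> ?U" for \<Phi>
    unfolding semi_ordered_def cls_def using semi_iso_reorder(1)[OF cp so[OF that]] by (intro quotientI) auto
  have "(\<Sum>\<Phi>\<in>?U. ?w Q \<Phi>) = (\<Sum>X\<in>semi_ordered k r j Q. \<Sum>\<Phi>\<in>{\<Phi>\<in>?U. cls \<Phi> = X}. ?w Q \<Phi>)"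
    by (rule sum.group[symmetric, OF finU finite_semi_ordered[OF cp]]) (use clsin in auto)
  also have "\<dots> = (\<Sum>X\<in>semi_ordered k r j Q. real (card (semi_isos k Q Q)) * Xi_path k r j G (SOME P. P \<in> X) S T)"
  proof (intro sum.cong refl)
    fix X assume X: "X \<in> semi_ordered k r j Q"
    define P where "P = (SOME P. P \<in> X)"
    obtain P0 where P0: "(Q, P0) \<in> semi_iso_rel k r j" "X = ?I `` {P0}" using X by (auto simp: semi_ordered_def elim: quotientE)
    note P0D = semi_iso_relD[OF P0(1)]
    have "P0 \<in> X" using P0 equiv_class_self[OF eq] P0D(2) by simp
    then have PX: "P \<in> X" unfolding P_def by (rule someI)
    then have PP: "(P0, P) \<in> ?I" using P0 by simp
    then have cpP: "clique_path r j P" and plP: "plen P = plen Q" and is0: "isos k P0 P \<noteq> {}"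
      unfolding iso_rel_iff using P0D by auto
    have XP: "X = ?I `` {P}" using equiv_class_eq[OF eq PP] P0 by simp
    have SIne: "semi_isos k Q P \<noteq> {}"
      using path_isos_comp[OF _ _ P0D(3) cp] P0D(4) is0 isos_semi by blast
    let ?R = "rooted_homs k G P S T" and ?SI = "semi_isos k Q P"
    let ?c = "\<lambda>(\<Psi>, f). compose (verts (phgraph k Q)) \<Psi> f"
    let ?UX = "{\<Phi>\<in>?U. cls \<Phi> = X}"
    have clsX: "cls \<Phi> = X \<longleftrightarrow> isos k (reorder \<Phi> Q) P \<noteq> {}" for \<Phi>
    proof -
      have "cls \<Phi> = X \<longleftrightarrow> (reorder \<Phi> Q, P) \<in> ?I"
        unfolding cls_def XP using eq_equiv_class_iff[OF eq] clique_path_reorder[OF cp] cpP by simp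
      then show ?thesis unfolding iso_rel_iff using clique_path_reorder[OF cp] cpP plP by simp
    qed
    have finR: "finite ?R" by (rule finite_subset[OF rooted_homs_sub finite_homs[OF cpP]])
    have finSI: "finite ?SI" by (rule finite_semi_isos[OF cp cpP])
    have img: "?c ` (?R \<times> ?SI) \<subseteq> ?UX"
    proof clarify
      fix \<Psi> f assume a: "\<Psi> \<in> ?R" "f \<in> ?SI"
      show "compose (verts (phgraph k Q)) \<Psi> f \<in> ?U \<and> cls (compose (verts (phgraph k Q)) \<Psi> f) = X"
        using compose_rooted_homs[OF cp cpP plP jk S a(2,1)] clsX by auto
    qed
    \<comment> \<open>The pair is determined by its semi-isomorphism, which ranges over the isomorphisms from the reordered path.\<close>
    have fibre: "(\<Sum>d\<in>{d \<in> ?R \<times> ?SI. ?c d = \<Phi>}. ?w P (fst d)) = real (card (isos k P P)) * ?w Q \<Phi>" if \<Phi>: "\<Phi> \<in> ?UX" for \<Phi>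
    proof -
      let ?D = "{d \<in> ?R \<times> ?SI. ?c d = \<Phi>}"
      have U: "\<Phi> \<in> ?U" and ne: "isos k (reorder \<Phi> Q) P \<noteq> {}" using \<Phi> clsX by auto
      have "?w P (fst d) = ?w Q \<Phi>" if "d \<in> ?D" for d
      proof -
        obtain \<Psi> f where d: "d = (\<Psi>, f)" "\<Psi> \<in> ?R" "f \<in> ?SI" "compose (verts (phgraph k Q)) \<Psi> f = \<Phi>" using \<open>d \<in> ?D\<close> by auto
        show ?thesis using homs_compose(2)[OF cp cpP plP jk d(3) subsetD[OF rooted_homs_sub d(2)]] d by simp
      qed
      then have "(\<Sum>d\<in>?D. ?w P (fst d)) = real (card ?D) * ?w Q \<Phi>" by simp
      moreover have "card ?D = card (isos k (reorder \<Phi> Q) P)"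
      proof (rule bij_betw_same_card[of snd], unfold bij_betw_def, intro conjI)
        show "inj_on snd ?D"
        proof (rule inj_onI)
          fix d d' assume dd: "d \<in> ?D" "d' \<in> ?D" "snd d = snd d'"
          obtain \<Psi> f where d: "d = (\<Psi>, f)" "\<Psi> \<in> ?R" "f \<in> ?SI" "compose (verts (phgraph k Q)) \<Psi> f = \<Phi>" using dd(1) by auto
          obtain \<Psi>' where d': "d' = (\<Psi>', f)" "\<Psi>' \<in> ?R" "compose (verts (phgraph k Q)) \<Psi>' f = \<Phi>" using dd d by auto
          have fi: "f ` verts (phgraph k Q) = verts (phgraph k P)" using d(3) hgraph_isoD(2) by (auto simp: semi_isos_def)
          have "\<Psi> = \<Psi>'"
          proof (rule extensionalityI[of _ "verts (phgraph k P)"])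
            show "\<Psi> \<in> extensional (verts (phgraph k P))" "\<Psi>' \<in> extensional (verts (phgraph k P))"
              using d(2) d'(2) by (auto simp: rooted_homs_def PiE_def)
            fix y assume "y \<in> verts (phgraph k P)"
            then obtain x where x: "x \<in> verts (phgraph k Q)" "y = f x" using fi by auto
            show "\<Psi> y = \<Psi>' y" using fun_cong[OF d(4), of x] fun_cong[OF d'(3), of x] x by (simp add: compose_def)
          qed
          then show "d = d'" using d d' by simp
        qed
        show "snd ` ?D = isos k (reorder \<Phi> Q) P"
        proof (intro equalityI subsetI)
          fix f assume "f \<in> snd ` ?D"
          then obtain \<Psi> where d: "\<Psi> \<in> ?R" "f \<in> ?SI" "compose (verts (phgraph k Q)) \<Psi> f = \<Phi>" by auto
          show "f \<in> isos k (reorder \<Phi> Q) P"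
            using compose_rooted_homs(2)[OF cp cpP plP jk S d(2,1)] d(3) by simp
        next
          fix f assume f: "f \<in> isos k (reorder \<Phi> Q) P"
          note dc = labelled_homs_decompose[OF cp cpP plP jk S U f]
          show "f \<in> snd ` ?D"
            by (rule image_eqI[of _ _ "(compose (verts (phgraph k P)) \<Phi> (pinv k Q P f), f)"]) (use dc in auto)
        qed
      qed
      moreover have "card (isos k (reorder \<Phi> Q) P) = card (isos k P P)"
      proof -
        obtain f where "f \<in> isos k (reorder \<Phi> Q) P" using ne by blast
        then show ?thesis using card_isos[OF clique_path_reorder[OF cp] cpP] plP by simp
      qed
      ultimately show ?thesis by simp
    qed
    have "real (card (isos k P P)) * (\<Sum>\<Phi>\<in>?UX. ?w Q \<Phi>) = (\<Sum>\<Phi>\<in>?UX. \<Sum>d\<in>{d \<in> ?R \<times> ?SI. ?c d = \<Phi>}. ?w P (fst d))"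
      unfolding sum_distrib_left using fibre by (intro sum.cong) auto
    also have "\<dots> = (\<Sum>d\<in>?R \<times> ?SI. ?w P (fst d))"
      by (rule sum.group) (use finR finSI finU img in auto)
    also have "\<dots> = (\<Sum>\<Psi>\<in>?R. \<Sum>f\<in>?SI. ?w P \<Psi>)"
      unfolding sum.cartesian_product by (simp add: case_prod_beta)
    also have "\<dots> = real (card ?SI) * (\<Sum>\<Psi>\<in>?R. ?w P \<Psi>)" by (simp add: sum_distrib_left)
    also have "\<dots> = real (card ?SI) * (real (card (isos k P P)) * Xi_path k r j G P S T)"
      by (simp add: sum_rooted_homs[OF cpP jk])
    also have "card ?SI = card (semi_isos k Q Q)"
    proof -
      obtain f where "f \<in> ?SI" using SIne by blast
      then show ?thesis by (rule card_semi_isos[OF cp cpP plP])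
    qed
    finally have fin: "real (card (isos k P P)) * (\<Sum>\<Phi>\<in>?UX. ?w Q \<Phi>) =
      real (card (isos k P P)) * (real (card (semi_isos k Q Q)) * Xi_path k r j G P S T)" by simp
    have "card (isos k P P) > 0"
      using id_isos[OF cpP, of k] finite_subset[OF isos_semi finite_semi_isos[OF cpP cpP]] by (auto simp: card_gt_0_iff)
    then show "(\<Sum>\<Phi>\<in>?UX. ?w Q \<Phi>) = real (card (semi_isos k Q Q)) * Xi_path k r j G (SOME P. P \<in> X) S T"
      using fin unfolding P_def[symmetric] by simp
  qed
  finally show ?thesis by (simp add: Xi_semi_def sum_distrib_left)
qed

end

section \<open>Supremum bounds and centred segments\<close>

lemma homs_reorder:
  assumes cp: "clique_path r j Q"
  shows "homs k G (reorder \<kappa> Q) = homs k G Q" "hom_weight k r' j' G (reorder \<kappa> Q) = hom_weight k r' j' G Q"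
proof -
  note len = clique_pathD(1)[OF cp]
  show "homs k G (reorder \<kappa> Q) = homs k G Q"
    using rset_reorder[of _ Q \<kappa>] len by (auto simp: homs_def phgraph_reorder[OF cp])
  show "hom_weight k r' j' G (reorder \<kappa> Q) = hom_weight k r' j' G Q"
    using pverts_reorder[OF len] by (simp add: hom_weight_def overlap_def fun_eq_iff)
qed

lemma card_verts_le:
  assumes cp: "clique_path r j P" and j: "j \<le> r"
  shows "card (verts (phgraph k P)) \<le> r * (plen P + 1)"
proof -
  have "card (verts (phgraph k P)) \<le> (\<Sum>i\<in>{1..plen P + 1}. card (pverts P i))"
    unfolding phgraph_def by (simp add: card_UN_le del: One_nat_def)
  also have "\<dots> \<le> (\<Sum>i\<in>{1..plen P + 1}. r)"
  proof (rule sum_mono)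
    fix i assume "i \<in> {1..plen P + 1}"
    then show "card (pverts P i) \<le> r"
      using clique_pathD(2)[OF cp, of i] pverts_last[of P] rset_card[OF cp, of "plen P"] j
      by (cases "i = plen P + 1") auto
  qed
  finally show ?thesis by (simp add: mult.commute)
qed

definition semi_iso_bound :: "nat \<Rightarrow> nat \<Rightarrow> nat" where
  "semi_iso_bound r L = (r * (L + 1)) ^ (r * (L + 1))"

lemma card_semi_isos_le:
  assumes cp: "clique_path r j P" and j: "j \<le> r" and r: "r \<ge> 1" and L: "plen P \<le> L"
  shows "card (semi_isos k P P) \<le> semi_iso_bound r L"
proof -
  let ?V = "verts (phgraph k P)" and ?M = "r * (L + 1)"
  have fin: "finite ?V" by (rule finite_verts[OF cp])
  have "semi_isos k P P \<subseteq> ?V \<rightarrow>\<^sub>E ?V"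
    by (auto simp: semi_isos_def PiE_def dest: hgraph_isoD(2))
  then have "card (semi_isos k P P) \<le> card (?V \<rightarrow>\<^sub>E ?V)"
    using fin by (intro card_mono finite_PiE) auto
  also have "\<dots> = card ?V ^ card ?V" using fin by (simp add: card_funcsetE)
  also have "\<dots> \<le> ?M ^ card ?V"
    using card_verts_le[OF cp j, of k] L by (intro power_mono) (auto intro: order_trans)
  also have "\<dots> \<le> ?M ^ ?M"
  proof (rule power_increasing)
    have "card ?V \<le> r * (plen P + 1)" by (rule card_verts_le[OF cp j])
    also have "\<dots> \<le> ?M" using L by simp
    finally show "card ?V \<le> ?M" .
  qed (use r in simp)
  finally show ?thesis by (simp add: semi_iso_bound_def)
qed

text \<open>One distributor multiplies the supremum of the discrepancies at its own or a higher level by at most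
  \<open>growth r\<close>; one bag multiplies the total absolute weight by at most \<open>weight_growth r\<close>.\<close>
definition growth :: "nat \<Rightarrow> real" where "growth r = 1 + 16 * 4 ^ r"
definition weight_growth :: "nat \<Rightarrow> real" where "weight_growth r = 16 * 4 ^ r * (fact r) ^ 3"

lemma growth_ge: "growth r \<ge> 1" by (simp add: growth_def)

lemma weight_growth_ge: "weight_growth r \<ge> 1"
proof -
  have "1 \<le> (fact r :: real) ^ 3" by (intro one_le_power) (simp add: fact_ge_1)
  then have "(1::real) * 1 \<le> (16 * 4 ^ r) * (fact r) ^ 3"
    by (intro mult_mono) (simp_all add: one_le_power order_trans[of 1 "16 :: real"])
  then show ?thesis by (simp add: weight_growth_def)
qed

lemma step_factor_le:
  assumes cp: "clique_path r j P" and pl: "plen P = 1" and j: "j \<le> r"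
  shows "real (step_factor P) \<le> (fact r) ^ 3"
proof -
  have F: "finite (pverts P 1)" "card (pverts P 1) = r" using clique_pathD(2)[OF cp, of 1] pl by auto
  have S: "finite (rset P 1)" "card (rset P 1) = j" using rset_card[OF cp, of 1] pl by auto
  have "card (overlap P 1 - rset P 0) \<le> r" "card (pverts P 1 - (rset P 0 \<union> overlap P 1)) \<le> r"
    using card_mono[OF F(1), of "overlap P 1 - rset P 0"] card_mono[OF F(1), of "pverts P 1 - (rset P 0 \<union> overlap P 1)"] F(2)
    by (auto simp: overlap_def)
  moreover have "card (rset P 1 - overlap P 1) \<le> r" using card_mono[OF S(1), of "rset P 1 - overlap P 1"] S(2) j by simp
  ultimately have "step_factor P \<le> fact r * fact r * fact r"
    unfolding step_factor_def by (intro mult_le_mono fact_mono_nat)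
  then have "real (step_factor P) \<le> real (fact r * fact r * fact r)" by (rule of_nat_mono)
  then show ?thesis by (simp add: power3_eq_cube)
qed

context regular_host begin

text \<open>There are at most \<open>4 * gam j\<close> cliques on \<open>T\<close> and at most \<open>2^r\<close> choices of
  \<open>R\<close> in each; the number of sets \<open>U\<close> divided by \<open>kc R\<close> is of order \<open>1 / gam
  j\<close>. So all densities cancel and the bound depends on \<open>r\<close> only.\<close>
lemma clique_sum_bound:
  assumes T: "T \<in> E j" and j: "s \<le> j" "j \<le> k" and X: "X \<ge> 0" and g: "\<And>U. U \<in> E j \<Longrightarrow> \<bar>g U\<bar> \<le> X"
    and Q: "\<And>K. K \<in> Cl T \<Longrightarrow> Q K \<subseteq> nsets K s"
  shows "\<bar>\<Sum>K\<in>Cl T. \<Sum>R\<in>Q K. (\<Sum>U\<in>{U\<in>E j. R \<subseteq> U}. g U) / kc R\<bar> \<le> 16 * 4 ^ r * X"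
proof -
  let ?b = "4 * 2 ^ r * X / gam j"
  have gp: "gam j > 0" using gam_pos j by simp
  have b0: "?b \<ge> 0" using gp X by simp
  have 1: "\<bar>(\<Sum>U\<in>{U\<in>E j. R \<subseteq> U}. g U) / kc R\<bar> \<le> ?b" if "K \<in> Cl T" "R \<in> nsets K s" for K R
  proof -
    have R: "R \<in> E s" using nsets_Cl_E that by blast
    have kr: "kc R > 0" using kc_pos[OF R] j by simp
    have "\<bar>\<Sum>U\<in>{U\<in>E j. R \<subseteq> U}. g U\<bar> \<le> (\<Sum>U\<in>{U\<in>E j. R \<subseteq> U}. \<bar>g U\<bar>)" by (rule sum_abs)
    also have "\<dots> \<le> real (card {U\<in>E j. R \<subseteq> U}) * X" using g by (intro sum_bounded_above) auto
    also have "\<dots> \<le> (4 * 2 ^ r * kc R / gam j) * X"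
      using supersets_bound[OF R j] X by (rule mult_right_mono)
    also have "\<dots> = ?b * kc R" by simp
    finally show ?thesis using kr by (simp add: abs_divide pos_divide_le_eq)
  qed
  have 2: "\<bar>\<Sum>R\<in>Q K. (\<Sum>U\<in>{U\<in>E j. R \<subseteq> U}. g U) / kc R\<bar> \<le> 2 ^ r * ?b" if K: "K \<in> Cl T" for K
  proof -
    have "card (Q K) \<le> card (Pow K)" using Q[OF K] cliquesD(2)[OF K] by (intro card_mono) (auto simp: nsets_def)
    also have "\<dots> = 2 ^ r" using cliquesD(2,3)[OF K] by (simp add: card_Pow)
    finally have c: "real (card (Q K)) \<le> 2 ^ r" by (metis of_nat_le_iff of_nat_numeral of_nat_power)
    have "\<bar>\<Sum>R\<in>Q K. (\<Sum>U\<in>{U\<in>E j. R \<subseteq> U}. g U) / kc R\<bar> \<le> (\<Sum>R\<in>Q K. \<bar>(\<Sum>U\<in>{U\<in>E j. R \<subseteq> U}. g U) / kc R\<bar>)" by (rule sum_abs)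
    also have "\<dots> \<le> real (card (Q K)) * ?b" by (rule sum_bounded_above) (use 1[OF K] Q[OF K] in blast)
    also have "\<dots> \<le> 2 ^ r * ?b" using c b0 by (rule mult_right_mono)
    finally show ?thesis .
  qed
  have "\<bar>\<Sum>K\<in>Cl T. \<Sum>R\<in>Q K. (\<Sum>U\<in>{U\<in>E j. R \<subseteq> U}. g U) / kc R\<bar> \<le> (\<Sum>K\<in>Cl T. \<bar>\<Sum>R\<in>Q K. (\<Sum>U\<in>{U\<in>E j. R \<subseteq> U}. g U) / kc R\<bar>)"
    by (rule sum_abs)
  also have "\<dots> \<le> kc T * (2 ^ r * ?b)" using 2 by (rule sum_bounded_above)
  also have "\<dots> \<le> (4 * gam j) * (2 ^ r * ?b)"
  proof (rule mult_right_mono[OF kc_regular(2)[OF T j(2)]])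
    show "0 \<le> 2 ^ r * ?b" using b0 by (intro mult_nonneg_nonneg) auto
  qed
  also have "\<dots> = 16 * 4 ^ r * X"
    using gp by (simp add: power_mult_distrib[symmetric] field_simps)
  finally show ?thesis .
qed

lemma discrepancy_distributor_bound:
  assumes j: "s \<le> j" "j \<le> k" and X: "X \<ge> 0" and x: "\<And>U. U \<in> E j \<Longrightarrow> \<bar>xi j \<phi> U\<bar> \<le> X" and T: "T \<in> E j"
  shows "\<bar>xi j (Rd s \<phi>) T\<bar> \<le> growth r * X"
proof -
  let ?B = "\<Sum>K\<in>Cl T. \<Sum>R\<in>nsets K s. (\<Sum>U\<in>{U\<in>E j. R \<subseteq> U}. xi j \<phi> U) / kc R"
  have b: "\<bar>?B\<bar> \<le> 16 * 4 ^ r * X" using x by (intro clique_sum_bound[OF T j X]) auto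
  have "\<bar>w_hat r j s * ?B\<bar> \<le> 1 * (16 * 4 ^ r * X)"
    unfolding abs_mult using w_hat_le[of s j r] j rk b X by (intro mult_mono) auto
  then show ?thesis using discrepancy_distributor_below[OF T j, of \<phi>] x[OF T] by (simp add: growth_def algebra_simps)
qed

lemma discrepancy_word_bound:
  assumes j: "j \<le> k" and ws: "set ws \<subseteq> {..j}" and X: "X \<ge> 0" and x: "\<And>U. U \<in> E j \<Longrightarrow> \<bar>xi j \<phi> U\<bar> \<le> X"
  shows "T \<in> E j \<Longrightarrow> \<bar>xi j (wop ws \<phi>) T\<bar> \<le> growth r ^ length ws * X"
  using ws
proof (induction ws arbitrary: T)
  case Nil then show ?case using x by simp
next
  case (Cons s ws)
  have g: "0 \<le> growth r ^ length ws * X" using growth_ge[of r] X by simp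
  have "\<bar>xi j (Rd s (wop ws \<phi>)) T\<bar> \<le> growth r * (growth r ^ length ws * X)"
    by (rule discrepancy_distributor_bound[OF _ j g _ Cons.prems(1)]) (use Cons in auto)
  then show ?case by (simp add: mult.assoc)
qed

lemma word_keeps_balance:
  assumes "xi 0 \<phi> {} = 0" and ws: "set ws \<subseteq> {..k}"
  shows "xi 0 (wop ws \<phi>) {} = 0"
  using ws
proof (induction ws)
  case Nil then show ?case using assms by simp
next
  case (Cons s ws)
  have "kc S \<noteq> 0" if "S \<in> E s" for S using kc_pos[OF that] Cons.prems by auto
  moreover have "0 < kc {}" using Cl0_ne by (simp add: card_gt_0_iff)
  ultimately show ?case using distributor_keeps_balance[of "wop ws \<phi>" s] Cons by simp
qed

text \<open>Every bag contributes a factor of the same sign, so the total absolute weight of a path is the absolute value of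
  a homomorphism sum and the gluing lemma applies to it.\<close>
lemma abs_hom_weight:
  assumes cp: "clique_path r j P" and j: "j \<le> r"
  shows "hom_weight k r j G P \<Phi> = (-1) ^ plen P * \<bar>hom_weight k r j G P \<Phi>\<bar>"
proof -
  let ?h = "\<lambda>i. w_hat r j (card (overlap P i)) / kc (\<Phi> ` overlap P i)"
  have "?h i = - 1 * \<bar>?h i\<bar>" if "i \<in> {1..plen P}" for i
  proof -
    have "card (overlap P i) \<le> j"
      using card_mono[OF _ overlap_sub[OF cp, of i]] rset_card[OF cp, of i] that by auto
    then have "w_hat r j (card (overlap P i)) < 0" using w_hat_le j by auto
    then have "?h i \<le> 0" by (intro divide_nonpos_nonneg) auto
    then have "\<bar>?h i\<bar> = - ?h i" by (rule abs_of_nonpos)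
    then show ?thesis by linarith
  qed
  then have "hom_weight k r j G P \<Phi> = (\<Prod>i\<in>{1..plen P}. - 1 * \<bar>?h i\<bar>)"
    unfolding hom_weight_def by (intro prod.cong refl)
  also have "\<dots> = (\<Prod>i\<in>{1..plen P}. - 1) * (\<Prod>i\<in>{1..plen P}. \<bar>?h i\<bar>)" by (rule prod.distrib)
  also have "\<dots> = (-1) ^ plen P * \<bar>hom_weight k r j G P \<Phi>\<bar>"
    by (simp add: hom_weight_def abs_prod del: abs_divide)
  finally show ?thesis .
qed

lemma sum_abs_weight_eq:
  assumes cp: "clique_path r j P" and j: "j \<le> r"
  shows "(\<Sum>\<Phi>\<in>homs_from k G P f. \<bar>hom_weight k r j G P \<Phi>\<bar>) = \<bar>HS j P f (\<lambda>_. 1)\<bar>"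
proof -
  let ?A = "\<Sum>\<Phi>\<in>homs_from k G P f. \<bar>hom_weight k r j G P \<Phi>\<bar>"
  have "HS j P f (\<lambda>_. 1) = (\<Sum>\<Phi>\<in>homs_from k G P f. (-1) ^ plen P * \<bar>hom_weight k r j G P \<Phi>\<bar>)"
    unfolding hom_sum_def by (intro sum.cong refl) (use abs_hom_weight[OF cp j] in simp)
  also have "\<dots> = (-1) ^ plen P * ?A" by (simp add: sum_distrib_left)
  finally have "\<bar>HS j P f (\<lambda>_. 1)\<bar> = \<bar>?A\<bar>" by (simp add: abs_mult)
  then show ?thesis by (simp add: sum_nonneg)
qed

lemma sum_abs_weight_bound:
  assumes j: "1 \<le> j" "j \<le> k"
  shows "clique_path r j P \<Longrightarrow> (\<Sum>\<Phi>\<in>homs_from k G P f. \<bar>hom_weight k r j G P \<Phi>\<bar>) \<le> weight_growth r ^ plen P"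
proof (induction "plen P" arbitrary: P)
  case 0
  have V: "verts (phgraph k P) = rset P 0" using pverts_last[of P] 0(1)[symmetric] by (simp add: phgraph_def)
  have "homs_from k G P f \<subseteq> {restrict f (rset P 0)}"
  proof
    fix \<Phi> assume h: "\<Phi> \<in> homs_from k G P f"
    have "\<Phi> = restrict f (rset P 0)"
      by (rule extensionalityI[of _ "rset P 0"]) (use h V in \<open>auto simp: homs_from_def homs_def PiE_def\<close>)
    then show "\<Phi> \<in> {restrict f (rset P 0)}" by simp
  qed
  then have "card (homs_from k G P f) \<le> 1" using card_mono[of "{restrict f (rset P 0)}"] by force
  moreover have "hom_weight k r j G P \<Phi> = 1" for \<Phi> using 0(1)[symmetric] by (simp add: hom_weight_def)
  ultimately show ?case using 0(1)[symmetric] by simp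
next
  case (Suc p)
  note cp = Suc.prems
  have jr: "j \<le> r" using j rk by simp
  have pl: "plen P = Suc p" "p \<le> plen P" using Suc.hyps(2) by auto
  note len = clique_pathD(1)[OF cp]
  let ?P = "ptake p P" and ?Q = "pdrop p P"
  have cp1: "clique_path r j ?P" and pl1: "plen ?P = p" using clique_path_ptake[OF cp pl(2)] plen_ptake[OF pl(2)] by auto
  have cp2: "clique_path r j ?Q" and pl2: "plen ?Q = 1" using clique_path_pdrop[OF cp pl(2)] plen_pdrop pl by auto
  have r0: "rset ?Q 0 = rset ?P p" using rset_pdrop[OF len, of p 0] rset_ptake[of p p P] pl by simp
  have one: "\<bar>HS j ?Q \<Phi> (\<lambda>_. 1)\<bar> \<le> weight_growth r" if h: "\<Phi> \<in> homs_from k G ?P f" for \<Phi>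
  proof -
    let ?T = "\<Phi> ` rset ?Q 0"
    have hh: "\<Phi> \<in> homs k G ?P" using h by (simp add: homs_from_def)
    have T: "?T \<in> E j" "inj_on \<Phi> (rset ?Q 0)"
      using hom_root[OF cp1 j(2) hh, of p] homsD(3)[OF hh, of p] pl1 r0 by auto
    let ?s = "card (overlap ?Q 1)"
    have s: "?s \<le> j" using card_mono[OF _ overlap_sub[OF cp2, of 1]] rset_card[OF cp2, of 1] pl2 by auto
    let ?B = "\<Sum>K\<in>Cl ?T. \<Sum>R\<in>{R \<in> nsets K ?s. R \<inter> ?T = \<Phi> ` (overlap ?Q 1 \<inter> rset ?Q 0)}.
      (\<Sum>U\<in>{U\<in>E j. R \<subseteq> U}. 1) / kc R"
    have B: "\<bar>?B\<bar> \<le> 16 * 4 ^ r * 1" by (rule clique_sum_bound[OF T(1) s j(2)]) auto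
    have "\<bar>HS j ?Q \<Phi> (\<lambda>_. 1)\<bar> = real (step_factor ?Q) * \<bar>w_hat r j ?s\<bar> * \<bar>?B\<bar>"
      by (subst hom_sum_single_clique[OF cp2 pl2 j(2) T(2) refl T(1)]) (simp add: abs_mult)
    also have "\<dots> \<le> ((fact r) ^ 3 * 1) * (16 * 4 ^ r * 1)"
      using step_factor_le[OF cp2 pl2 jr] w_hat_le[OF s jr] B by (intro mult_mono) auto
    finally show ?thesis by (simp add: weight_growth_def mult.commute)
  qed
  have "(\<Sum>\<Phi>\<in>homs_from k G P f. \<bar>hom_weight k r j G P \<Phi>\<bar>) = \<bar>HS j P f (\<lambda>_. 1)\<bar>" by (rule sum_abs_weight_eq[OF cp jr])
  also have "\<dots> = \<bar>\<Sum>\<Phi>\<in>homs_from k G ?P f. hom_weight k r j G ?P \<Phi> * HS j ?Q \<Phi> (\<lambda>_. 1)\<bar>"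
    by (simp only: hom_sum_glue[OF cp pl(2)])
  also have "\<dots> \<le> (\<Sum>\<Phi>\<in>homs_from k G ?P f. \<bar>hom_weight k r j G ?P \<Phi> * HS j ?Q \<Phi> (\<lambda>_. 1)\<bar>)" by (rule sum_abs)
  also have "\<dots> \<le> (\<Sum>\<Phi>\<in>homs_from k G ?P f. \<bar>hom_weight k r j G ?P \<Phi>\<bar> * weight_growth r)"
    unfolding abs_mult using one by (intro sum_mono mult_left_mono) auto
  also have "\<dots> = (\<Sum>\<Phi>\<in>homs_from k G ?P f. \<bar>hom_weight k r j G ?P \<Phi>\<bar>) * weight_growth r" by (simp add: sum_distrib_right)
  also have "\<dots> \<le> weight_growth r ^ p * weight_growth r"
    using Suc.hyps(1)[of ?P] pl1 cp1 weight_growth_ge[of r] by (intro mult_right_mono) auto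
  finally show ?case using pl by (simp add: mult.commute)
qed

text \<open>Here the regularity condition on centred paths enters. Grouped by the last root set \<open>T\<close>, the sum has
  the weight \<open>\<alpha> * gam j / gam b\<close> up to a small error for all \<open>T\<close> above the image
  \<open>B\<close> of the common roots, and weight 0 otherwise. So the values \<open>x T\<close> enter only through their sum
  over \<open>T \<supseteq> B\<close>, which is a discrepancy at level \<open>b < j\<close>. The segment is first reordered
  by \<open>\<Phi>\<close>, so that \<open>\<Phi>\<close> becomes order-preserving on the first root set.\<close>
lemma centred_segment_value:
  assumes cpQ: "clique_path r j Q" and j: "1 \<le> j" "j \<le> k" and b: "b < j"
    and cen: "centred k b c Q" and L: "plen Q \<le> l ^ (3 * k)" and C0: "C \<ge> 0"
    and S: "\<Phi> ` rset Q 0 = S" "S \<in> E j" "inj_on \<Phi> (rset Q 0)"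
    and X: "X \<ge> 0" and x: "\<And>T. T \<in> E j \<Longrightarrow> \<bar>x T\<bar> \<le> X"
    and Y: "\<And>B. B \<in> E b \<Longrightarrow> \<bar>\<Sum>T\<in>{T\<in>E j. B \<subseteq> T}. x T\<bar> \<le> Y * gam b / gam j"
  shows "\<bar>HS j Q \<Phi> x\<bar> \<le> real (semi_iso_bound r (l ^ (3 * k))) * (C * Y + \<epsilon> * X)"
proof -
  define Q' where "Q' = reorder \<Phi> Q"
  note len = clique_pathD(1)[OF cpQ]
  have cp': "clique_path r j Q'" unfolding Q'_def by (rule clique_path_reorder[OF cpQ])
  have pl': "plen Q' = plen Q" by (simp add: Q'_def)
  have rs': "rset Q' i = rset Q i" if "i \<le> plen Q" for i using rset_reorder[of i Q \<Phi>] len that by (simp add: Q'_def)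
  have ph': "phgraph k Q' = phgraph k Q" unfolding Q'_def by (rule phgraph_reorder[OF cpQ])
  have ro': "root_seq Q' 0 = sort_key \<Phi> (root_seq Q 0)" using root_reorder[of 0 Q \<Phi>] len by (simp add: Q'_def)
  have cen': "centred k b c Q'" using cen rs'[of 0] rs'[of "plen Q"] by (simp add: centred_def pl' ph')
  have h': "homs k G Q' = homs k G Q" "hom_weight k r j G Q' = hom_weight k r j G Q"
    using homs_reorder[OF cpQ] by (auto simp: Q'_def)
  have Sf: "finite S" "card S = j" using E_D[OF S(2)] by auto
  have order: "map \<Phi> (root_seq Q' 0) = sorted_list_of_set S"
  proof (rule strict_sorted_eqI)
    show "sorted_wrt (<) (map \<Phi> (root_seq Q' 0))"
      unfolding ro' using clique_pathD(3)[OF cpQ, of 0] S(3) by (intro map_sort_key_strict) (auto simp: rset_def)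
    show "set (map \<Phi> (root_seq Q' 0)) = set (sorted_list_of_set S)" using S(1) Sf ro' by (simp add: rset_def)
  qed simp
  have root0: "set (root_seq Q' 0) = rset Q 0" using rs'[of 0] by (simp add: rset_def)
  define core where "core = rset Q 0 \<inter> rset Q (plen Q)"
  define B where "B = \<Phi> ` core"
  have Bb: "card core = b" using cen by (simp add: centred_def Let_def core_def)
  have cB: "card B = b" unfolding B_def Bb[symmetric] using S(3) by (intro card_image) (auto simp: core_def intro: inj_on_subset)
  have BS: "B \<subseteq> S" using S(1) by (auto simp: B_def core_def)
  have BE: "B \<in> E b"
    using BS cB E_D[OF S(2)] b j finite_subset by (auto simp: Ej_def nsets_def)
  let ?w = "hom_weight k r j G Q" and ?q = "rset Q (plen Q)"
  have hf: "homs_from k G Q \<Phi> = {\<Omega> \<in> homs k G Q'. map \<Omega> (root_seq Q' 0) = sorted_list_of_set S}"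
    unfolding homs_from_def h' order[symmetric] using root0 by auto
  have last: "\<Omega> ` ?q \<in> E j" if "\<Omega> \<in> homs_from k G Q \<Phi>" for \<Omega>
    using hom_root[OF cpQ j(2), of \<Omega> "plen Q"] that by (simp add: homs_from_def)
  define W where "W T = (\<Sum>\<Omega>\<in>labelled_homs Q' S T. hom_weight k r j G Q' \<Omega>)" for T
  have "HS j Q \<Phi> x = (\<Sum>T\<in>E j. \<Sum>\<Omega>\<in>{\<Omega>\<in>homs_from k G Q \<Phi>. \<Omega> ` ?q = T}. ?w \<Omega> * x (\<Omega> ` ?q))"
    unfolding hom_sum_def by (rule sum.group[symmetric]) (use finite_homs_from[OF cpQ] last in auto)
  also have "\<dots> = (\<Sum>T\<in>E j. W T * x T)"
  proof (intro sum.cong refl)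
    fix T
    have "{\<Omega>\<in>homs_from k G Q \<Phi>. \<Omega> ` ?q = T} = labelled_homs Q' S T"
      unfolding hf labelled_homs_def pl' using rs'[of "plen Q"] by auto
    then show "(\<Sum>\<Omega>\<in>{\<Omega>\<in>homs_from k G Q \<Phi>. \<Omega> ` ?q = T}. ?w \<Omega> * x (\<Omega> ` ?q)) = W T * x T"
      unfolding W_def h'(2) sum_distrib_right by (intro sum.cong) (auto simp: labelled_homs_def pl' rs')
  qed
  finally have H: "HS j Q \<Phi> x = (\<Sum>T\<in>E j. W T * x T)" .
  \<comment> \<open>Positions in the order of \<open>S\<close> correspond to positions in the sorted first root, so a set \<open>T\<close> above \<open>B\<close> meets the condition on \<open>iota\<close>.\<close>
  have io: "iota_path Q' \<subseteq> iota (S \<inter> T) (sorted_list_of_set S)" if "B \<subseteq> T" for T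
  proof
    fix i assume "i \<in> iota_path Q'"
    then have i: "1 \<le> i" "i \<le> length (root_seq Q' 0)" "root_seq Q' 0 ! (i - 1) \<in> core"
      using rs'[of 0] rs'[of "plen Q"] by (auto simp: iota_path_def iota_def core_def pl')
    have "sorted_list_of_set S ! (i - 1) = \<Phi> (root_seq Q' 0 ! (i - 1))"
      unfolding order[symmetric] using i by simp
    then have "sorted_list_of_set S ! (i - 1) \<in> B" using i by (auto simp: B_def)
    moreover have "length (sorted_list_of_set S) = length (root_seq Q' 0)" unfolding order[symmetric] by simp
    ultimately show "i \<in> iota (S \<inter> T) (sorted_list_of_set S)" using i BS that by (auto simp: iota_def)
  qed
  have zero: "W T = 0" if "\<not> B \<subseteq> T" for T
  proof -
    have "labelled_homs Q' S T = {}"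
    proof -
      have False if \<Omega>: "\<Omega> \<in> labelled_homs Q' S T" for \<Omega>
      proof -
        have "map \<Omega> (root_seq Q' 0) = map \<Phi> (root_seq Q' 0)" using \<Omega> order by (simp add: labelled_homs_def)
        then have "\<Omega> v = \<Phi> v" if "v \<in> rset Q 0" for v using that root0 by auto
        then have "B = \<Omega> ` core" by (auto simp: B_def core_def)
        also have "\<dots> \<subseteq> T" using \<Omega> rs'[of "plen Q"] by (auto simp: labelled_homs_def core_def pl')
        finally show False using \<open>\<not> B \<subseteq> T\<close> by simp
      qed
      then show ?thesis by blast
    qed
    then show ?thesis by (simp add: W_def)
  qed
  define a where "a = real (card (semi_isos k Q' Q'))"
  have a: "0 \<le> a" "a \<le> real (semi_iso_bound r (l ^ (3 * k)))"
    using card_semi_isos_le[OF cp', of "l ^ (3 * k)" k] j rk L by (auto simp: a_def pl')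
  obtain \<alpha> \<zeta> where \<alpha>: "\<bar>\<alpha>\<bar> \<le> C" and \<zeta>: "pair_norm (E j) \<zeta> \<le> \<epsilon>"
    and reg: "\<And>S T. S \<in> E j \<Longrightarrow> T \<in> E j \<Longrightarrow> iota_path Q' \<subseteq> iota (S \<inter> T) (sorted_list_of_set S) \<Longrightarrow>
      Xi_semi k r j G (semi_ordered k r j Q') S T = \<alpha> * (gam j / gam b) + \<zeta> S T"
  proof -
    have "\<exists>\<alpha> \<zeta>. \<bar>\<alpha>\<bar> \<le> C \<and> pair_norm (E j) \<zeta> \<le> \<epsilon> \<and>
           (\<forall>S\<in>E j. \<forall>T\<in>E j. iota_path Q' \<subseteq> iota (S \<inter> T) (sorted_list_of_set S) \<longrightarrow>
              Xi_semi k r j G (semi_ordered k r j Q') S T = \<alpha> * (gam j / gam b) + \<zeta> S T)"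
      using creg b j(2) cp' L cen' unfolding clique_regular_def pl'[symmetric] by blast
    then show ?thesis using that by blast
  qed
  have WT: "W T = a * (\<alpha> * (gam j / gam b) + \<zeta> S T)" if "T \<in> E j" "B \<subseteq> T" for T
    unfolding W_def sum_labelled_homs[OF cp' j(2) Sf(1)] reg[OF S(2) that(1) io[OF that(2)]] by (simp add: a_def)
  let ?F = "{T \<in> E j. B \<subseteq> T}"
  have "HS j Q \<Phi> x = (\<Sum>T\<in>?F. W T * x T)"
    unfolding H using zero by (intro sum.mono_neutral_right) auto
  also have "\<dots> = (\<Sum>T\<in>?F. a * (\<alpha> * (gam j / gam b)) * x T + a * (\<zeta> S T * x T))"
    by (intro sum.cong refl) (auto simp: WT algebra_simps)
  also have "\<dots> = a * (\<alpha> * (gam j / gam b) * (\<Sum>T\<in>?F. x T) + (\<Sum>T\<in>?F. \<zeta> S T * x T))"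
    by (simp add: sum.distrib sum_distrib_left algebra_simps)
  finally have HE: "HS j Q \<Phi> x = a * (\<alpha> * (gam j / gam b) * (\<Sum>T\<in>?F. x T) + (\<Sum>T\<in>?F. \<zeta> S T * x T))" .
  have g: "gam j > 0" "gam b > 0" using gam_pos j b by auto
  have 1: "\<bar>\<alpha> * (gam j / gam b) * (\<Sum>T\<in>?F. x T)\<bar> \<le> C * Y"
  proof -
    have "\<bar>\<alpha> * (gam j / gam b) * (\<Sum>T\<in>?F. x T)\<bar> = \<bar>\<alpha>\<bar> * (gam j / gam b) * \<bar>\<Sum>T\<in>?F. x T\<bar>"
      using g by (simp add: abs_mult)
    also have "\<dots> \<le> C * (gam j / gam b) * (Y * gam b / gam j)"
      using \<alpha> Y[OF BE] g C0 by (intro mult_mono) auto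
    also have "\<dots> = C * Y" using g by simp
    finally show ?thesis .
  qed
  have 2: "\<bar>\<Sum>T\<in>?F. \<zeta> S T * x T\<bar> \<le> \<epsilon> * X"
  proof -
    have "\<bar>\<Sum>T\<in>?F. \<zeta> S T * x T\<bar> \<le> (\<Sum>T\<in>?F. \<bar>\<zeta> S T * x T\<bar>)" by (rule sum_abs)
    also have "\<dots> \<le> (\<Sum>T\<in>E j. \<bar>\<zeta> S T * x T\<bar>)" by (rule sum_mono2) auto
    also have "\<dots> \<le> (\<Sum>T\<in>E j. \<bar>\<zeta> S T\<bar> * X)"
      unfolding abs_mult using x by (intro sum_mono mult_left_mono) auto
    also have "\<dots> = (\<Sum>T\<in>E j. \<bar>\<zeta> S T\<bar>) * X" by (simp add: sum_distrib_right)
    also have "\<dots> \<le> \<epsilon> * X"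
    proof (rule mult_right_mono[OF _ X])
      have "(\<Sum>T\<in>E j. \<bar>\<zeta> S T\<bar>) \<le> pair_norm (E j) \<zeta>"
        unfolding pair_norm_def by (rule Max_ge) (use S(2) in auto)
      then show "(\<Sum>T\<in>E j. \<bar>\<zeta> S T\<bar>) \<le> \<epsilon>" using \<zeta> by simp
    qed
    finally show ?thesis .
  qed
  have "\<bar>HS j Q \<Phi> x\<bar> \<le> a * (C * Y + \<epsilon> * X)"
    unfolding HE abs_mult using a(1) 1 2 by (intro mult_mono order_trans[OF abs_triangle_ineq] add_mono) auto
  also have "\<dots> \<le> real (semi_iso_bound r (l ^ (3 * k))) * (C * Y + \<epsilon> * X)"
    using a(2) 1 2 by (intro mult_right_mono) linarith+
  finally show ?thesis .
qed

text \<open>Only a final segment has to be centred: the initial segment contributes at most its total absolute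
  weight.\<close>
lemma centred_bound:
  assumes cp: "clique_path r j P" and q: "q \<le> plen P" and j: "1 \<le> j" "j \<le> k" and b: "b < j"
    and cen: "centred k b c (pdrop q P)" and L: "plen P \<le> l ^ (3 * k)" and C0: "C \<ge> 0"
    and X: "X \<ge> 0" and x: "\<And>T. T \<in> E j \<Longrightarrow> \<bar>x T\<bar> \<le> X"
    and Y0: "Y \<ge> 0" and Y: "\<And>B. B \<in> E b \<Longrightarrow> \<bar>\<Sum>T\<in>{T\<in>E j. B \<subseteq> T}. x T\<bar> \<le> Y * gam b / gam j"
  shows "\<bar>HS j P f x\<bar> \<le> weight_growth r ^ (l ^ (3 * k)) * (real (semi_iso_bound r (l ^ (3 * k))) * (C * Y + \<epsilon> * X))"
proof -
  let ?Z = "real (semi_iso_bound r (l ^ (3 * k))) * (C * Y + \<epsilon> * X)"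
  let ?P = "ptake q P" and ?Q = "pdrop q P"
  note len = clique_pathD(1)[OF cp]
  have Z: "?Z \<ge> 0" using C0 Y0 X eps by simp
  have cp1: "clique_path r j ?P" and pl1: "plen ?P = q" using clique_path_ptake[OF cp q] plen_ptake[OF q] by auto
  have cp2: "clique_path r j ?Q" and pl2: "plen ?Q \<le> l ^ (3 * k)" using clique_path_pdrop[OF cp q] plen_pdrop[of q P] L by auto
  have r0: "rset ?Q 0 = rset ?P q" using rset_pdrop[OF len, of q 0] rset_ptake[of q q P] q by simp
  have seg: "\<bar>HS j ?Q \<Phi> x\<bar> \<le> ?Z" if h: "\<Phi> \<in> homs_from k G ?P f" for \<Phi>
  proof -
    have hh: "\<Phi> \<in> homs k G ?P" using h by (simp add: homs_from_def)
    show ?thesis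
      by (rule centred_segment_value[OF cp2 j b cen pl2 C0 refl _ _ X x Y])
        (use hom_root[OF cp1 j(2) hh, of q] homsD(3)[OF hh, of q] pl1 r0 in auto)
  qed
  have "\<bar>HS j P f x\<bar> \<le> (\<Sum>\<Phi>\<in>homs_from k G ?P f. \<bar>hom_weight k r j G ?P \<Phi> * HS j ?Q \<Phi> x\<bar>)"
    unfolding hom_sum_glue[OF cp q] by (rule sum_abs)
  also have "\<dots> \<le> (\<Sum>\<Phi>\<in>homs_from k G ?P f. \<bar>hom_weight k r j G ?P \<Phi>\<bar> * ?Z)"
    unfolding abs_mult using seg by (intro sum_mono mult_left_mono) auto
  also have "\<dots> = (\<Sum>\<Phi>\<in>homs_from k G ?P f. \<bar>hom_weight k r j G ?P \<Phi>\<bar>) * ?Z" by (simp only: sum_distrib_right)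
  also have "\<dots> \<le> weight_growth r ^ (l ^ (3 * k)) * ?Z"
  proof (rule mult_right_mono[OF _ Z])
    have "(\<Sum>\<Phi>\<in>homs_from k G ?P f. \<bar>hom_weight k r j G ?P \<Phi>\<bar>) \<le> weight_growth r ^ plen ?P"
      by (rule sum_abs_weight_bound[OF j cp1])
    also have "\<dots> \<le> weight_growth r ^ (l ^ (3 * k))"
      using weight_growth_ge q L pl1 by (intro power_increasing) auto
    finally show "(\<Sum>\<Phi>\<in>homs_from k G ?P f. \<bar>hom_weight k r j G ?P \<Phi>\<bar>) \<le> weight_growth r ^ (l ^ (3 * k))" .
  qed
  finally show ?thesis .
qed

end

section \<open>Checkpoints\<close>

text \<open>The root sets at the indices in \<open>I\<close> are an interval family of distinct \<open>j\<close>-sets, and a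
  sunflower among them spans a centred segment.\<close>
lemma centred_segment_exists:
  assumes cp: "clique_path r j P" and I: "I \<subseteq> {0..plen P}" "card I \<ge> c ^ j + 1" and c: "c \<ge> 1" and k: "k \<ge> 2"
  shows "\<exists>p\<in>I. \<exists>q<p. \<exists>b<j. centred k b c (pdrop q (ptake p P))"
proof -
  have fin: "finite I" using I finite_subset by auto
  define e where "e i = sorted_list_of_set I ! i" for i
  have len: "length (sorted_list_of_set I) = card I" by simp
  have mono: "e a < e b" if "a < b" "b \<le> c ^ j" for a b
    using sorted_wrt_nth_less[OF strict_sorted_list_of_set[of I] that(1)] that I len by (simp add: e_def)
  have mono': "e a \<le> e b" if "a \<le> b" "b \<le> c ^ j" for a b
    using mono[of a b] that by (cases "a = b") auto
  have eI: "e i \<in> I" if "i \<le> c ^ j" for i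
    using nth_mem[of i "sorted_list_of_set I"] that I fin len by (simp add: e_def)
  have eP: "e i \<le> plen P" if "i \<le> c ^ j" for i using eI[OF that] I by auto
  have "\<exists>t B. strict_mono_on {..c} t \<and> t c \<le> c ^ j \<and> (\<forall>a b. a < b \<longrightarrow> b \<le> c \<longrightarrow> rset P (e (t a)) \<inter> rset P (e (t b)) = B)"
  proof (rule sunflower_in_interval_family)
    show "finite (rset P (e i)) \<and> card (rset P (e i)) = j" if "i \<le> c ^ j" for i
      using rset_card[OF cp eP[OF that]] .
    show "rset P (e i) \<noteq> rset P (e i')" if "i < i'" "i' \<le> c ^ j" for i i'
      using rset_distinct[OF cp eP[of i] eP[of i']] mono[OF that] that by simp
    show "x \<in> rset P (e n)" if "x \<in> rset P (e i)" "x \<in> rset P (e i')" "i \<le> n" "n \<le> i'" "i' \<le> c ^ j" for x i n i'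
      using roots_interval[OF cp that(1,2)] mono' eP that by simp
  qed (use c in auto)
  then obtain t B where t: "strict_mono_on {..c} t" "t c \<le> c ^ j"
    and B: "\<And>a b. a < b \<Longrightarrow> b \<le> c \<Longrightarrow> rset P (e (t a)) \<inter> rset P (e (t b)) = B" by blast
  have tm: "t a < t b" if "a < b" "b \<le> c" for a b using t(1) that by (auto simp: strict_mono_on_def)
  have tc: "t a \<le> c ^ j" if "a \<le> c" for a using tm[of a c] t(2) that by (cases "a = c") auto
  have etm: "e (t a) < e (t b)" if "a < b" "b \<le> c" for a b using mono tm tc that by simp
  define q where "q = e (t 0)"
  define p where "p = e (t c)"
  have qp: "q < p" using etm[of 0 c] c by (simp add: q_def p_def)
  have pP: "p \<le> plen P" using eP tc by (simp add: p_def)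
  let ?P = "ptake p P" and ?t = "\<lambda>a. e (t a) - q"
  have cp1: "clique_path r j ?P" and pl1: "plen ?P = p" using clique_path_ptake[OF cp pP] plen_ptake[OF pP] by auto
  have cp2: "clique_path r j (pdrop q ?P)" using clique_path_pdrop[OF cp1] qp pl1 by simp
  have qe: "q \<le> e (t a)" "e (t a) \<le> p" if "a \<le> c" for a
    using etm[of 0 a] etm[of a c] that by (cases "a = 0"; cases "a = c"; simp add: q_def p_def)+
  have rs: "rset (pdrop q ?P) (?t a) = rset P (e (t a))" if "a \<le> c" for a
    using rset_pdrop[OF clique_pathD(1)[OF cp1], of q "?t a"] rset_ptake[of "e (t a)" p P] qe[OF that] pl1 by simp
  have 1: "plen (pdrop q ?P) = ?t c" using plen_pdrop pl1 by (simp add: p_def)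
  have 2: "?t 0 = 0" by (simp add: q_def)
  have 3: "?t a < ?t b" if "a < b" "b \<le> c" for a b using etm[OF that] qe[of a] that by simp
  have 4: "rset (pdrop q ?P) (?t a) \<inter> rset (pdrop q ?P) (?t b) = B" if "a < b" "b \<le> c" for a b
    using B[OF that] rs that by simp
  have "centred k (card B) c (pdrop q ?P)" "card B < j"
    using centred_from_sunflower[of r j "pdrop q ?P" ?t c B k, OF cp2 1 2 3 4 c k] by auto
  moreover have "p \<in> I" using eI tc by (simp add: p_def)
  ultimately show ?thesis using qp by blast
qed

context regular_host begin

text \<open>Backwards through the blocks of the word. The set \<open>I\<close> records the lengths that the path had at the
  checkpoints passed so far, where a checkpoint is the moment after a run of \<open>ws\<close>. A path is stopped at the
  first checkpoint that ends a centred segment and is then bounded by \<open>Z\<close>. A path that is never stopped would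
  pass more than \<open>c^j\<close> checkpoints, which is impossible; so the case of no remaining block is vacuous.\<close>
lemma hom_sum_blocks:
  fixes \<phi> :: "nat set \<Rightarrow> real"
  assumes j: "1 \<le> j" "j \<le> k" and c: "c \<ge> 1" and l: "l \<ge> 1" and C0: "C \<ge> 0"
    and ws: "set ws \<subseteq> {..j}" and X: "X \<ge> 0" and Y0: "Y \<ge> 0"
  defines "\<phi>s \<equiv> \<lambda>i. wop (concat (replicate i (replicate l j @ ws))) \<phi>"
  defines "Z \<equiv> weight_growth r ^ (l ^ (3 * k)) * (real (semi_iso_bound r (l ^ (3 * k))) * (C * Y + \<epsilon> * X))"
  assumes x: "\<And>i T. i < n \<Longrightarrow> T \<in> E j \<Longrightarrow> \<bar>xi j (wop ws (\<phi>s i)) T\<bar> \<le> X"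
    and Y: "\<And>i b B. i < n \<Longrightarrow> b < j \<Longrightarrow> B \<in> E b \<Longrightarrow> \<bar>\<Sum>T\<in>{T\<in>E j. B \<subseteq> T}. xi j (wop ws (\<phi>s i)) T\<bar> \<le> Y * gam b / gam j"
  shows "i \<le> n \<Longrightarrow> clique_path r j P \<Longrightarrow> sorted_roots P \<Longrightarrow> I \<subseteq> {0..plen P} \<Longrightarrow> card I + i \<ge> c ^ j + 1 \<Longrightarrow>
    plen P + i * (l + length ws) \<le> l ^ (3 * k) \<Longrightarrow>
    (\<And>p q b. p \<in> I \<Longrightarrow> q < p \<Longrightarrow> b < j \<Longrightarrow> \<not> centred k b c (pdrop q (ptake p P))) \<Longrightarrow>
    \<bar>HS j P f (xi j (\<phi>s i))\<bar> \<le> (2 ^ r + 1) ^ (i * (l + length ws)) * Z"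
proof (induction i arbitrary: P I)
  case 0
  obtain p q b where "p \<in> I" "q < p" "b < j" "centred k b c (pdrop q (ptake p P))"
    using centred_segment_exists[OF 0(2) 0(4) _ c k2] 0(5) by auto
  then show ?case using 0(7) by blast
next
  case (Suc i)
  have Z: "Z \<ge> 0"
    unfolding Z_def using C0 Y0 X eps weight_growth_ge[of r] by simp
  have pos: "kc S > 0" if "S \<in> E j" for S using kc_pos[OF that j(2)] .
  let ?m = "l + length ws"
  let ?Z1 = "(2 ^ r + 1) ^ (i * ?m) * Z"
  let ?Z2 = "(2 ^ r + 1) ^ length ws * ?Z1"
  have Z1: "?Z1 \<ge> 0" and Z2: "?Z2 \<ge> 0" using Z by simp_all
  have ZZ2: "Z \<le> ?Z2"
  proof -
    have "1 * Z \<le> ((2 ^ r + 1) ^ length ws * (2 ^ r + 1) ^ (i * ?m)) * Z"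
      using Z by (intro mult_right_mono) (simp_all add: one_le_power flip: power_add)
    then show ?thesis by (simp add: mult.assoc)
  qed
  have step: "\<phi>s (Suc i) = wop (replicate l j) (wop ws (\<phi>s i))" by (simp add: \<phi>s_def)
  have "\<bar>HS j P f (xi j (wop (replicate l j) (wop ws (\<phi>s i))))\<bar> \<le> (2 ^ r + 1) ^ length (replicate l j) * ?Z2"
  proof (rule hom_sum_word[OF j Z2 pos Suc.prems(2,3)])
    show "set (replicate l j) \<subseteq> {..j}" by auto
  next
    fix P' assume P': "clique_path r j P'" "sorted_roots P'" "ptake (plen P) P' = P"
      "plen P' \<le> plen P + length (replicate l j)" "j \<in> set (replicate l j) \<Longrightarrow> plen P < plen P'"
    have lt: "plen P < plen P'" using P'(5) l by simp
    have le: "plen P' \<le> plen P + l" using P'(4) by simp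
    have lenP': "plen P' \<le> l ^ (3 * k)" using le Suc.prems(6) by simp
    show "\<bar>HS j P' f (xi j (wop ws (\<phi>s i)))\<bar> \<le> ?Z2"
    proof (cases "\<exists>q<plen P'. \<exists>b<j. centred k b c (pdrop q P')")
      case True
      then obtain q b where qb: "q < plen P'" "b < j" "centred k b c (pdrop q P')" by blast
      have "\<bar>HS j P' f (xi j (wop ws (\<phi>s i)))\<bar> \<le> Z"
        unfolding Z_def using qb Suc.prems(1)
        by (intro centred_bound[OF P'(1) _ j qb(2,3) lenP' C0 X x Y0 Y]) auto
      then show ?thesis using ZZ2 by simp
    next
      case False
      show ?thesis
      proof (rule hom_sum_word[OF j Z1 pos P'(1,2) ws])
        fix P'' assume P'': "clique_path r j P''" "sorted_roots P''" "ptake (plen P') P'' = P'" "plen P' \<le> plen P''"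
          "plen P'' \<le> plen P' + length ws"
        show "\<bar>HS j P'' f (xi j (\<phi>s i))\<bar> \<le> ?Z1"
        proof (rule Suc.IH[OF _ P''(1,2), of "insert (plen P') I"])
          show "i \<le> n" using Suc.prems(1) by simp
          show "insert (plen P') I \<subseteq> {0..plen P''}" using Suc.prems(4) lt P''(4) by auto
          have "plen P' \<notin> I" "finite I" using Suc.prems(4) lt finite_subset by auto
          then show "c ^ j + 1 \<le> card (insert (plen P') I) + i" using Suc.prems(5) by simp
          show "plen P'' + i * ?m \<le> l ^ (3 * k)" using P''(5) le Suc.prems(6) by simp
          fix p q b assume p: "p \<in> insert (plen P') I" "q < p" "b < j"
          show "\<not> centred k b c (pdrop q (ptake p P''))"
          proof (cases "p = plen P'")
            case True
            then show ?thesis using False p P''(3) by auto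
          next
            case F: False
            then have pI: "p \<in> I" "p \<le> plen P" using p Suc.prems(4) by auto
            have "ptake p P'' = ptake p P"
              using ptake_ptake[of p "plen P'" P''] ptake_ptake[of p "plen P" P'] pI lt P''(3) P'(3) by simp
            then show ?thesis using Suc.prems(7)[OF pI(1) p(2,3)] by simp
          qed
        qed
      qed simp
    qed
  qed simp
  then show ?case unfolding step by (simp add: power_add algebra_simps)
qed

text \<open>The path of length 0, from which the unrolling starts.\<close>
lemma hom_sum_trivial_path:
  assumes j: "1 \<le> j" "j \<le> k" and T: "T \<in> E j"
  defines "P \<equiv> ([], [[0..<j]]) :: cpath" and "f \<equiv> \<lambda>i. sorted_list_of_set T ! i"
  shows "clique_path r j P" "sorted_roots P" "plen P = 0" "HS j P f g = g T"
proof -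
  have Tf: "finite T" "card T = j" "T \<subseteq> verts G" using E_D[OF T] by auto
  show pl: "plen P = 0" by (simp add: P_def plen_def)
  have ro: "root_seq P 0 = [0..<j]" by (simp add: P_def root_seq_def)
  have rs: "rset P 0 = {0..<j}" by (simp add: rset_def ro)
  have pv: "pverts P 0 = {0..<j}" "pverts P 1 = {0..<j}" using rs pl by (auto simp: pverts_def)
  show cp: "clique_path r j P"
    unfolding clique_path_def using pl ro rs pv by (simp add: P_def)
  show "sorted_roots P" by (simp add: sorted_roots_def pl ro rs)
  have V: "verts (phgraph k P) = {0..<j}" using pv(2) by (simp add: phgraph_def pl)
  have Ed: "edges (phgraph k P) = nsets {0..<j} k" using pv(2) by (simp add: phgraph_def pl)
  have bij: "bij_betw f {0..<j} T"
    using bij_betw_nth[of "sorted_list_of_set T" "{0..<j}" T] Tf by (simp add: f_def lessThan_atLeast0)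
  have rbij: "bij_betw (restrict f {0..<j}) {0..<j} T" using bij by (subst bij_betw_cong[where g = f]) auto
  have "homs_from k G P f = {restrict f {0..<j}}"
  proof (intro equalityI subsetI)
    fix \<Phi> assume h: "\<Phi> \<in> homs_from k G P f"
    have "\<Phi> = restrict f {0..<j}"
      by (rule extensionalityI[of _ "{0..<j}"]) (use h V rs in \<open>auto simp: homs_from_def homs_def PiE_def\<close>)
    then show "\<Phi> \<in> {restrict f {0..<j}}" by simp
  next
    fix \<Phi> assume "\<Phi> \<in> {restrict f {0..<j}}"
    then have \<Phi>: "\<Phi> = restrict f {0..<j}" by simp
    have "\<Phi> ` e \<in> edges G" if e: "e \<in> nsets {0..<j} k" for e
    proof -
      have "e \<subseteq> {0..<j}" "card e = k" using e by (auto simp: nsets_def)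
      moreover have "card e \<le> card {0..<j}" by (rule card_mono) (use \<open>e \<subseteq> {0..<j}\<close> in auto)
      ultimately have "e = {0..<j}" "j = k" using j(2) card_subset_eq[of "{0..<j}" e] by auto
      then show ?thesis using T rbij by (simp add: \<Phi> Ej_def bij_betw_def)
    qed
    then show "\<Phi> \<in> homs_from k G P f"
      using bij rbij Tf V Ed rs pl by (auto simp: homs_from_def homs_def \<Phi> bij_betw_def)
  qed
  then show "HS j P f g = g T"
    using rbij by (simp add: hom_sum_def hom_weight_def pl rs bij_betw_def)
qed

end

section \<open>Contraction and convergence\<close>

primrec dist_word :: "nat \<Rightarrow> nat \<Rightarrow> nat list" where
  "dist_word l 0 = []"
| "dist_word l (Suc s) = concat (replicate l (replicate l (Suc s) @ dist_word l s))"

lemma word_op_replicate: "word_op k r G (replicate n s) \<phi> = (distributor k r G s ^^ n) \<phi>"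
  by (induction n) auto

lemma word_op_concat_replicate: "word_op k r G (concat (replicate n ws)) \<phi> = (word_op k r G ws ^^ n) \<phi>"
  by (induction n) auto

lemma iterated_distributor_word: "iterated_distributor k r G l s = word_op k r G (dist_word l s)"
proof (induction s)
  case 0 show ?case by (simp add: fun_eq_iff)
next
  case (Suc s)
  have A: "word_op k r G (replicate l (Suc s) @ dist_word l s) = (distributor k r G (Suc s) ^^ l) \<circ> iterated_distributor k r G l s"
    by (simp add: fun_eq_iff Suc word_op_replicate)
  show ?case by (rule ext) (simp only: iterated_distributor.simps dist_word.simps word_op_concat_replicate A)
qed

lemma set_dist_word: "set (dist_word l s) \<subseteq> {..s}"
  by (induction s) (auto simp: set_replicate_conv_if split: if_splits)

lemma length_dist_word: "l \<ge> 2 \<Longrightarrow> length (dist_word l s) \<le> l ^ (3 * s)"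
proof (induction s)
  case (Suc s)
  let ?a = "l ^ (3 * s)"
  have a: "?a \<ge> 1" using Suc.prems by simp
  have "length (dist_word l (Suc s)) = l * (l + length (dist_word l s))"
    by (simp add: length_concat sum_list_replicate)
  also have "\<dots> \<le> l * (l * ?a + l * ?a)"
    using Suc a by (intro mult_le_mono2 add_mono) (auto intro: order_trans[of _ "1 * ?a"])
  also have "\<dots> \<le> l * (l * (l * ?a))" using Suc.prems by (intro mult_le_mono2) (simp add: mult_2[symmetric])
  also have "\<dots> = l ^ (3 * Suc s)" by (simp add: power_add power3_eq_cube)
  finally show ?case .
qed simp

text \<open>The passage from level \<open>s\<close> to \<open>s + 1\<close>. The factors bound, in this order, the number of
  paths in the unrolling, the absolute weight of an initial segment, the number of semi-automorphisms, the value at a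
  checkpoint and the growth before it.\<close>
definition contraction_factor_step :: "nat \<Rightarrow> nat \<Rightarrow> nat \<Rightarrow> real \<Rightarrow> real \<Rightarrow> real" where
  "contraction_factor_step k r l C D = (2 ^ r + 1) ^ (l ^ (3 * k)) * (weight_growth r ^ (l ^ (3 * k)) *
     (real (semi_iso_bound r (l ^ (3 * k))) * ((C * (256 * 2 ^ k * 4 ^ r * D) + 1) * growth r ^ (l ^ (3 * k)))))"

primrec contraction_factor :: "nat \<Rightarrow> nat \<Rightarrow> nat \<Rightarrow> real \<Rightarrow> nat \<Rightarrow> real" where
  "contraction_factor k r l C 0 = 0"
| "contraction_factor k r l C (Suc s) = contraction_factor_step k r l C (contraction_factor k r l C s)"

lemma contraction_factor_nonneg: "C \<ge> 0 \<Longrightarrow> contraction_factor k r l C s \<ge> 0"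
  using weight_growth_ge[of r] growth_ge[of r] by (induction s) (simp_all add: contraction_factor_step_def)

context regular_host begin

text \<open>Sums over the \<open>j\<close>-sets above \<open>B\<close> and discrepancies at level \<open>b\<close> differ by
  a binomial factor between 1 and \<open>2^k\<close>.\<close>
lemma superset_sum_bounds:
  assumes B: "B \<in> E b" and b: "b \<le> j" "j \<le> k" and X: "X \<ge> 0" and x: "\<And>T. T \<in> E j \<Longrightarrow> \<bar>xi j \<phi> T\<bar> \<le> X"
  shows "\<bar>\<Sum>T\<in>{T\<in>E j. B \<subseteq> T}. xi j \<phi> T\<bar> \<le> 16 * 2 ^ r * X * gam b / gam j"
    and "\<bar>xi b \<phi> B\<bar> \<le> \<bar>\<Sum>T\<in>{T\<in>E j. B \<subseteq> T}. xi j \<phi> T\<bar>"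
    and "\<bar>\<Sum>T\<in>{T\<in>E j. B \<subseteq> T}. xi j \<phi> T\<bar> \<le> 2 ^ k * \<bar>xi b \<phi> B\<bar>"
proof -
  have g: "gam j > 0" using gam_pos b by simp
  have "\<bar>\<Sum>T\<in>{T\<in>E j. B \<subseteq> T}. xi j \<phi> T\<bar> \<le> (\<Sum>T\<in>{T\<in>E j. B \<subseteq> T}. \<bar>xi j \<phi> T\<bar>)" by (rule sum_abs)
  also have "\<dots> \<le> real (card {T\<in>E j. B \<subseteq> T}) * X" using x by (intro sum_bounded_above) auto
  also have "\<dots> \<le> (4 * 2 ^ r * kc B / gam j) * X" using supersets_bound[OF B b] X by (rule mult_right_mono)
  also have "\<dots> \<le> (4 * 2 ^ r * (4 * gam b) / gam j) * X"
    using kc_regular(2)[OF B] b X g by (intro mult_right_mono divide_right_mono mult_left_mono) auto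
  finally show "\<bar>\<Sum>T\<in>{T\<in>E j. B \<subseteq> T}. xi j \<phi> T\<bar> \<le> 16 * 2 ^ r * X * gam b / gam j" by (simp add: mult_ac)
  let ?n = "(k - b) choose (j - b)"
  have "?n > 0" using b by (simp add: zero_less_binomial_iff)
  then have n1: "1 \<le> real ?n" by linarith
  have "?n \<le> 2 ^ (k - b)" by (rule binomial_le_pow2)
  also have "\<dots> \<le> 2 ^ k" by (rule power_increasing) auto
  finally have n2: "real ?n \<le> 2 ^ k" by (metis of_nat_le_iff of_nat_numeral of_nat_power)
  have eq: "\<bar>\<Sum>T\<in>{T\<in>E j. B \<subseteq> T}. xi j \<phi> T\<bar> = real ?n * \<bar>xi b \<phi> B\<bar>"
    unfolding discrepancy_superset_sum[OF B b] by (simp add: abs_mult)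
  show "\<bar>xi b \<phi> B\<bar> \<le> \<bar>\<Sum>T\<in>{T\<in>E j. B \<subseteq> T}. xi j \<phi> T\<bar>"
    unfolding eq using mult_right_mono[OF n1, of "\<bar>xi b \<phi> B\<bar>"] by simp
  show "\<bar>\<Sum>T\<in>{T\<in>E j. B \<subseteq> T}. xi j \<phi> T\<bar> \<le> 2 ^ k * \<bar>xi b \<phi> B\<bar>"
    unfolding eq using n2 by (intro mult_right_mono) auto
qed

text \<open>At a checkpoint a run of the word for level \<open>s\<close> has just ended, so all discrepancies at levels up to
  \<open>s\<close> are of order \<open>\<epsilon>\<close>. This is the input that the stopped paths need.\<close>
lemma contraction_step:
  assumes j: "Suc s \<le> k" and c: "c \<ge> 1" and l: "l \<ge> 2" "l \<ge> c ^ k + 1" and C0: "C \<ge> 0" and D: "D \<ge> 0"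
    and IH: "\<And>\<phi> X S. xi 0 \<phi> {} = 0 \<Longrightarrow> X \<ge> 0 \<Longrightarrow> (\<And>S. S \<in> E s \<Longrightarrow> \<bar>xi s \<phi> S\<bar> \<le> X) \<Longrightarrow> S \<in> E s \<Longrightarrow>
       \<bar>xi s (wop (dist_word l s) \<phi>) S\<bar> \<le> D * \<epsilon> * X"
    and z: "xi 0 \<phi> {} = 0" and X: "X \<ge> 0" and x: "\<And>S. S \<in> E (Suc s) \<Longrightarrow> \<bar>xi (Suc s) \<phi> S\<bar> \<le> X" and S: "S \<in> E (Suc s)"
  shows "\<bar>xi (Suc s) (wop (dist_word l (Suc s)) \<phi>) S\<bar> \<le> contraction_factor_step k r l C D * \<epsilon> * X"
proof -
  define ws where "ws = dist_word l s"
  define L where "L = l ^ (3 * k)"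
  define \<phi>s where "\<phi>s i = wop (concat (replicate i (replicate l (Suc s) @ ws))) \<phi>" for i
  \<comment> \<open>A bound for all discrepancies at level \<open>Suc s\<close> that occur while the word is applied.\<close>
  define X' where "X' = growth r ^ L * X"
  have X': "X' \<ge> 0" using growth_ge[of r] X by (simp add: X'_def)
  have ws: "set ws \<subseteq> {..s}" unfolding ws_def by (rule set_dist_word)
  then have wsj: "set ws \<subseteq> {..Suc s}" by auto
  have total: "l * (l + length ws) \<le> L"
  proof -
    have "l * (l + length ws) = length (dist_word l (Suc s))" by (simp add: ws_def length_concat sum_list_replicate)
    also have "\<dots> \<le> l ^ (3 * Suc s)" by (rule length_dist_word[OF l(1)])
    also have "\<dots> \<le> L" unfolding L_def using l j by (intro power_increasing) auto
    finally show ?thesis .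
  qed
  have grow: "growth r ^ n * X \<le> X'" if "n \<le> L" for n
    unfolding X'_def using growth_ge[of r] X that by (intro mult_right_mono power_increasing)
  let ?w = "\<lambda>i. concat (replicate i (replicate l (Suc s) @ ws))"
  have setw: "set (?w i) \<subseteq> {..Suc s}" for i using wsj by (auto simp: set_replicate_conv_if split: if_splits)
  have lenw: "length (?w i) = i * (l + length ws)" for i by (simp add: length_concat sum_list_replicate)
  have lenw': "length (?w i) + length ws \<le> L" if "i < l" for i
  proof -
    have "length (?w i) + length ws \<le> Suc i * (l + length ws)" unfolding lenw by simp
    also have "\<dots> \<le> l * (l + length ws)" using that by (intro mult_le_mono1) simp
    finally show ?thesis using total by simp
  qed
  have b\<phi>: "\<bar>xi (Suc s) (\<phi>s i) T\<bar> \<le> X'" if "i < l" "T \<in> E (Suc s)" for i T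
  proof -
    have "\<bar>xi (Suc s) (\<phi>s i) T\<bar> \<le> growth r ^ length (?w i) * X"
      unfolding \<phi>s_def by (rule discrepancy_word_bound[OF j setw X x that(2)])
    also have "\<dots> \<le> X'" using lenw'[OF that(1)] by (intro grow) simp
    finally show ?thesis .
  qed
  have b\<psi>: "\<bar>xi (Suc s) (wop ws (\<phi>s i)) T\<bar> \<le> X'" if "i < l" "T \<in> E (Suc s)" for i T
  proof -
    have "\<bar>xi (Suc s) (wop (ws @ ?w i) \<phi>) T\<bar> \<le> growth r ^ length (ws @ ?w i) * X"
      by (rule discrepancy_word_bound[OF j _ X x that(2)]) (use wsj setw in auto)
    also have "\<dots> \<le> X'" using lenw'[OF that(1)] by (intro grow) simp
    finally show ?thesis by (simp add: \<phi>s_def)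
  qed
  \<comment> \<open>The bound at a checkpoint for the levels up to \<open>s\<close>: down to level \<open>s\<close>, contraction there, and further down.\<close>
  define Y where "Y = 256 * 2 ^ k * 4 ^ r * D * \<epsilon> * X'"
  have Y0: "Y \<ge> 0" using D X' eps by (simp add: Y_def)
  have bY: "\<bar>\<Sum>T\<in>{T\<in>E (Suc s). B \<subseteq> T}. xi (Suc s) (wop ws (\<phi>s i)) T\<bar> \<le> Y * gam b / gam (Suc s)"
    if i: "i < l" and b: "b < Suc s" and B: "B \<in> E b" for i b B
  proof -
    have g: "gam s > 0" "gam b > 0" "gam (Suc s) > 0" using gam_pos j b by auto
    let ?X1 = "16 * 2 ^ r * X' * gam s / gam (Suc s)"
    have X1: "?X1 \<ge> 0" using X' g by simp
    have 1: "\<bar>xi s (\<phi>s i) B'\<bar> \<le> ?X1" if "B' \<in> E s" for B'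
      using superset_sum_bounds(1,2)[OF that _ j X' b\<phi>[OF i]] by (meson le_SucI le_refl order_trans)
    have "xi 0 (\<phi>s i) {} = 0"
      unfolding \<phi>s_def using setw[of i] j by (intro word_keeps_balance[OF z]) (auto simp: subset_iff)
    then have 2: "\<bar>xi s (wop ws (\<phi>s i)) B'\<bar> \<le> D * \<epsilon> * ?X1" if "B' \<in> E s" for B'
      unfolding ws_def by (intro IH[OF _ X1 1 that])
    have X2: "D * \<epsilon> * ?X1 \<ge> 0" by (intro mult_nonneg_nonneg X1) (use D eps in auto)
    have 3: "\<bar>xi b (wop ws (\<phi>s i)) B\<bar> \<le> 16 * 2 ^ r * (D * \<epsilon> * ?X1) * gam b / gam s"
      using superset_sum_bounds(1,2)[OF B _ _ X2 2] b j by (meson Suc_leD less_Suc_eq_le order_trans)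
    have "\<bar>\<Sum>T\<in>{T\<in>E (Suc s). B \<subseteq> T}. xi (Suc s) (wop ws (\<phi>s i)) T\<bar> \<le> 2 ^ k * \<bar>xi b (wop ws (\<phi>s i)) B\<bar>"
      using superset_sum_bounds(3)[OF B _ j X' b\<psi>[OF i]] b by simp
    also have "\<dots> \<le> 2 ^ k * (16 * 2 ^ r * (D * \<epsilon> * ?X1) * gam b / gam s)" using 3 by (intro mult_left_mono) auto
    also have "\<dots> = Y * gam b / gam (Suc s)"
    proof -
      have "(4::real) ^ r = 2 ^ r * 2 ^ r" by (simp add: power_mult_distrib[symmetric])
      then show ?thesis using g by (simp add: Y_def field_simps)
    qed
    finally show ?thesis .
  qed
  define P0 where "P0 = (([], [[0..<Suc s]]) :: cpath)"
  define f where "f = (\<lambda>i. sorted_list_of_set S ! i)"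
  note triv = hom_sum_trivial_path[OF _ j S, folded P0_def f_def]
  have cl: "c ^ Suc s + 1 \<le> l"
    using power_increasing[OF j c] l by simp
  let ?Z = "weight_growth r ^ L * (real (semi_iso_bound r L) * (C * Y + \<epsilon> * X'))"
  have Z0: "?Z \<ge> 0" using weight_growth_ge[of r] C0 Y0 X' eps by simp
  have "\<bar>HS (Suc s) P0 f (xi (Suc s) (\<phi>s l))\<bar> \<le> (2 ^ r + 1) ^ (l * (l + length ws)) * ?Z"
    unfolding \<phi>s_def L_def
  proof (rule hom_sum_blocks[OF _ j c _ C0 wsj X' Y0, where n = l and I = "{}"])
    show "\<bar>xi (Suc s) (wop ws (wop (?w i) \<phi>)) T\<bar> \<le> X'" if "i < l" "T \<in> E (Suc s)" for i T
      using b\<psi>[OF that] by (simp add: \<phi>s_def)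
    show "\<bar>\<Sum>T\<in>{T\<in>E (Suc s). B \<subseteq> T}. xi (Suc s) (wop ws (wop (?w i) \<phi>)) T\<bar> \<le> Y * gam b / gam (Suc s)"
      if "i < l" "b < Suc s" "B \<in> E b" for i b B
      using bY[OF that] by (simp add: \<phi>s_def)
    show "plen P0 + l * (l + length ws) \<le> l ^ (3 * k)" using total triv(3) by (simp add: L_def)
  qed (use l cl triv in auto)
  also have "\<dots> \<le> (2 ^ r + 1) ^ L * ?Z"
    using total Z0 by (intro mult_right_mono power_increasing) auto
  also have "\<dots> = contraction_factor_step k r l C D * \<epsilon> * X"
    by (simp add: contraction_factor_step_def Y_def X'_def L_def algebra_simps)
  finally show ?thesis using triv(4) by (simp add: \<phi>s_def ws_def)
qed

text \<open>Induction on the level. At level 0 the only discrepancy is the total one, which is 0 for a balanced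
  function.\<close>
lemma contraction:
  assumes c: "c \<ge> 1" and l: "l \<ge> 2" "l \<ge> c ^ k + 1" and C0: "C \<ge> 0"
  shows "s \<le> k \<Longrightarrow> xi 0 \<phi> {} = 0 \<Longrightarrow> X \<ge> 0 \<Longrightarrow> (\<And>S. S \<in> E s \<Longrightarrow> \<bar>xi s \<phi> S\<bar> \<le> X) \<Longrightarrow> S \<in> E s \<Longrightarrow>
    \<bar>xi s (wop (dist_word l s) \<phi>) S\<bar> \<le> contraction_factor k r l C s * \<epsilon> * X"
proof (induction s arbitrary: \<phi> X S)
  case 0
  then have "S = {}" using E_D[of S 0] by auto
  then show ?case using 0 by simp
next
  case (Suc s)
  show ?case
    unfolding contraction_factor.simps
    by (rule contraction_step[OF Suc.prems(1) c l C0 contraction_factor_nonneg[OF C0] _ Suc.prems(2,3,4,5)])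
      (use Suc.IH Suc.prems(1) in auto)
qed

text \<open>The correction on \<open>K\<close> is of the order of the edge discrepancies times \<open>1 / gam k\<close>, that
  is, small compared with the initial value on \<open>K\<close>.\<close>
lemma distributor_change:
  assumes s: "s \<le> k" and X: "X \<ge> 0" and x: "\<And>e. e \<in> E k \<Longrightarrow> \<bar>xi k \<phi> e\<bar> \<le> X" and K: "K \<in> Cl {}"
  shows "\<bar>Rd s \<phi> K - \<phi> K\<bar> \<le> 4 * 4 ^ r * X / gam k"
proof -
  have g: "gam k > 0" using gam_pos by simp
  let ?b = "4 * 2 ^ r * X / gam k"
  have one: "\<bar>xi s \<phi> S / kc S\<bar> \<le> ?b" if "S \<in> nsets K s" for S
  proof -
    have S: "S \<in> E s" using nsets_Cl_E[OF K that] .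
    have kp: "kc S > 0" using kc_pos[OF S s] .
    have "\<bar>xi s \<phi> S\<bar> \<le> \<bar>\<Sum>T\<in>{T\<in>E k. S \<subseteq> T}. xi k \<phi> T\<bar>" by (rule superset_sum_bounds(2)[OF S s le_refl X x])
    also have "\<dots> \<le> (\<Sum>T\<in>{T\<in>E k. S \<subseteq> T}. \<bar>xi k \<phi> T\<bar>)" by (rule sum_abs)
    also have "\<dots> \<le> real (card {T\<in>E k. S \<subseteq> T}) * X" using x by (intro sum_bounded_above) auto
    also have "\<dots> \<le> (4 * 2 ^ r * kc S / gam k) * X" using supersets_bound[OF S s le_refl] X by (rule mult_right_mono)
    also have "\<dots> = ?b * kc S" by simp
    finally show ?thesis using kp by (simp add: abs_divide pos_divide_le_eq)
  qed
  have b0: "?b \<ge> 0" using X g by simp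
  have "\<bar>\<Sum>S\<in>nsets K s. xi s \<phi> S / kc S\<bar> \<le> (\<Sum>S\<in>nsets K s. \<bar>xi s \<phi> S / kc S\<bar>)" by (rule sum_abs)
  also have "\<dots> \<le> real (card (nsets K s)) * ?b" using one by (rule sum_bounded_above)
  also have "\<dots> \<le> 2 ^ r * ?b"
  proof (rule mult_right_mono[OF _ b0])
    have "card (nsets K s) \<le> card (Pow K)" using cliquesD(2)[OF K] by (intro card_mono) (auto simp: nsets_def)
    also have "\<dots> = 2 ^ r" using cliquesD(2,3)[OF K] by (simp add: card_Pow)
    finally show "real (card (nsets K s)) \<le> 2 ^ r" by (metis of_nat_le_iff of_nat_numeral of_nat_power)
  qed
  also have "\<dots> = 4 * 4 ^ r * X / gam k"
  proof -
    have "(4::real) ^ r = 2 ^ r * 2 ^ r" by (simp add: power_mult_distrib[symmetric])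
    then show ?thesis by simp
  qed
  finally have A: "\<bar>\<Sum>S\<in>nsets K s. xi s \<phi> S / kc S\<bar> \<le> 4 * 4 ^ r * X / gam k" .
  let ?n = "(r - s) choose (k - s)"
  have "?n > 0" using s rk by (simp add: zero_less_binomial_iff)
  then have n1: "1 \<le> real ?n" by linarith
  have "\<bar>Rd s \<phi> K - \<phi> K\<bar> = (1 / real ?n) * \<bar>\<Sum>S\<in>nsets K s. xi s \<phi> S / kc S\<bar>"
    by (simp add: distributor_def abs_mult)
  also have "\<dots> \<le> 1 * (4 * 4 ^ r * X / gam k)"
    using frac_le[of 1 1 1 "real ?n", OF _ _ _ n1] A by (intro mult_mono) simp_all
  finally show ?thesis by simp
qed

lemma word_change:
  assumes X: "X \<ge> 0" and x: "\<And>e. e \<in> E k \<Longrightarrow> \<bar>xi k \<phi> e\<bar> \<le> X" and K: "K \<in> Cl {}"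
  shows "set ws \<subseteq> {..k} \<Longrightarrow> \<bar>wop ws \<phi> K - \<phi> K\<bar> \<le> real (length ws) * (growth r ^ length ws * (4 * 4 ^ r * X / gam k))"
proof (induction ws)
  case (Cons s ws)
  have g: "gam k > 0" using gam_pos by simp
  let ?g = "growth r ^ length ws" and ?c = "4 * 4 ^ r * X / gam k"
  have c0: "?c \<ge> 0" using g X by simp
  have g1: "growth r \<ge> 1" by (rule growth_ge)
  have gg: "?g * ?c \<le> growth r ^ length (s # ws) * ?c" using g1 c0 by (intro mult_right_mono power_increasing) auto
  have "\<bar>Rd s (wop ws \<phi>) K - wop ws \<phi> K\<bar> \<le> 4 * 4 ^ r * (?g * X) / gam k"
  proof (rule distributor_change[OF _ _ _ K])
    show "s \<le> k" using Cons.prems by simp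
    show "0 \<le> ?g * X" using g1 X by simp
    show "\<bar>xi k (wop ws \<phi>) e\<bar> \<le> ?g * X" if "e \<in> E k" for e
      by (rule discrepancy_word_bound[OF le_refl _ X x that]) (use Cons.prems in auto)
  qed
  also have "\<dots> = ?g * ?c" by simp
  finally have 1: "\<bar>Rd s (wop ws \<phi>) K - wop ws \<phi> K\<bar> \<le> growth r ^ length (s # ws) * ?c" using gg by linarith
  have "\<bar>wop ws \<phi> K - \<phi> K\<bar> \<le> real (length ws) * (?g * ?c)" using Cons by simp
  also have "\<dots> \<le> real (length ws) * (growth r ^ length (s # ws) * ?c)" using gg by (rule mult_left_mono) simp
  finally have 2: "\<bar>wop ws \<phi> K - \<phi> K\<bar> \<le> real (length ws) * (growth r ^ length (s # ws) * ?c)" .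
  have "\<bar>wop (s # ws) \<phi> K - \<phi> K\<bar> \<le> \<bar>Rd s (wop ws \<phi>) K - wop ws \<phi> K\<bar> + \<bar>wop ws \<phi> K - \<phi> K\<bar>" by simp
  also have "\<dots> \<le> growth r ^ length (s # ws) * ?c + real (length ws) * (growth r ^ length (s # ws) * ?c)"
    using 1 2 by (rule add_mono)
  also have "\<dots> = real (length (s # ws)) * (growth r ^ length (s # ws) * ?c)"
    by (simp only: list.size(4) add.commute[of _ "Suc 0"] plus_1_eq_Suc of_nat_Suc distrib_right mult_1 add_0_right add_Suc_right)
  finally show ?case .
qed simp

end

definition change_const :: "nat \<Rightarrow> nat \<Rightarrow> nat \<Rightarrow> real" where
  "change_const k r l = real (length (dist_word l k)) * (growth r ^ length (dist_word l k) * (4 * 4 ^ r))"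

context regular_host begin

text \<open>A balanced uniform function has the value \<open>1 / gam k\<close>, and then the discrepancy of an edge is the
  relative error of its clique count.\<close>
lemma uniform_start:
  assumes u: "uniform k r G \<phi>" and gb: "globally_balanced k r G \<phi>"
  shows "\<And>K. K \<in> Cl {} \<Longrightarrow> \<phi> K = 1 / gam k" "\<And>e. e \<in> E k \<Longrightarrow> \<bar>xi k \<phi> e\<bar> \<le> \<epsilon>" "xi 0 \<phi> {} = 0"
proof -
  obtain a where a: "\<And>K. K \<in> Cl {} \<Longrightarrow> \<phi> K = a" using u by (auto simp: uniform_def)
  have g: "gam k > 0" using gam_pos by simp
  have n: "real (r choose k) > 0" using rk by (simp add: zero_less_binomial_iff)
  have e: "edges G \<noteq> {}" using E_ne[of k] by (simp add: Ej_def)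
  have "kc {} * a = inverse (real (r choose k)) * real (card (edges G))"
    using gb a by (simp add: globally_balanced_def)
  then have "kc {} * real (r choose k) * a = real (card (edges G))" using n by (simp add: field_simps)
  then have "gam k * a = 1" using e by (simp add: gamma_def Ej_def field_simps)
  then have a1: "a = 1 / gam k" using g by (simp add: field_simps)
  show "\<phi> K = 1 / gam k" if "K \<in> Cl {}" for K using a[OF that] a1 by simp
  show "\<bar>xi k \<phi> e\<bar> \<le> \<epsilon>" if e: "e \<in> E k" for e
  proof -
    have "K \<in> Cl {}" if "K \<in> Cl e" for K using that by (auto simp: cliques_def)
    then have "edge_weight k r G \<phi> e = (\<Sum>K\<in>Cl e. a)" unfolding edge_weight_def using a by (intro sum.cong) auto
    then have "xi k \<phi> e = kc e / gam k - 1" using a1 by (simp add: discrepancy_def)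
    moreover have "(1 - \<epsilon>) * gam k \<le> kc e" "kc e \<le> (1 + \<epsilon>) * gam k"
      using edge_cliques_regular[of e] e by (auto simp: Ej_def approx_within_def)
    then have "1 - \<epsilon> \<le> kc e / gam k" "kc e / gam k \<le> 1 + \<epsilon>" using g by (simp_all add: pos_le_divide_eq pos_divide_le_eq)
    ultimately show ?thesis by simp
  qed
  have e0: "{} \<in> E 0" using k2 by (simp add: Ej_def nsets_def)
  have "(\<Sum>e\<in>enbhd G {}. edge_weight k r G \<phi> e) = real (r choose k) * (\<Sum>K\<in>Cl {}. \<phi> K)"
    unfolding edge_weight_def using sum_cliques_over_edges[OF e0, of \<phi>] by simp
  also have "\<dots> = real (card (edges G))" using gb n by (simp add: globally_balanced_def)
  finally have "(\<Sum>e\<in>enbhd G {}. edge_weight k r G \<phi> e) = real (card (edges G))" .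
  then show "xi 0 \<phi> {} = 0" using discrepancy_eq_sum[OF e0, of \<phi>] by (simp add: sum_subtractf enbhd_def)
qed

text \<open>The discrepancies halve in each round, so the changes on a clique are dominated by a geometric series with sum at
  most the initial value \<open>1 / gam k\<close>.\<close>
lemma iteration_converges:
  assumes c: "c \<ge> 1" and l: "l \<ge> 2" "l \<ge> c ^ k + 1" and C0: "C \<ge> 0"
    and e1: "contraction_factor k r l C k * \<epsilon> \<le> 1 / 2" and e2: "2 * change_const k r l * \<epsilon> \<le> 1"
    and u: "uniform k r G \<phi>" and gb: "globally_balanced k r G \<phi>"
  shows "\<exists>\<psi>. (\<forall>K\<in>Cl {}. (\<lambda>t. ((iterated_distributor k r G l k ^^ t) \<phi>) K) \<longlonglongrightarrow> \<psi> K) \<and> fractional_decomposition k r G \<psi>"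
proof -
  define \<phi>t where "\<phi>t t = (iterated_distributor k r G l k ^^ t) \<phi>" for t
  let ?ws = "dist_word l k"
  have g: "gam k > 0" using gam_pos by simp
  note start = uniform_start[OF u gb]
  have suc: "\<phi>t (Suc t) = wop ?ws (\<phi>t t)" for t by (simp add: \<phi>t_def iterated_distributor_word)
  have z: "xi 0 (\<phi>t t) {} = 0" for t
  proof (induction t)
    case 0 then show ?case using start(3) by (simp add: \<phi>t_def)
  next
    case (Suc t) then show ?case unfolding suc by (rule word_keeps_balance[OF _ set_dist_word])
  qed
  define h where "h t = (1 / 2) ^ t * \<epsilon>" for t :: nat
  have h0: "h t \<ge> 0" for t using eps by (simp add: h_def)
  have dec: "\<bar>xi k (\<phi>t t) e\<bar> \<le> h t" if "e \<in> E k" for t e using that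
  proof (induction t arbitrary: e)
    case 0 then show ?case using start(2) by (simp add: \<phi>t_def h_def)
  next
    case (Suc t)
    have "\<bar>xi k (wop ?ws (\<phi>t t)) e\<bar> \<le> contraction_factor k r l C k * \<epsilon> * h t"
      by (rule contraction[OF c l C0 le_refl z h0 Suc.IH Suc.prems])
    also have "\<dots> \<le> 1 / 2 * h t" using e1 h0 by (rule mult_right_mono)
    finally show ?case by (simp add: suc h_def)
  qed
  \<comment> \<open>The change in the first round; round \<open>t\<close> changes a clique by at most \<open>(1/2)^t * M\<close>.\<close>
  define M where "M = change_const k r l * \<epsilon> / gam k"
  have ch: "\<bar>\<phi>t (Suc t) K - \<phi>t t K\<bar> \<le> (1 / 2) ^ t * M" if K: "K \<in> Cl {}" for t K
  proof -
    have "\<bar>\<phi>t (Suc t) K - \<phi>t t K\<bar> \<le> real (length ?ws) * (growth r ^ length ?ws * (4 * 4 ^ r * h t / gam k))"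
      unfolding suc by (rule word_change[OF h0 dec K set_dist_word])
    also have "\<dots> = (1 / 2) ^ t * M" by (simp add: M_def change_const_def h_def)
    finally show ?thesis .
  qed
  have M0: "M \<ge> 0" using growth_ge[of r] eps g by (simp add: M_def change_const_def)
  have M1: "2 * M \<le> 1 / gam k" using e2 g by (simp add: M_def field_simps)
  have geo: "summable (\<lambda>t. (1 / 2) ^ t * M)" by (intro summable_mult2 summable_geometric) simp
  define d where "d K t = \<phi>t (Suc t) K - \<phi>t t K" for K t
  define \<psi> where "\<psi> K = \<phi> K + suminf (d K)" for K
  have sumd: "summable (d K)" if "K \<in> Cl {}" for K
    by (rule summable_comparison_test'[OF geo, of 0]) (use ch[OF that] in \<open>simp add: d_def\<close>)
  have tel: "(\<Sum>i<t. d K i) = \<phi>t t K - \<phi> K" for t K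
    unfolding d_def by (subst sum_lessThan_telescope) (simp add: \<phi>t_def)
  have lim: "(\<lambda>t. \<phi>t t K) \<longlonglongrightarrow> \<psi> K" if K: "K \<in> Cl {}" for K
  proof -
    have "(\<lambda>t. \<phi> K + (\<Sum>i<t. d K i)) \<longlonglongrightarrow> \<phi> K + suminf (d K)"
      by (intro tendsto_add tendsto_const summable_LIMSEQ sumd K)
    then show ?thesis by (simp add: tel \<psi>_def)
  qed
  have pos: "\<phi>t t K \<ge> 0" if K: "K \<in> Cl {}" for t K
  proof -
    have "\<bar>\<Sum>i<t. d K i\<bar> \<le> (\<Sum>i<t. \<bar>d K i\<bar>)" by (rule sum_abs)
    also have "\<dots> \<le> (\<Sum>i<t. (1 / 2) ^ i * M)" using ch[OF K] by (intro sum_mono) (simp add: d_def)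
    also have "\<dots> \<le> (\<Sum>i. (1 / 2) ^ i * M)" using geo M0 by (intro sum_le_suminf) auto
    also have "\<dots> = (\<Sum>i. (1 / 2) ^ i) * M" by (rule suminf_mult2[symmetric]) (simp add: summable_geometric)
    also have "\<dots> = 2 * M" by (simp add: suminf_geometric)
    finally show ?thesis using M1 start(1)[OF K] by (simp add: tel)
  qed
  have "fractional_decomposition k r G \<psi>"
    unfolding fractional_decomposition_def
  proof (intro conjI ballI)
    fix K assume K: "K \<in> Cl {}"
    show "0 \<le> \<psi> K" using lim[OF K] pos[OF K] by (intro LIMSEQ_le_const[OF lim[OF K]]) auto
  next
    fix e assume e: "e \<in> edges G"
    have "(\<lambda>t. edge_weight k r G (\<phi>t t) e) \<longlonglongrightarrow> edge_weight k r G \<psi> e"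
      unfolding edge_weight_def by (intro tendsto_sum lim) (auto simp: cliques_def)
    moreover have "(\<lambda>t. edge_weight k r G (\<phi>t t) e) \<longlonglongrightarrow> 1"
    proof -
      have "(\<lambda>t. h t) \<longlonglongrightarrow> 0 * \<epsilon>" unfolding h_def by (intro tendsto_mult tendsto_const LIMSEQ_power_zero) simp
      then have h00: "h \<longlonglongrightarrow> 0" by simp
      have "(\<lambda>t. xi k (\<phi>t t) e) \<longlonglongrightarrow> 0"
        by (rule tendsto_rabs_zero_cancel, rule tendsto_sandwich[OF _ _ tendsto_const h00])
          (use dec[of e] e in \<open>auto simp: Ej_def\<close>)
      then have "(\<lambda>t. (edge_weight k r G (\<phi>t t) e - 1) + 1) \<longlonglongrightarrow> 0 + 1"
        by (intro tendsto_add tendsto_const) (simp add: discrepancy_def)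
      then show ?thesis by simp
    qed
    ultimately show "edge_weight k r G \<psi> e = 1" by (rule LIMSEQ_unique)
  qed
  then show ?thesis using lim unfolding \<phi>t_def by blast
qed

end

text \<open>The three bounds give the clique counts within a factor 4, contraction by one half, and a total change of at most
  the initial value.\<close>
definition \<epsilon>_bound :: "nat \<Rightarrow> nat \<Rightarrow> nat \<Rightarrow> real \<Rightarrow> real" where
  "\<epsilon>_bound k r l C = min (1 / 2) (min (1 / (2 * (contraction_factor k r l C k + 1))) (1 / (2 * (change_const k r l + 1))))"

theorem theorem1p3:
  fixes k r :: nat
  assumes "k \<ge> 2" and "r \<ge> k + 1"
  shows "\<forall>c::nat\<ge>1. \<exists>l0::nat\<ge>1. \<forall>l\<ge>l0. \<exists>C0::real>0. \<forall>C\<ge>C0. \<exists>(n0::nat) (\<epsilon>0::real). \<epsilon>0 > 0 \<and>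
    (\<forall>n \<epsilon> G \<phi>.
       n \<ge> n0 \<and> 0 < \<epsilon> \<and> \<epsilon> \<le> \<epsilon>0 \<and>
       kgraph k G \<and> verts G = {1..n} \<and>
       clique_regular k r l c C \<epsilon> G \<and>
       (\<forall>S\<subseteq>verts G. S \<in> edges G \<or> card S < k \<longrightarrow> cliques k r G S \<noteq> {}) \<and>
       uniform k r G \<phi> \<and> globally_balanced k r G \<phi> \<longrightarrow>
       (\<exists>\<psi>. (\<forall>K\<in>cliques k r G {}.
               (\<lambda>t. ((iterated_distributor k r G l k ^^ t) \<phi>) K) \<longlonglongrightarrow> \<psi> K) \<and>
            fractional_decomposition k r G \<psi>))"
proof -
  have main: "\<exists>\<psi>. (\<forall>K\<in>cliques k r G {}. (\<lambda>t. ((iterated_distributor k r G l k ^^ t) \<phi>) K) \<longlonglongrightarrow> \<psi> K) \<and>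
      fractional_decomposition k r G \<psi>"
    if c: "1 \<le> c" and l: "c ^ k + 2 \<le> l" and C: "1 \<le> C" and e: "0 < \<epsilon>" "\<epsilon> \<le> \<epsilon>_bound k r l C"
      and h: "kgraph k G" "clique_regular k r l c C \<epsilon> G"
        "\<forall>S\<subseteq>verts G. S \<in> edges G \<or> card S < k \<longrightarrow> cliques k r G S \<noteq> {}"
        "uniform k r G \<phi>" "globally_balanced k r G \<phi>"
    for c l :: nat and C \<epsilon> :: real and G :: hgraph and \<phi> :: "nat set \<Rightarrow> real"
  proof -
    let ?D = "contraction_factor k r l C k" and ?M = "change_const k r l"
    have D: "?D \<ge> 0" using C by (intro contraction_factor_nonneg) simp
    have M: "?M \<ge> 0" using growth_ge[of r] by (simp add: change_const_def)
    have e': "\<epsilon> \<le> 1 / 2" "\<epsilon> \<le> 1 / (2 * (?D + 1))" "\<epsilon> \<le> 1 / (2 * (?M + 1))"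
      using e by (auto simp: \<epsilon>_bound_def)
    interpret regular_host k r G l c C \<epsilon>
      using assms h e e' by unfold_locales auto
    have "(?D + 1) * \<epsilon> \<le> 1 / 2" using e'(2) D by (simp add: pos_le_divide_eq algebra_simps)
    then have e1: "?D * \<epsilon> \<le> 1 / 2" using e(1) by (simp add: algebra_simps)
    have "2 * (?M + 1) * \<epsilon> \<le> 1" using e'(3) M by (simp add: pos_le_divide_eq algebra_simps)
    then have e2: "2 * ?M * \<epsilon> \<le> 1" using e(1) by (simp add: algebra_simps)
    show ?thesis by (rule iteration_converges[OF c _ _ _ e1 e2]) (use l C h in auto)
  qed
  have pos: "\<epsilon>_bound k r l C > 0" if "1 \<le> C" for l C
  proof -
    have "contraction_factor k r l C k \<ge> 0" using that by (intro contraction_factor_nonneg) simp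
    moreover have "change_const k r l \<ge> 0" using growth_ge[of r] by (simp add: change_const_def)
    ultimately show ?thesis by (simp add: \<epsilon>_bound_def)
  qed
  show ?thesis
    apply (intro allI impI)
    subgoal premises c for c
      \<comment> \<open>More than \<open>c ^ j\<close> checkpoints for every level \<open>j \<le> k\<close>, and \<open>l \<ge> 2\<close> so that the unrolled paths have length at most \<open>l ^ (3 * k)\<close>.\<close>
      apply (rule exI[of _ "c ^ k + 2"])
      apply (intro conjI allI impI)
      subgoal by simp
      subgoal premises l for l
        \<comment> \<open>Any positive constant will do, since \<open>\<epsilon>\<close> is chosen after \<open>C\<close>.\<close>
        apply (rule exI[of _ 1])
        apply (intro conjI allI impI)
        subgoal by simp
        subgoal premises C for C
          apply (rule exI[of _ 0], rule exI[of _ "\<epsilon>_bound k r l C"])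
          apply (intro conjI allI impI)
          subgoal by (rule pos[OF C])
          subgoal for n \<epsilon> G \<phi> by (rule main[OF c l C]) auto
          done
        done
      done
    done
qed

end
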